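(* Fix $k_0\in\mathbb{N}$, real numbers $\sigma_1,\sigma_2,\sigma_0^1,\dots,\sigma_0^{12}$ and $\delta>0$ satisfying the strip conditions of the context, and an admissible set $\{U_1,\dots,U_{n_0}\}$ as in the context. There is $L_0>0$ such that for all integers $L\ge L_0$ and all integers $k_1,\dots,k_9$ with $1\le k_l\le k_0$ the following holds. For every $n=1,\dots,n_0$ there exist points $$\alpha_0^{l,k_l,n}\in(\pi L,\pi L+U_n),\qquad \alpha_r^{l,k_l,n},\ \beta_r^{k_l,n}\in\big((\pi L)^{(r)},(\pi L+U_n)^{(r)}\big),\quad r=1,\dots,k_l,\ l=1,\dots,9,$$ where $\alpha_r^{l,k_l,n}$ depends only on $U_n,\pi L,k_l,f_l$ (and $r$) and $\beta_r^{k_l,n}$ depends only on $U_n,\pi L,k_l$ (and $r$), and there exist infinite sets $W_l^n\subset S^l_{\sigma_0^l,\delta}$, $l=1,\dots,12$, such that every choice of $w_l^n\in W_l^n$ satisfies $$|\zeta(w_l^n)|=f_l(\alpha_0^{l,k_l,n}),\ l=1,\dots,9;\qquad |\zeta(w_l^n)|=f_l(U_n),\ l=10,11,12,$$ and, writing $$P_l^n=\prod_{r=1}^{k_l}\frac{\tilde Z^2(\alpha_r^{l,k_l,n})}{\tilde Z^2(\beta_r^{k_l,n})},\qquad l=1,\dots,9,$$ one has the equalities $$|\zeta(w_1^n)|P_1^n=\tfrac12-\tfrac12|\zeta(w_{10}^n)|,$$ $$|\zeta(w_2^n)|P_2^n=\tfrac12+\tfrac12|\zeta(w_{10}^n)|,$$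 $$|\zeta(w_3^n)|P_3^n=\tfrac38-\tfrac12|\zeta(w_{10}^n)|+\tfrac18|\zeta(w_{11}^n)|,$$ $$|\zeta(w_4^n)|P_4^n=\tfrac38+\tfrac12|\zeta(w_{10}^n)|+\tfrac18|\zeta(w_{11}^n)|,$$ $$|\zeta(w_5^n)|P_5^n=\tfrac5{16}-\tfrac{15}{32}|\zeta(w_{10}^n)|+\tfrac3{16}|\zeta(w_{11}^n)|-\tfrac1{32}|\zeta(w_{12}^n)|,$$ $$|\zeta(w_6^n)|P_6^n=\tfrac5{16}+\tfrac{15}{32}|\zeta(w_{10}^n)|+\tfrac3{16}|\zeta(w_{11}^n)|+\tfrac1{32}|\zeta(w_{12}^n)|,$$ $$|\zeta(w_7^n)|P_7^n=|\zeta(w_{10}^n)|,\qquad |\zeta(w_8^n)|P_8^n=|\zeta(w_{11}^n)|,\qquad |\zeta(w_9^n)|P_9^n=|\zeta(w_{12}^n)|.$$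
   Context: Functions: $f_1,\dots,f_9$ are, in this order, $\sin^2t,\cos^2t,\sin^4t,\cos^4t,\sin^6t,\cos^6t,\cos2t,\cos4t,\cos6t$; for $U\in(0,\pi/12)$, $f_{10}(U)=\frac{\sin2U}{2U}$, $f_{11}(U)=\frac{\sin4U}{4U}$, $f_{12}(U)=\frac{\sin6U}{6U}$. Jacob's ladder: fix an increasing $C^\infty$ function $\mu$ on $[y_0,\infty)$ with $\mu(y)\ge 7y\ln y$. For sufficiently large $T$ let $\varphi(T)$ be the solution $x=\varphi(T)$ of $\int_0^{\mu(x)}|\zeta(\tfrac12+it)|^2e^{-2t/x}\,dt=\int_0^T|\zeta(\tfrac12+it)|^2\,dt$, and put $\varphi_1(T)=\tfrac12\varphi(T)$ (Jacob's ladder), a continuous strictly increasing unbounded function for large $T$. Its reverse iterates are defined by $T^{(0)}=T$ and $\varphi_1(T^{(r)})=T^{(r-1)}$, $r\ge1$; the $r$-th reverse iterate of the interval $(\pi L,\pi L+U)$ is $((\pi L)^{(r)},(\pi L+U)^{(r)})$. $\tilde Z^2(t)=\frac{d\varphi_1(t)}{dt}=\frac{|\zeta(\frac12+it)|^2}{\omega(t)}$, where $\omega(t)=\left\{1+\mathcal{O}\left(\frac{\ln\ln t}{\ln t}\right)\right\}\ln t$ as $t\to\infty$. Strips: $\frac12<\sigma_1<\sigma_0^1<\sigma_0^2<\dots<\sigma_0^{12}<\sigma_2<1$, and $\delta>0$ is small enough that $\sigma_1<\sigma_0^1-\delta$, $\sigma_0^{12}+\delta<\sigma_2$, $\sigma_0^l+\delta<\sigma_0^{l+1}-\delta$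 for $l=1,\dots,11$. Then $S^l_{\sigma_0^l,\delta}=(\sigma_0^l-\delta,\sigma_0^l+\delta)\times(0,+\infty)$ denotes the set of $s=\sigma+it$ with $|\sigma-\sigma_0^l|<\delta$, $t>0$ (these strips are pairwise disjoint). Admissible set: a finite set $0<U_1<U_2<\dots<U_{n_0}<\frac{\pi}{12}$ with $U_{n+1}-U_n>10^{-34}$ for $n=1,\dots,n_0-1$, $U_1>10^{-43}$ and $\frac{\pi}{12}-U_{n_0}>10^{-43}$. *)

theory Defs
  imports "HOL-Complex_Analysis.Complex_Analysis"
begin

text \<open>
  The Riemann zeta function, as the analytic continuation of its Dirichlet series to the
  punctured plane. The value at the pole is pinned to 0 only to make the description unique.
\<close>

definition is_zeta :: "(complex \<Rightarrow> complex) \<Rightarrow> bool" where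
  "is_zeta f \<longleftrightarrow>
     f holomorphic_on (- {1}) \<and> f 1 = 0 \<and>
     (\<forall>s. Re s > 1 \<longrightarrow> (\<lambda>n. of_nat (Suc n) powr (- s)) sums f s)"

definition zeta :: "complex \<Rightarrow> complex" where
  "zeta = (THE f. is_zeta f)"

definition zeta_crit_sq :: "real \<Rightarrow> real" where
  "zeta_crit_sq t = (cmod (zeta (Complex (1 / 2) t)))\<^sup>2"

text \<open>
  \<open>C\<^sup>\<infinity>\<close> on the closed half-line \<open>[a, \<infinity>)\<close>, with one-sided derivatives at \<open>a\<close>:
  \<open>D n\<close> is the \<open>n\<close>-th derivative.
\<close>

definition smooth_on_ray :: "real \<Rightarrow> (real \<Rightarrow> real) \<Rightarrow> bool" where
  "smooth_on_ray a g \<longleftrightarrow>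
     (\<exists>D :: nat \<Rightarrow> real \<Rightarrow> real. D 0 = g \<and>
        (\<forall>n. \<forall>y\<ge>a. (D n has_real_derivative D (Suc n) y) (at y within {a..})))"

definition ladder_eq :: "real \<Rightarrow> (real \<Rightarrow> real) \<Rightarrow> real \<Rightarrow> real \<Rightarrow> bool" where
  "ladder_eq y0 \<mu> T x \<longleftrightarrow> y0 \<le> x \<and>
     integral {0..\<mu> x} (\<lambda>t. zeta_crit_sq t * exp (- 2 * t / x)) = integral {0..T} zeta_crit_sq"

text \<open>
  The functions below carry their intended meaning at large arguments; \<open>ladder_dom\<close> collects
  the arguments at which the defining equation determines \<open>\<phi>\<close>.
\<close>

definition ladder_dom :: "real \<Rightarrow> (real \<Rightarrow> real) \<Rightarrow> real set" where
  "ladder_dom y0 \<mu> = {T. 0 \<le> T \<and> (\<exists>!x. ladder_eq y0 \<mu> T x)}"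

definition ladder_phi :: "real \<Rightarrow> (real \<Rightarrow> real) \<Rightarrow> real \<Rightarrow> real" where
  "ladder_phi y0 \<mu> T = (THE x. ladder_eq y0 \<mu> T x)"

definition jacobs_ladder :: "real \<Rightarrow> (real \<Rightarrow> real) \<Rightarrow> real \<Rightarrow> real" where
  "jacobs_ladder y0 \<mu> T = ladder_phi y0 \<mu> T / 2"

primrec reverse_iterate :: "real \<Rightarrow> (real \<Rightarrow> real) \<Rightarrow> nat \<Rightarrow> real \<Rightarrow> real" where
  "reverse_iterate y0 \<mu> 0 T = T"
| "reverse_iterate y0 \<mu> (Suc r) T =
     (THE t. t \<in> ladder_dom y0 \<mu> \<and> jacobs_ladder y0 \<mu> t = reverse_iterate y0 \<mu> r T)"

definition Ztilde_sq :: "real \<Rightarrow> (real \<Rightarrow> real) \<Rightarrow> real \<Rightarrow> real" where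
  "Ztilde_sq y0 \<mu> t = deriv (jacobs_ladder y0 \<mu>) t"

text \<open>The functions \<open>f\<^sub>1, \<dots>, f\<^sub>1\<^sub>2\<close>; the index \<open>l\<close> is meant to range over \<open>1, \<dots>, 12\<close>.\<close>

definition osc_fun :: "nat \<Rightarrow> real \<Rightarrow> real" where
  "osc_fun l =
     [\<lambda>t. sin t ^ 2, \<lambda>t. cos t ^ 2, \<lambda>t. sin t ^ 4, \<lambda>t. cos t ^ 4, \<lambda>t. sin t ^ 6, \<lambda>t. cos t ^ 6,
      \<lambda>t. cos (2 * t), \<lambda>t. cos (4 * t), \<lambda>t. cos (6 * t),
      \<lambda>U. sin (2 * U) / (2 * U), \<lambda>U. sin (4 * U) / (4 * U), \<lambda>U. sin (6 * U) / (6 * U)] ! (l - 1)"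

definition half_strip :: "real \<Rightarrow> real \<Rightarrow> complex set" where
  "half_strip \<sigma> \<delta> = {s. \<bar>Re s - \<sigma>\<bar> < \<delta> \<and> Im s > 0}"

definition strip_conditions :: "real \<Rightarrow> real \<Rightarrow> (nat \<Rightarrow> real) \<Rightarrow> real \<Rightarrow> bool" where
  "strip_conditions \<sigma>1 \<sigma>2 \<sigma>0 \<delta> \<longleftrightarrow>
     1 / 2 < \<sigma>1 \<and> \<sigma>1 < \<sigma>0 1 \<and> (\<forall>l\<in>{1..11}. \<sigma>0 l < \<sigma>0 (l + 1)) \<and> \<sigma>0 12 < \<sigma>2 \<and> \<sigma>2 < 1 \<and>
     0 < \<delta> \<and> \<sigma>1 < \<sigma>0 1 - \<delta> \<and> \<sigma>0 12 + \<delta> < \<sigma>2 \<and>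
     (\<forall>l\<in>{1..11}. \<sigma>0 l + \<delta> < \<sigma>0 (l + 1) - \<delta>)"

text \<open>The admissible set \<open>{U\<^sub>1 < \<dots> < U\<^bsub>n0\<^esub>}\<close> is given by its enumeration.\<close>

definition admissible :: "nat \<Rightarrow> (nat \<Rightarrow> real) \<Rightarrow> bool" where
  "admissible n0 U \<longleftrightarrow>
     1 \<le> n0 \<and> 0 < U 1 \<and> (\<forall>n\<in>{1..<n0}. U n < U (n + 1)) \<and> U n0 < pi / 12 \<and>
     (\<forall>n\<in>{1..<n0}. U (n + 1) - U n > 1 / 10 ^ 34) \<and>
     U 1 > 1 / 10 ^ 43 \<and> pi / 12 - U n0 > 1 / 10 ^ 43"

end

theory Submission
  imports Defs "HOL-Real_Asymp.Real_Asymp"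
begin

text \<open>
  Lagrange's mean value theorem for \<open>A \<circ> \<phi>\<^sub>1\<^sup>k\<close>, where \<open>A' = f\<^sub>l\<close>, and for \<open>\<phi>\<^sub>1\<^sup>k\<close> itself, on the \<open>k\<close>-th
  reverse iterate of \<open>(\<pi>L, \<pi>L + U)\<close> yields the points \<open>\<alpha>\<close> and \<open>\<beta>\<close>; by the chain rule the derivatives
  are products of \<open>Z\<close>-values along the iterates, so the quotient of the two identities turns
  \<open>f\<^sub>l(\<alpha>\<^sub>0) P\<^sub>l\<close> into the mean of \<open>f\<^sub>l\<close> over \<open>(\<pi>L, \<pi>L + U)\<close>, an elementary trigonometric integral.
  Far out, \<open>\<phi>\<^sub>1\<close> is differentiable because the left side of its defining equation has positive derivative in
  \<open>x\<close>, and it is onto because \<open>\<integral>|\<zeta>(1/2 + it)|\<^sup>2 dt\<close> diverges, by the first moment of \<open>(1 - 2\<^sup>1\<^sup>-\<^sup>s) \<zeta>(s)\<close>.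

  The sets \<open>W\<close> exist because \<open>|\<zeta>|\<close> takes every positive value at arbitrarily large heights on each
  line \<open>Re s = \<sigma>\<close> with \<open>1/2 < \<sigma> < 1\<close>. By continuity it is enough that \<open>|\<zeta>|\<close> is neither bounded nor
  bounded away from 0 high up on the line. For a Dirichlet polynomial \<open>D\<close> the mean square of
  \<open>(1 - 2\<^sup>1\<^sup>-\<^sup>s) \<zeta>(s) D(s)\<close> is the \<open>\<ell>\<^sup>2\<close>-norm of its coefficients, so a bound for \<open>|\<zeta>|\<close> would make
  multiplication by \<open>\<zeta>\<close> bounded (or bounded below) on coefficient sequences. The
  factors \<open>1 + p\<^sup>\<sigma>\<^sup>-\<^sup>s\<close> and \<open>(1 - p\<^sup>-\<^sup>s)(1 - p\<^sup>\<sigma>\<^sup>-\<^sup>s)\<close>, taken over many odd primes \<open>p\<close>, contradict this because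
  \<open>\<Prod>(1 + p\<^sup>-\<^sup>\<sigma>)\<close> diverges.
\<close>

section \<open>Euler transform of the alternating zeta series\<close>

text \<open>Zeta is handled through the alternating series (1 - 2^(1-s)) zeta(s). On a line Re s =
  \<sigma> with 0 < \<sigma> < 1 its partial sums of length T^(1+\<eta>) approximate it on [T, 2T]
  with an error tending to 0, so that mean values become those of Dirichlet polynomials. The
  obstacle is the length X: it must exceed T, while estimating the off-diagonal terms of a mean
  square in absolute value costs X^(2 - 2\<sigma>) (ln X)^2, which must stay below T. For \<sigma> >
  1/2 the length T^(\<sigma> + 1/2) meets both demands; at \<sigma> = 1/2 they are incompatible, and
  only a first moment is taken there.

  The norms in the argument about large and small values factor over primes because, for odd p, the
  coefficient sequence of the alternating series is an eigenvector of the adjoint of multiplication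
  by p^(\<sigma>-s), with eigenvalue p^(-\<sigma>). The alternating sign spoils this at p = 2.

  The moduli to be attained must be positive; this is where U < \<pi>/12 enters.\<close>

primrec fdiff :: "nat \<Rightarrow> complex \<Rightarrow> complex \<Rightarrow> complex" where
  "fdiff 0 s z = z powr (- s)"
| "fdiff (Suc k) s z = fdiff k s z - fdiff k s (z + 1)"

lemma fdiff_has_field_derivative:
  assumes "Re z > 0"
  shows "(fdiff k s has_field_derivative - s * fdiff k (s + 1) z) (at z)"
  using assms
proof (induction k arbitrary: z)
  case 0
  then have "z \<notin> \<real>\<^sub>\<le>\<^sub>0" by (auto simp: complex_nonpos_Reals_iff)
  from has_field_derivative_powr[OF this, of "-s"]
  have "((\<lambda>z. z powr (-s)) has_field_derivative - s * z powr (- (s + 1))) (at z)" by simp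
  moreover have "fdiff 0 s = (\<lambda>z. z powr (-s))" by (rule ext) simp
  ultimately show ?case by simp
next
  case (Suc k)
  have "((\<lambda>z. fdiff k s z - fdiff k s (z + 1)) has_field_derivative
      - s * fdiff k (s + 1) z - (- s * fdiff k (s + 1) (z + 1))) (at z)"
    using Suc.IH[of z] Suc.IH[of "z + 1"] Suc.prems
    by (intro DERIV_diff) (auto simp: DERIV_shift)
  moreover have "fdiff (Suc k) s = (\<lambda>z. fdiff k s z - fdiff k s (z + 1))" by (rule ext) simp
  ultimately show ?case by (simp add: algebra_simps)
qed

lemma segment_of_real_Suc:
  assumes "z \<in> closed_segment (complex_of_real x) (of_real (x + 1))"
  shows "\<exists>y. z = of_real y \<and> x \<le> y"
proof -
  from assms obtain u where "0 \<le> u" "z = (1 - u) *\<^sub>R of_real x + u *\<^sub>R of_real (x + 1)"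
    by (auto simp: in_segment)
  then show ?thesis
    by (intro exI[of _ "x + u"]) (auto simp: scaleR_conv_of_real algebra_simps)
qed

text \<open>A further difference is an increment over a unit segment, hence bounded by the
  derivative \<open>- s * fdiff k (s + 1)\<close>: it costs a factor |s| and gains a power of x. As
  s moves to s + 1 each time, the factors accumulate to |s| |s + 1| ... |s + k - 1|. The sign
  condition puts the maximum of the power at the left end of the segment.\<close>

lemma norm_fdiff_le:
  assumes "x > 0" "Re s + real k \<ge> 0"
  shows "norm (fdiff k s (of_real x)) \<le> (\<Prod>i<k. norm (s + of_nat i)) * x powr (- (Re s + real k))"
  using assms
proof (induction k arbitrary: x s)
  case 0
  then show ?case by (simp add: norm_powr_real_powr)
next
  case (Suc k)
  define B where "B = (\<Prod>i<Suc k. norm (s + of_nat i)) * x powr (- (Re s + real (Suc k)))"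
  have "norm (fdiff k s (of_real x) - fdiff k s (of_real (x + 1)))
      \<le> B * norm (of_real x - complex_of_real (x + 1))"
  proof (rule field_differentiable_bound[OF convex_closed_segment])
    fix z assume "z \<in> closed_segment (complex_of_real x) (of_real (x + 1))"
    then obtain y where y: "z = of_real y" "x \<le> y" using segment_of_real_Suc by blast
    show "(fdiff k s has_field_derivative - s * fdiff k (s + 1) z)
        (at z within closed_segment (complex_of_real x) (of_real (x + 1)))"
      using fdiff_has_field_derivative[of z k s] y Suc.prems
      by (auto intro: has_field_derivative_at_within)
    have "norm (fdiff k (s + 1) (of_real y))
        \<le> (\<Prod>i<k. norm (s + 1 + of_nat i)) * y powr (- (Re (s + 1) + real k))"
      using Suc.prems y by (intro Suc.IH) auto
    also have "\<dots> \<le> (\<Prod>i<k. norm (s + 1 + of_nat i)) * x powr (- (Re (s + 1) + real k))"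
      using Suc.prems y by (intro mult_left_mono powr_mono2' prod_nonneg) auto
    finally have "norm s * norm (fdiff k (s + 1) (of_real y))
        \<le> norm s * ((\<Prod>i<k. norm (s + 1 + of_nat i)) * x powr (- (Re (s + 1) + real k)))"
      by (rule mult_left_mono) auto
    also have "\<dots> = B"
      unfolding B_def by (subst prod.lessThan_Suc_shift) (simp add: algebra_simps)
    finally show "norm (- s * fdiff k (s + 1) z) \<le> B" using y by (simp add: norm_mult)
  qed auto
  then show ?case by (simp add: B_def)
qed

text \<open>With Y in place of the product, k differences multiply the size x^(-Re s) by at most
  (Y/x)^k, a gain as soon as x exceeds |s| + k.\<close>

lemma norm_fdiff_le':
  assumes "x > 0" "Re s + real k \<ge> 0" "norm s + real k \<le> Y"
  shows "norm (fdiff k s (of_real x)) \<le> Y ^ k * x powr (- (Re s + real k))"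
proof -
  have "(\<Prod>i<k. norm (s + of_nat i)) \<le> (\<Prod>i<k. Y)"
  proof (intro prod_mono conjI)
    fix i assume "i \<in> {..<k}"
    have "norm (s + of_nat i) \<le> norm s + norm (of_nat i :: complex)" by (rule norm_triangle_ineq)
    also have "\<dots> \<le> Y" using assms(3) \<open>i \<in> {..<k}\<close> by auto
    finally show "norm (s + of_nat i) \<le> Y" .
  qed auto
  then show ?thesis
    by (intro order.trans[OF norm_fdiff_le[OF assms(1,2)]] mult_right_mono) auto
qed

lemma summable_powr_shift:
  assumes "c > 1"
  shows "summable (\<lambda>m. real (N + 1 + m) powr (- c))"
proof -
  have "summable (\<lambda>m. real (m + (N + 1)) powr (- c))"
    using assms by (subst summable_iff_shift) (simp add: summable_real_powr_iff)
  then show ?thesis by (simp add: add_ac)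
qed

lemma summable_norm_fdiff:
  assumes "Re s + real K > 1"
  shows "summable (\<lambda>m. norm (fdiff K s (of_nat (N + 1 + m))))"
proof (rule summable_comparison_test)
  show "\<exists>M. \<forall>m\<ge>M. norm (norm (fdiff K s (of_nat (N + 1 + m))))
      \<le> (norm s + real K) ^ K * real (N + 1 + m) powr (- (Re s + real K))"
    using norm_fdiff_le'[of "real (N + 1 + m)" s K "norm s + real K" for m] assms
    by (auto simp del: of_nat_add of_nat_Suc)
  show "summable (\<lambda>m. (norm s + real K) ^ K * real (N + 1 + m) powr (- (Re s + real K)))"
    using assms by (intro summable_mult summable_powr_shift) auto
qed

lemma summable_fdiff:
  assumes "Re s + real K > 1"
  shows "summable (\<lambda>m. (-1) ^ m * fdiff K s (of_nat (N + 1 + m)))"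
  by (rule summable_norm_cancel) (use summable_norm_fdiff[OF assms] in \<open>simp add: norm_mult norm_power\<close>)

text \<open>
  Summation by parts \<open>K\<close> times from index \<open>N\<close> on. The value does not depend on \<open>K\<close> and \<open>N\<close>: a large \<open>K\<close>
  moves the abscissa of convergence to \<open>1 - K\<close>, and for \<open>N\<close> well above \<open>|s|\<close> everything beyond the partial
  sum is small.
\<close>

definition etaT :: "nat \<Rightarrow> nat \<Rightarrow> complex \<Rightarrow> complex" where
  "etaT K N s = (\<Sum>m. (-1) ^ m * fdiff K s (of_nat (N + 1 + m)))"

definition etaE :: "nat \<Rightarrow> nat \<Rightarrow> complex \<Rightarrow> complex" where
  "etaE K N s = (\<Sum>n<N. (-1) ^ n * of_nat (n + 1) powr (- s))
     + (-1) ^ N * ((\<Sum>j<K. fdiff j s (of_nat (N + 1)) / 2 ^ (j + 1)) + etaT K N s / 2 ^ K)"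

lemma etaT_Suc_N:
  assumes "Re s + real K > 1"
  shows "etaT K N s + etaT K (Suc N) s = fdiff K s (of_nat (N + 1))"
proof -
  have "etaT K N s = (-1) ^ 0 * fdiff K s (of_nat (N + 1 + 0))
      + (\<Sum>m. (-1) ^ Suc m * fdiff K s (of_nat (N + 1 + Suc m)))"
    unfolding etaT_def by (subst suminf_split_head[OF summable_fdiff[OF assms]]) simp
  also have "(\<Sum>m. (-1) ^ Suc m * fdiff K s (of_nat (N + 1 + Suc m)))
      = (\<Sum>m. - ((-1) ^ m * fdiff K s (of_nat (Suc N + 1 + m))))"
    by (intro suminf_cong) (simp add: add_ac)
  also have "\<dots> = - etaT K (Suc N) s"
    unfolding etaT_def by (rule suminf_minus[OF summable_fdiff[OF assms]])
  finally show ?thesis by simp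
qed

text \<open>The differenced series is the alternating series minus its shift by one index, and
  \<open>etaT_Suc_N\<close> removes the shifted one. Divided by 2^(K+1) this is one step of Euler's
  transformation.\<close>

lemma etaT_Suc_K:
  assumes "Re s + real K > 1"
  shows "etaT (Suc K) N s = 2 * etaT K N s - fdiff K s (of_nat (N + 1))"
proof -
  have "etaT (Suc K) N s = (\<Sum>m. (-1) ^ m * fdiff K s (of_nat (N + 1 + m))
      - (-1) ^ m * fdiff K s (of_nat (Suc N + 1 + m)))"
    unfolding etaT_def by (intro suminf_cong) (simp add: algebra_simps)
  also have "\<dots> = etaT K N s - etaT K (Suc N) s"
    unfolding etaT_def using assms by (intro suminf_diff[symmetric] summable_fdiff) auto
  also have "\<dots> = 2 * etaT K N s - fdiff K s (of_nat (N + 1))"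
    using etaT_Suc_N[OF assms, of N] by (simp add: algebra_simps)
  finally show ?thesis .
qed

lemma etaE_Suc_K:
  assumes "Re s + real K > 1"
  shows "etaE (Suc K) N s = etaE K N s"
  unfolding etaE_def etaT_Suc_K[OF assms] by (simp add: field_simps)

text \<open>Since \<open>fdiff j s (z + 1) = fdiff j s z - fdiff (Suc j) s z\<close>, the summand
  equals \<open>fdiff j s z / 2 ^ j - fdiff (Suc j) s z / 2 ^ Suc j\<close>.\<close>

lemma fdiff_telescope:
  "(\<Sum>j<K. (fdiff j s z + fdiff j s (z + 1)) / 2 ^ (j + 1)) = fdiff 0 s z - fdiff K s z / 2 ^ K"
proof (induction K)
  case (Suc K)
  have "(\<Sum>j<Suc K. (fdiff j s z + fdiff j s (z + 1)) / 2 ^ (j + 1))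
      = fdiff 0 s z - fdiff K s z / 2 ^ K + (fdiff K s z + fdiff K s (z + 1)) / 2 ^ (K + 1)"
    by (simp only: sum.lessThan_Suc Suc.IH)
  also have "\<dots> = fdiff 0 s z - fdiff (Suc K) s z / 2 ^ Suc K"
    by (simp add: field_simps)
  finally show ?case .
qed simp

lemma etaE_Suc_N:
  assumes "Re s + real K > 1"
  shows "etaE K (Suc N) s = etaE K N s"
proof -
  define S where "S = (\<lambda>N. (\<Sum>j<K. fdiff j s (of_nat (N + 1)) / 2 ^ (j + 1)))"
  have "S N + S (Suc N) = (\<Sum>j<K. (fdiff j s (of_nat (N + 1)) + fdiff j s (of_nat (N + 1) + 1)) / 2 ^ (j + 1))"
    unfolding S_def by (simp add: sum.distrib add_divide_distrib add_ac)
  also have "\<dots> = of_nat (N + 1) powr (- s) - fdiff K s (of_nat (N + 1)) / 2 ^ K"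
    unfolding fdiff_telescope by simp
  finally have S: "S N + S (Suc N) = of_nat (N + 1) powr (- s) - fdiff K s (of_nat (N + 1)) / 2 ^ K" .
  have "etaE K N s - etaE K (Suc N) s = (-1) ^ N * ((S N + S (Suc N)) - of_nat (N + 1) powr (- s)
      + (etaT K N s + etaT K (Suc N) s) / 2 ^ K)"
    unfolding etaE_def S_def by (simp add: algebra_simps add_divide_distrib)
  also have "\<dots> = 0" unfolding S etaT_Suc_N[OF assms] by simp
  finally show ?thesis by simp
qed

lemma etaE_eq:
  assumes "Re s + real K > 1" "Re s + real K' > 1"
  shows "etaE K N s = etaE K' N' s"
proof -
  have N: "etaE K N s = etaE K 0 s" if "Re s + real K > 1" for K N
    by (induction N) (simp_all add: etaE_Suc_N[OF that])
  have K: "etaE (K + j) 0 s = etaE K 0 s" if "Re s + real K > 1" for K j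
    by (induction j) (use that in \<open>simp_all add: etaE_Suc_K\<close>)
  show ?thesis
    \<comment> \<open>Of the natural differences \<open>K' - K\<close> and \<open>K - K'\<close> one
      is 0; the other raises the smaller order to the larger.\<close>
    using N[OF assms(1), of N] N[OF assms(2), of N'] K[OF assms(1), of "K' - K"] K[OF assms(2), of "K - K'"]
    by (cases "K \<le> K'") auto
qed

lemma fdiff_holomorphic [holomorphic_intros]:
  "z \<noteq> 0 \<Longrightarrow> Re z > 0 \<Longrightarrow> (\<lambda>s. fdiff k s z) holomorphic_on A"
  by (induction k arbitrary: z)
     (auto intro!: holomorphic_intros simp: complex_eq_iff)

lemma etaT_holomorphic: "etaT K N holomorphic_on {s. Re s + real K > 1}"
proof -
  let ?S = "{s. Re s + real K > 1}"
  have S: "open ?S" using open_halfspace_Re_gt[of "1 - real K"] by (simp add: algebra_simps)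
  have "\<exists>g. \<forall>x\<in>?S. ((\<lambda>m. (-1) ^ m * fdiff K x (of_nat (N + 1 + m))) sums g x) \<and> g field_differentiable (at x)"
  proof (rule series_differentiable_comparison_complex[OF S])
    fix m x assume "x \<in> ?S"
    have "(\<lambda>x. (-1) ^ m * fdiff K x (of_nat (N + 1 + m))) holomorphic_on UNIV"
      by (intro holomorphic_intros) (auto simp: complex_eq_iff)
    then show "(\<lambda>x. (-1) ^ m * fdiff K x (of_nat (N + 1 + m))) field_differentiable at x"
      by (auto simp: holomorphic_on_def)
  next
    fix x assume x: "x \<in> ?S"
    \<comment> \<open>Half the distance to the edge of the half plane keeps the exponent above a
      fixed number > 1 on the whole ball; the bound 1 makes C valid for all its points.\<close>
    define d where "d = min 1 ((Re x + real K - 1) / 2)"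
    define C where "C = (norm x + 1 + real K) ^ K"
    define h where "h = (\<lambda>m. C * real (N + 1 + m) powr (- (Re x - d + real K)))"
    have d: "0 < d" "d \<le> 1" "Re x - d + real K > 1" using x by (auto simp: d_def min_def field_simps)
    have C: "C \<ge> 0" by (simp add: C_def)
    have "norm ((-1) ^ m * fdiff K y (of_nat (N + 1 + m))) \<le> h m"
      if "y \<in> ball x d \<inter> ?S" for y m
    proof -
      have "norm (y - x) < d" using that by (simp add: dist_norm norm_minus_commute)
      then have 1: "norm y \<le> norm x + 1" and 2: "\<bar>Re y - Re x\<bar> < d"
        using norm_triangle_ineq[of x "y - x"] d abs_Re_le_cmod[of "y - x"] by auto
      have "norm (fdiff K y (of_real (real (N + 1 + m))))
          \<le> C * real (N + 1 + m) powr (- (Re y + real K))"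
        unfolding C_def using 1 that by (intro norm_fdiff_le') auto
      also have "\<dots> \<le> h m"
        unfolding h_def using C 2 by (intro mult_left_mono powr_mono) auto
      finally show ?thesis by (simp add: norm_mult norm_power)
    qed
    note bd = this
    have "summable h" unfolding h_def using d by (intro summable_mult summable_powr_shift)
    moreover have "h m \<ge> 0" for m using C by (simp add: h_def)
    ultimately show "\<exists>d h. 0 < d \<and> summable h \<and> range h \<subseteq> \<real>\<^sub>\<ge>\<^sub>0 \<and>
        (\<forall>\<^sub>F n in sequentially. \<forall>y\<in>ball x d \<inter> ?S. cmod ((-1) ^ n * fdiff K y (of_nat (N + 1 + n))) \<le> cmod (h n))"
      using d bd by (intro exI[of _ d] exI[of _ "\<lambda>n. of_real (h n)"])
        (auto simp: summable_of_real intro!: always_eventually)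
  qed blast
  then obtain g where g: "\<And>x. x \<in> ?S \<Longrightarrow> (\<lambda>m. (-1) ^ m * fdiff K x (of_nat (N + 1 + m))) sums g x"
    "\<And>x. x \<in> ?S \<Longrightarrow> g field_differentiable (at x)" by blast
  have "g holomorphic_on ?S" using g(2) by (auto simp: holomorphic_on_def intro: field_differentiable_at_within)
  moreover have "g x = etaT K N x" if "x \<in> ?S" for x
    using sums_unique[OF g(1)[OF that]] by (simp add: etaT_def)
  ultimately show ?thesis using holomorphic_transform by blast
qed

lemma etaE_holomorphic: "etaE K N holomorphic_on {s. Re s + real K > 1}"
proof -
  have "(\<lambda>s. etaE K N s) holomorphic_on {s. Re s + real K > 1}"
    unfolding etaE_def using etaT_holomorphic[of K N]
    by (intro holomorphic_intros) (auto simp: complex_eq_iff)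
  then show ?thesis by simp
qed

section \<open>Analytic continuation of the zeta function\<close>

lemma norm_powr_diff_le:
  assumes "0 < x" "x \<le> y" "Re s + 1 \<ge> 0"
  shows "norm (of_real x powr (- s) - of_real y powr (- s)) \<le> norm s * x powr (- (Re s + 1)) * (y - x)"
proof -
  have "norm (fdiff 0 s (of_real x) - fdiff 0 s (of_real y))
      \<le> (norm s * x powr (- (Re s + 1))) * norm (of_real x - complex_of_real y)"
  proof (rule field_differentiable_bound[OF convex_closed_segment])
    fix z assume z: "z \<in> closed_segment (complex_of_real x) (of_real y)"
    obtain u where u: "z = of_real u" "x \<le> u"
    proof -
      from z obtain v where v: "0 \<le> v" "z = (1 - v) *\<^sub>R of_real x + v *\<^sub>R of_real y"
        by (auto simp: in_segment)
      have "z = of_real (x + v * (y - x))"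
        by (simp add: v(2) scaleR_conv_of_real algebra_simps)
      moreover have "x \<le> x + v * (y - x)" using v assms by simp
      ultimately show ?thesis using that by blast
    qed
    show "(fdiff 0 s has_field_derivative - s * fdiff 0 (s + 1) z)
        (at z within closed_segment (complex_of_real x) (of_real y))"
      using fdiff_has_field_derivative[of z 0 s] u assms
      by (auto intro: has_field_derivative_at_within)
    have "norm (fdiff 0 (s + 1) z) = u powr (- (Re s + 1))"
      using u assms by (simp add: norm_powr_real_powr)
    also have "\<dots> \<le> x powr (- (Re s + 1))" using u assms by (intro powr_mono2') auto
    finally show "norm (- s * fdiff 0 (s + 1) z) \<le> norm s * x powr (- (Re s + 1))"
      unfolding norm_mult norm_minus_cancel by (rule mult_left_mono) simp
  qed auto
  also have "norm (of_real x - complex_of_real y) = y - x"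
    using assms by (metis abs_minus_commute abs_of_nonneg diff_ge_0_iff_ge norm_of_real of_real_diff)
  finally show ?thesis by simp
qed

text \<open>The subtracted quotient is the integral of x^(-s) over [n + 1, n + 2], which makes the
  series converge for Re s > 0. The integral over [1, \<infinity>) returns as 1/(s - 1) in
  \<open>zeta_half\<close>.\<close>

definition zeta_term :: "nat \<Rightarrow> complex \<Rightarrow> complex" where
  "zeta_term n s = of_nat (n + 1) powr (- s)
     - (of_nat (n + 2) powr (1 - s) - of_nat (n + 1) powr (1 - s)) / (1 - s)"

lemma norm_zeta_term_le:
  assumes "Re s > 0" "s \<noteq> 1"
  shows "norm (zeta_term n s) \<le> norm s * real (n + 1) powr (- (Re s + 1))"
proof -
  define x where "x = real (n + 1)"
  have x: "x > 0" by (simp add: x_def)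
  \<comment> \<open>The increment of q over [x, x + 1] is \<open>zeta_term n s\<close>, and its
    derivative x^(-s) - z^(-s) is small by \<open>norm_powr_diff_le\<close>.\<close>
  define q where "q = (\<lambda>z. z * of_real x powr (- s) - z powr (1 - s) / (1 - s))"
  have "norm (q (of_real (x + 1)) - q (of_real x))
      \<le> (norm s * x powr (- (Re s + 1))) * norm (of_real (x + 1) - complex_of_real x)"
  proof (rule field_differentiable_bound[OF convex_closed_segment])
    fix z assume z: "z \<in> closed_segment (complex_of_real x) (of_real (x + 1))"
    from z obtain v where v: "0 \<le> v" "v \<le> 1" "z = (1 - v) *\<^sub>R of_real x + v *\<^sub>R of_real (x + 1)"
      by (auto simp: in_segment)
    have u: "z = of_real (x + v)"
      by (simp add: v(3) scaleR_conv_of_real algebra_simps)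
    have z0: "z \<notin> \<real>\<^sub>\<le>\<^sub>0" using u x v by (auto simp: complex_nonpos_Reals_iff)
    have "(q has_field_derivative of_real x powr (- s) - ((1 - s) * z powr (1 - s - 1)) / (1 - s)) (at z)"
      unfolding q_def using has_field_derivative_powr[OF z0, of "1 - s"]
      by (intro DERIV_diff DERIV_cdivide) (auto intro!: derivative_eq_intros)
    then show "(q has_field_derivative of_real x powr (- s) - z powr (- s))
        (at z within closed_segment (complex_of_real x) (of_real (x + 1)))"
      using assms by (auto intro: has_field_derivative_at_within)
    have "norm (of_real x powr (- s) - z powr (- s)) \<le> norm s * x powr (- (Re s + 1)) * (x + v - x)"
      unfolding u using x v assms by (intro norm_powr_diff_le) auto
    also have "\<dots> \<le> norm s * x powr (- (Re s + 1)) * 1"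
      using v by (intro mult_left_mono) auto
    finally show "norm (of_real x powr (- s) - z powr (- s)) \<le> norm s * x powr (- (Re s + 1))" by simp
  qed auto
  moreover have "q (of_real (x + 1)) - q (of_real x) = zeta_term n s"
  proof -
    have e: "complex_of_real (x + 1) = of_nat (n + 2)" "complex_of_real x = of_nat (n + 1)"
      by (simp_all add: x_def)
    have e2: "complex_of_nat (n + 2) = of_nat (n + 1) + 1" by simp
    have "(of_nat (n + 1) + 1) * c - b / d - (of_nat (n + 1) * c - a / d) = c - (b - a) / d"
      for a b c d :: complex by (simp add: algebra_simps diff_divide_distrib)
    then show ?thesis unfolding q_def zeta_term_def e e2 .
  qed
  ultimately show ?thesis by (simp add: x_def)
qed

text \<open>A second continuation beside the Euler transform: 1 - 2^(1-s) has zeros other than 1 on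
  the line Re s = 1, and there zeta cannot be recovered from \<open>etaE\<close> by
  division.\<close>

definition zeta_half :: "complex \<Rightarrow> complex" where
  "zeta_half s = 1 / (s - 1) + (\<Sum>n. zeta_term n s)"

lemma zeta_half_holomorphic: "zeta_half holomorphic_on ({s. Re s > 0} - {1})"
proof -
  let ?S = "{s. Re s > 0} - {1 :: complex}"
  have S: "open ?S" using open_halfspace_Re_gt[of 0] by (intro open_Diff) auto
  have "\<exists>g. \<forall>x\<in>?S. ((\<lambda>n. zeta_term n x) sums g x) \<and> g field_differentiable (at x)"
  proof (rule series_differentiable_comparison_complex[OF S])
    fix n x assume x: "x \<in> ?S"
    have "(\<lambda>s. zeta_term n s) holomorphic_on ?S"
      unfolding zeta_term_def by (intro holomorphic_intros) auto
    then show "(\<lambda>s. zeta_term n s) field_differentiable at x"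
      using S x holomorphic_on_imp_differentiable_at by blast
  next
    fix x assume x: "x \<in> ?S"
    define d where "d = min 1 (Re x / 2)"
    define h where "h = (\<lambda>n. (norm x + 1) * real (0 + 1 + n) powr (- (Re x - d + 1)))"
    have d: "0 < d" "d \<le> 1" "Re x - d > 0" using x by (auto simp: d_def min_def field_simps)
    have bd: "norm (zeta_term n y) \<le> h n"
      if "y \<in> ball x d \<inter> ?S" for y n
    proof -
      have "norm (y - x) < d" using that by (simp add: dist_norm norm_minus_commute)
      then have 1: "norm y \<le> norm x + 1" and 2: "\<bar>Re y - Re x\<bar> < d"
        using norm_triangle_ineq[of x "y - x"] d abs_Re_le_cmod[of "y - x"] by auto
      have "norm (zeta_term n y) \<le> norm y * real (n + 1) powr (- (Re y + 1))"
        using that by (intro norm_zeta_term_le) auto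
      also have "\<dots> \<le> h n"
        unfolding h_def using 1 2 by (intro mult_mono powr_mono) (auto simp: add_ac intro!: powr_mono)
      finally show ?thesis .
    qed
    have "summable h" unfolding h_def using d by (intro summable_mult summable_powr_shift) auto
    moreover have "h m \<ge> 0" for m by (simp add: h_def)
    ultimately show "\<exists>d h. 0 < d \<and> summable h \<and> range h \<subseteq> \<real>\<^sub>\<ge>\<^sub>0 \<and>
        (\<forall>\<^sub>F n in sequentially. \<forall>y\<in>ball x d \<inter> ?S. cmod (zeta_term n y) \<le> cmod (h n))"
      using d bd by (intro exI[of _ d] exI[of _ "\<lambda>n. of_real (h n)"])
        (auto simp: summable_of_real intro!: always_eventually)
  qed blast
  then obtain g where g: "\<And>x. x \<in> ?S \<Longrightarrow> (\<lambda>n. zeta_term n x) sums g x"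
    "\<And>x. x \<in> ?S \<Longrightarrow> g field_differentiable (at x)" by blast
  have "g holomorphic_on ?S" using g(2) by (auto simp: holomorphic_on_def intro: field_differentiable_at_within)
  then have "(\<lambda>s. 1 / (s - 1) + g s) holomorphic_on ?S" by (intro holomorphic_intros) auto
  moreover have "1 / (x - 1) + g x = zeta_half x" if "x \<in> ?S" for x
    using sums_unique[OF g(1)[OF that]] by (simp add: zeta_half_def)
  ultimately show ?thesis using holomorphic_transform by blast
qed

definition zeta_series :: "complex \<Rightarrow> complex" where
  "zeta_series s = (\<Sum>n. of_nat (Suc n) powr (- s))"

lemma zeta_series_sums:
  assumes "Re s > 1"
  shows "(\<lambda>n. of_nat (Suc n) powr (- s)) sums zeta_series s"
proof -
  have "summable (\<lambda>n. norm (fdiff 0 s (of_nat (0 + 1 + n))))"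
    using assms by (intro summable_norm_fdiff) simp
  then have "summable (\<lambda>n. norm (of_nat (Suc n) powr (- s) :: complex))" by simp
  then show ?thesis unfolding zeta_series_def by (rule summable_sums[OF summable_norm_cancel])
qed

lemma zeta_half_eq_series:
  assumes "Re s > 1"
  shows "zeta_half s = zeta_series s"
proof -
  have s: "s \<noteq> 1" using assms by auto
  have part: "(\<Sum>n<N. zeta_term n s) = (\<Sum>n<N. of_nat (Suc n) powr (- s))
      - (of_nat (N + 1) powr (1 - s) - 1) / (1 - s)" for N
    using s by (induction N) (simp_all add: zeta_term_def diff_divide_distrib)
  have "(\<lambda>N. of_nat (N + 1) powr (1 - s)) \<longlonglongrightarrow> (0 :: complex)"
  proof (rule tendsto_norm_zero_cancel)
    have "(\<lambda>N. real (N + 1) powr (1 - Re s)) \<longlonglongrightarrow> 0"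
    proof (rule tendsto_neg_powr)
      show "filterlim (\<lambda>N. real (N + 1)) at_top sequentially"
        using filterlim_real_sequentially filterlim_sequentially_Suc[of real] by simp
    qed (use assms in auto)
    moreover have "norm (of_nat (N + 1) powr (1 - s) :: complex) = real (N + 1) powr (1 - Re s)" for N
      using norm_powr_real_powr[of "of_nat (N + 1)" "1 - s"] by simp
    ultimately show "(\<lambda>N. norm (of_nat (N + 1) powr (1 - s) :: complex)) \<longlonglongrightarrow> 0" by simp
  qed
  then have "(\<lambda>N. (\<Sum>n<N. of_nat (Suc n) powr (- s)) - (of_nat (N + 1) powr (1 - s) - 1) / (1 - s))
      \<longlonglongrightarrow> zeta_series s - (0 - 1) / (1 - s)"
    using zeta_series_sums[OF assms] s unfolding sums_def
    by (intro tendsto_diff tendsto_divide) auto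
  then have "(\<lambda>n. zeta_term n s) sums (zeta_series s - (0 - 1) / (1 - s))"
    unfolding sums_def part .
  then have "(\<Sum>n. zeta_term n s) = zeta_series s - (0 - 1) / (1 - s)" by (rule sums_unique[symmetric])
  moreover have "1 / (s - 1) = (0 - 1) / (1 - s)"
    using minus_divide_divide[of 1 "s - 1"] by simp
  ultimately show ?thesis unfolding zeta_half_def by simp
qed

lemma etaE_eq_series:
  assumes "Re s > 1"
  shows "etaE K N s = (1 - 2 powr (1 - s)) * zeta_series s"
proof -
  define a where "a = (\<lambda>n. of_nat (Suc n) powr (- s) :: complex)"
  have a: "a sums zeta_series s" unfolding a_def by (rule zeta_series_sums[OF assms])
  \<comment> \<open>Index n stands for the integer n + 1, so odd indices are the even integers;
    twice their terms sum to 2^(1-s) times the series.\<close>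
  define b where "b = (\<lambda>n. if odd n then 2 * a n else 0)"
  have "(\<lambda>k. 2 powr (1 - s) * a k) sums (2 powr (1 - s) * zeta_series s)" by (rule sums_mult[OF a])
  moreover have "2 powr (1 - s) * a k = b (2 * k + 1)" for k
  proof -
    have "(of_nat (2 * Suc k) :: complex) powr (- s) = 2 powr (- s) * of_nat (Suc k) powr (- s)"
      using powr_times_real[of 2 "of_nat (Suc k)" "- s"] by (simp add: mult_ac)
    moreover have "(2::complex) powr (1 - s) = 2 * 2 powr (- s)"
      by (simp add: powr_diff powr_minus divide_inverse)
    ultimately show ?thesis by (simp add: a_def b_def)
  qed
  ultimately have "(\<lambda>k. b (2 * k + 1)) sums (2 powr (1 - s) * zeta_series s)" by simp
  moreover have "strict_mono (\<lambda>k::nat. 2 * k + 1)" by (auto simp: strict_mono_def)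
  moreover have "b n = 0" if "n \<notin> range (\<lambda>k. 2 * k + 1)" for n
  proof -
    have "even n" using that by (metis oddE rangeI)
    then show ?thesis by (simp add: b_def)
  qed
  ultimately have b: "b sums (2 powr (1 - s) * zeta_series s)"
    using sums_mono_reindex[of "\<lambda>k. 2 * k + 1" b] by simp
  have "(\<lambda>n. a n - b n) sums (zeta_series s - 2 powr (1 - s) * zeta_series s)"
    by (rule sums_diff[OF a b])
  moreover have "a n - b n = (-1) ^ n * fdiff 0 s (of_nat (0 + 1 + n))" for n
    by (simp add: a_def b_def)
  ultimately have "etaT 0 0 s = zeta_series s - 2 powr (1 - s) * zeta_series s"
    unfolding etaT_def by (simp add: sums_iff)
  moreover have "etaE K N s = etaE 0 0 s" using assms by (intro etaE_eq) auto
  ultimately show ?thesis by (simp add: etaE_def algebra_simps)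
qed

lemma zeta_factor_nonzero:
  assumes "Re s \<noteq> 1"
  shows "1 - 2 powr (1 - s) \<noteq> (0::complex)"
proof
  assume "1 - 2 powr (1 - s) = (0::complex)"
  then have "(1::complex) = 2 powr (1 - s)" by (rule eq_iff_diff_eq_0[THEN iffD2])
  then have "norm (2 powr (1 - s) :: complex) = norm (1::complex)" by (rule arg_cong[OF sym])
  then have "norm (2 powr (1 - s) :: complex) = 1" unfolding norm_one .
  then have "(2::real) powr (1 - Re s) = 1" using norm_powr_real_powr[of 2 "1 - s"] by simp
  then show False using assms by simp
qed

lemma convex_connected_delete_complex:
  assumes "convex S" "open S"
  shows "connected (S - {a :: complex})"
  using assms by (intro connected_open_delete convex_connected) auto

text \<open>The identity theorem on a half plane without 1. The abscissa c is a parameter because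
  the lemma serves \<open>zeta_half\<close>, with c = 0, during the construction of zeta, and
  \<open>zeta\<close> itself afterwards.\<close>

lemma etaE_eq_of_continuation:
  assumes "f holomorphic_on ({s. Re s > c} - {1})" "c \<le> 1"
    and "\<And>s. Re s > 1 \<Longrightarrow> f s = zeta_series s"
    and "Re s > c" "Re s + real K > 1" "s \<noteq> 1"
  shows "etaE K N s = (1 - 2 powr (1 - s)) * f s"
proof -
  define A where "A = {s. Re s > max c (1 - real K)}"
  have A: "open A" "convex A"
    unfolding A_def by (rule open_halfspace_Re_gt convex_halfspace_Re_gt)+
  show ?thesis
  proof (rule analytic_continuation_open[of "{s. Re s > 1}" "A - {1}" "etaE K N" "\<lambda>s. (1 - 2 powr (1 - s)) * f s"])
    show "open {s. Re s > 1}" by (rule open_halfspace_Re_gt)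
    show "{s. 1 < Re s} \<noteq> {}" by (auto intro!: exI[of _ 2])
    show "open (A - {1})" using A by (intro open_Diff) auto
    show "connected (A - {1})" using A by (intro convex_connected_delete_complex)
    show "{s. 1 < Re s} \<subseteq> A - {1}" using assms(2) by (auto simp: A_def)
    show "etaE K N holomorphic_on A - {1}"
      by (rule holomorphic_on_subset[OF etaE_holomorphic]) (auto simp: A_def)
    have "f holomorphic_on A - {1}"
      by (rule holomorphic_on_subset[OF assms(1)]) (auto simp: A_def)
    then show "(\<lambda>s. (1 - 2 powr (1 - s)) * f s) holomorphic_on A - {1}"
      by (intro holomorphic_intros)
    show "etaE K N z = (1 - 2 powr (1 - z)) * f z" if "z \<in> {s. 1 < Re s}" for z
      using that assms(3) etaE_eq_series by simp
    show "s \<in> A - {1}" using assms by (auto simp: A_def)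
  qed
qed

lemma is_zeta_unique:
  assumes "is_zeta f" "is_zeta g"
  shows "f = g"
proof
  fix s
  show "f s = g s"
  proof (cases "s = 1")
    case False
    show ?thesis
    proof (rule analytic_continuation_open[of "{s. Re s > 1}" "- {1}" f g])
      show "open {s. Re s > 1}" by (rule open_halfspace_Re_gt)
      show "{s. 1 < Re s} \<noteq> {}" by (auto intro!: exI[of _ 2])
      show "connected (- {1 :: complex})"
        using convex_connected_delete_complex[of UNIV 1] by (simp add: Compl_eq_Diff_UNIV)
      show "f z = g z" if "z \<in> {s. 1 < Re s}" for z
        using assms that unfolding is_zeta_def by (auto intro: sums_unique2)
    qed (use assms False in \<open>auto simp: is_zeta_def\<close>)
  qed (use assms in \<open>simp add: is_zeta_def\<close>)
qed

text \<open>Existence by gluing: \<open>zeta_half\<close> for Re s > 0, the quotient of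
  \<open>etaE\<close> by 1 - 2^(1-s) elsewhere.\<close>

lemma is_zeta_zeta: "is_zeta zeta"
proof -
  define K where "K = (\<lambda>s::complex. nat \<lceil>2 - Re s\<rceil>)"
  have K: "Re s + real (K s) > 1" for s unfolding K_def by linarith
  define f where "f = (\<lambda>s. if s = 1 then 0 else if Re s > 0 then zeta_half s
      else etaE (K s) 0 s / (1 - 2 powr (1 - s)))"
  \<comment> \<open>The order \<open>K s\<close> jumps with s. For differentiability one fixed order
    k must serve a whole neighbourhood, and it must agree with \<open>zeta_half\<close> in the
    overlap 0 < Re s < 1.\<close>
  have f_left: "f s = etaE k 0 s / (1 - 2 powr (1 - s))" if s: "Re s < 1" "Re s + real k > 1" for s k
  proof (cases "Re s > 0")
    case True
    have "etaE k 0 s = (1 - 2 powr (1 - s)) * zeta_half s"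
      using that True zeta_half_holomorphic zeta_half_eq_series
      by (intro etaE_eq_of_continuation[of zeta_half 0]) auto
    then show ?thesis using True s zeta_factor_nonzero[of s] by (auto simp: f_def)
  next
    case False
    then show ?thesis using s K[of s] etaE_eq[of s "K s" k 0 0] by (auto simp: f_def)
  qed
  have "f field_differentiable (at s)" if "s \<noteq> 1" for s
  proof (cases "Re s > 0")
    case True
    define A where "A = {s. Re s > 0} - {1 :: complex}"
    have "open A" unfolding A_def by (intro open_Diff open_halfspace_Re_gt) auto
    moreover have "f holomorphic_on A"
      by (rule holomorphic_transform[of zeta_half]) (use zeta_half_holomorphic in \<open>auto simp: A_def f_def\<close>)
    ultimately show ?thesis using that True holomorphic_on_imp_differentiable_at[of f A s]
      by (auto simp: A_def)
  next
    case False
    define A where "A = {z. Re z < 1} \<inter> {z. Re z > 1 - real (K s)}"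
    have "open A" unfolding A_def by (intro open_Int open_halfspace_Re_gt open_halfspace_Re_lt)
    moreover have "(\<lambda>z. etaE (K s) 0 z / (1 - 2 powr (1 - z))) holomorphic_on A"
      using zeta_factor_nonzero
      by (intro holomorphic_intros holomorphic_on_subset[OF etaE_holomorphic]) (force simp: A_def)+
    then have "f holomorphic_on A"
      by (rule holomorphic_transform) (auto simp: A_def f_left[of _ "K s"])
    ultimately show ?thesis using that False K[of s] holomorphic_on_imp_differentiable_at[of f A s]
      by (auto simp: A_def)
  qed
  then have "f holomorphic_on - {1}"
    by (auto simp: holomorphic_on_def intro: field_differentiable_at_within)
  moreover have "(\<lambda>n. of_nat (Suc n) powr (- s)) sums f s" if "Re s > 1" for s
    using zeta_series_sums[OF that] zeta_half_eq_series[OF that] that by (auto simp: f_def)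
  ultimately have "is_zeta f" by (simp add: is_zeta_def f_def)
  then show ?thesis unfolding zeta_def by (rule theI[of is_zeta f]) (rule is_zeta_unique[OF _ \<open>is_zeta f\<close>])
qed

lemma zeta_holomorphic: "zeta holomorphic_on (- {1})"
  using is_zeta_zeta by (simp add: is_zeta_def)

lemma zeta_eq_series: "Re s > 1 \<Longrightarrow> zeta s = zeta_series s"
  using is_zeta_zeta zeta_series_sums sums_unique2 unfolding is_zeta_def by blast

lemma etaE_eq_zeta:
  assumes "Re s + real K > 1" "s \<noteq> 1"
  shows "etaE K N s = (1 - 2 powr (1 - s)) * zeta s"
  using assms zeta_eq_series
  by (intro etaE_eq_of_continuation[of zeta "min 1 (Re s - 1)"] holomorphic_on_subset[OF zeta_holomorphic]) auto

section \<open>Mean squares of Dirichlet polynomials\<close>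

text \<open>
  A Dirichlet polynomial restricted to a vertical line \<open>Re s = \<sigma>\<close>; the factor \<open>n\<^sup>-\<^sup>\<sigma>\<close> is absorbed
  into the coefficient.
\<close>

definition dpoly :: "(nat \<Rightarrow> real) \<Rightarrow> nat \<Rightarrow> real \<Rightarrow> complex" where
  "dpoly b X t = (\<Sum>n=1..X. of_real (b n) * cis (- (t * ln (real n))))"

lemma continuous_on_dpoly [continuous_intros]: "continuous_on A (dpoly b X)"
  unfolding dpoly_def by (intro continuous_intros)

lemma norm_dpoly_le: "norm (dpoly b X t) \<le> (\<Sum>n=1..X. \<bar>b n\<bar>)"
  unfolding dpoly_def by (rule order.trans[OF norm_sum]) (simp add: norm_mult)

lemma norm_dpoly_square:
  "(norm (dpoly b X t))\<^sup>2 = (\<Sum>m=1..X. \<Sum>n=1..X. b m * b n * cos (t * (ln (real m) - ln (real n))))"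
proof -
  have "complex_of_real ((norm (dpoly b X t))\<^sup>2) = dpoly b X t * cnj (dpoly b X t)"
    by (simp only: complex_norm_square)
  also have "\<dots> = (\<Sum>m=1..X. \<Sum>n=1..X. of_real (b m) * cis (- (t * ln (real m))) *
      (of_real (b n) * cis (t * ln (real n))))"
    unfolding dpoly_def cnj_sum sum_product by (simp add: cis_cnj)
  also have "\<dots> = (\<Sum>m=1..X. \<Sum>n=1..X. of_real (b m * b n) * cis (- (t * (ln (real m) - ln (real n)))))"
  proof -
    have "of_real x * cis (- (t * p)) * (of_real y * cis (t * q)) = of_real (x * y) * cis (- (t * (p - q)))"
      for x y p q
    proof -
      have "cis (- (t * p)) * cis (t * q) = cis (- (t * (p - q)))"
        by (simp add: cis_mult algebra_simps)
      then show ?thesis by (simp add: mult_ac)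
    qed
    then show ?thesis by (intro sum.cong refl)
  qed
  finally have "Re (complex_of_real ((norm (dpoly b X t))\<^sup>2))
      = Re (\<Sum>m=1..X. \<Sum>n=1..X. of_real (b m * b n) * cis (- (t * (ln (real m) - ln (real n)))))"
    by (rule arg_cong)
  then show ?thesis by (simp add: Re_sum)
qed

lemma has_integral_cos_mult:
  fixes l a b :: real
  assumes "l \<noteq> 0" "a \<le> b"
  shows "((\<lambda>t. cos (t * l)) has_integral (sin (b * l) - sin (a * l)) / l) {a..b}"
proof -
  have "((\<lambda>t. cos (t * l)) has_integral ((\<lambda>t. sin (t * l) / l) b - (\<lambda>t. sin (t * l) / l) a)) {a..b}"
  proof (rule fundamental_theorem_of_calculus[OF assms(2)])
    fix t
    have "((\<lambda>t. sin (t * l) / l) has_real_derivative cos (t * l)) (at t within {a..b})"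
      using assms(1) by (auto intro!: derivative_eq_intros)
    then show "((\<lambda>t. sin (t * l) / l) has_vector_derivative cos (t * l)) (at t within {a..b})"
      by (simp add: has_real_derivative_iff_has_vector_derivative)
  qed
  then show ?thesis by (simp add: diff_divide_distrib)
qed

definition cos_int :: "real \<Rightarrow> real \<Rightarrow> real" where
  "cos_int T l = (if l = 0 then T else (sin (2 * T * l) - sin (T * l)) / l)"

lemma has_integral_cos_int:
  assumes "T \<ge> 0"
  shows "((\<lambda>t. cos (t * l)) has_integral cos_int T l) {T..2 * T}"
proof (cases "l = 0")
  case True
  then show ?thesis using assms has_integral_const_real[of "1::real" T "2 * T"] by (simp add: cos_int_def)
next
  case False
  then show ?thesis using assms has_integral_cos_mult[of l T "2 * T"] by (simp add: cos_int_def)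
qed

lemma abs_cos_int_le: "l \<noteq> 0 \<Longrightarrow> \<bar>cos_int T l\<bar> \<le> 2 / \<bar>l\<bar>"
proof -
  have "\<bar>sin (2 * T * l) - sin (T * l)\<bar> \<le> 2"
    using abs_sin_le_one[of "2 * T * l"] abs_sin_le_one[of "T * l"] by linarith
  then show "l \<noteq> 0 \<Longrightarrow> \<bar>cos_int T l\<bar> \<le> 2 / \<bar>l\<bar>"
    by (simp add: cos_int_def divide_right_mono)
qed

lemma integral_norm_dpoly_square:
  assumes "T \<ge> 0"
  shows "integral {T..2 * T} (\<lambda>t. (norm (dpoly b X t))\<^sup>2)
    = (\<Sum>m=1..X. \<Sum>n=1..X. b m * b n * cos_int T (ln (real m) - ln (real n)))"
  unfolding norm_dpoly_square
  by (intro integral_unique has_integral_sum has_integral_mult_right has_integral_cos_int assms) auto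

lemma ln_diff_ge:
  assumes "0 < m" "m < n"
  shows "ln (real n) - ln (real m) \<ge> (real n - real m) / real n"
proof -
  have "ln (real m / real n) \<le> real m / real n - 1" using assms by (intro ln_le_minus_one) auto
  then show ?thesis using assms by (simp add: ln_div field_simps)
qed

text \<open>The bound ln(n/m) \<ge> (n - m)/n leaves m^(1-\<sigma>) n^(1-\<sigma>) / (m (n - m)).
  The powers are at most X^(2 - 2\<sigma>), and the partial fractions of 1/(m (n - m)) turn the
  double sum into products of harmonic sums.\<close>

lemma off_diagonal_term_le:
  assumes "0 < m" "m < n" "n \<le> X" "\<sigma> \<le> 1"
    and "\<bar>x\<bar> \<le> C * real m powr (- \<sigma>)" "\<bar>y\<bar> \<le> C * real n powr (- \<sigma>)" "C \<ge> 0"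
  shows "\<bar>x\<bar> * \<bar>y\<bar> * (2 / \<bar>ln (real m) - ln (real n)\<bar>)
    \<le> 2 * C\<^sup>2 * real X powr (2 - 2 * \<sigma>) * (1 / real n * (1 / real m + 1 / (real n - real m)))"
proof -
  define M where "M = real m"
  define N where "N = real n"
  have MN: "0 < M" "M < N" "N \<le> real X" using assms by (auto simp: M_def N_def)
  have ln: "ln N - ln M \<ge> (N - M) / N" unfolding M_def N_def by (rule ln_diff_ge[OF assms(1,2)])
  have pos: "(N - M) / N > 0" using MN by simp
  have "2 / \<bar>ln M - ln N\<bar> \<le> 2 / ((N - M) / N)"
    using ln pos by (intro divide_left_mono mult_pos_pos) auto
  then have 1: "2 / \<bar>ln M - ln N\<bar> \<le> 2 * N / (N - M)" by simp
  have "\<bar>x\<bar> * \<bar>y\<bar> * (2 / \<bar>ln M - ln N\<bar>)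
      \<le> (C * M powr (- \<sigma>)) * (C * N powr (- \<sigma>)) * (2 * N / (N - M))"
    using assms 1 MN unfolding M_def N_def by (intro mult_mono) auto
  also have "\<dots> = 2 * C\<^sup>2 * (M powr (1 - \<sigma>) * N powr (1 - \<sigma>)) * (1 / (M * (N - M)))"
    using MN by (simp add: powr_diff powr_minus power2_eq_square field_simps)
  also have "\<dots> \<le> 2 * C\<^sup>2 * (real X powr (1 - \<sigma>) * real X powr (1 - \<sigma>)) * (1 / (M * (N - M)))"
    using MN assms by (intro mult_right_mono mult_left_mono mult_mono powr_mono2) auto
  also have "real X powr (1 - \<sigma>) * real X powr (1 - \<sigma>) = real X powr (2 - 2 * \<sigma>)"
    by (simp flip: powr_add)
  also have "1 / (M * (N - M)) = 1 / N * (1 / M + 1 / (N - M))"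
    using MN by (simp add: field_simps)
  finally show ?thesis unfolding M_def N_def .
qed

text \<open>An elementary mean value theorem for Dirichlet polynomials: the diagonal gives the main
  term, everything else is estimated in absolute value, at the price of the squared harmonic
  sum.\<close>

lemma integral_norm_dpoly_square_approx:
  assumes "T > 0" "\<sigma> \<le> 1" "C \<ge> 0"
    and b: "\<And>n. 1 \<le> n \<Longrightarrow> n \<le> X \<Longrightarrow> \<bar>b n\<bar> \<le> C * real n powr (- \<sigma>)"
  shows "\<bar>integral {T..2 * T} (\<lambda>t. (norm (dpoly b X t))\<^sup>2) - T * (\<Sum>n=1..X. (b n)\<^sup>2)\<bar>
    \<le> 8 * C\<^sup>2 * real X powr (2 - 2 * \<sigma>) * (harm X)\<^sup>2"
proof -
  define A where "A = 2 * C\<^sup>2 * real X powr (2 - 2 * \<sigma>)"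
  have A: "A \<ge> 0" by (simp add: A_def)
  \<comment> \<open>Supported on m < n, so that \<open>v m n + v n m\<close> majorises an
    off-diagonal term in either order and only one sum, doubled by symmetry, has to be
    bounded.\<close>
  define v where "v = (\<lambda>m n. if m < n then A * (1 / real n * (1 / real m + 1 / (real n - real m))) else 0)"
  have "integral {T..2 * T} (\<lambda>t. (norm (dpoly b X t))\<^sup>2) - T * (\<Sum>n=1..X. (b n)\<^sup>2)
      = (\<Sum>m=1..X. \<Sum>n=1..X. b m * b n * cos_int T (ln (real m) - ln (real n)))
        - (\<Sum>m=1..X. \<Sum>n=1..X. if n = m then T * (b m)\<^sup>2 else 0)"
    using assms by (simp add: integral_norm_dpoly_square sum_distrib_left)
  also have "\<dots> = (\<Sum>m=1..X. \<Sum>n=1..X. b m * b n * cos_int T (ln (real m) - ln (real n))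
        - (if n = m then T * (b m)\<^sup>2 else 0))"
    by (simp only: sum_subtractf)
  finally have "\<bar>integral {T..2 * T} (\<lambda>t. (norm (dpoly b X t))\<^sup>2) - T * (\<Sum>n=1..X. (b n)\<^sup>2)\<bar>
      \<le> (\<Sum>m=1..X. \<Sum>n=1..X. \<bar>b m * b n * cos_int T (ln (real m) - ln (real n))
        - (if n = m then T * (b m)\<^sup>2 else 0)\<bar>)"
    by (simp only:) (intro order.trans[OF sum_abs] sum_mono sum_abs)
  also have "\<dots> \<le> (\<Sum>m=1..X. \<Sum>n=1..X. v m n + v n m)"
  proof (intro sum_mono)
    fix m n assume mn: "m \<in> {1..X}" "n \<in> {1..X}"
    consider "m = n" | "m < n" | "n < m" by linarith
    then show "\<bar>b m * b n * cos_int T (ln (real m) - ln (real n)) - (if n = m then T * (b m)\<^sup>2 else 0)\<bar>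
        \<le> v m n + v n m"
    proof cases
      case 1
      then show ?thesis by (simp add: cos_int_def v_def power2_eq_square)
    next
      case 2
      have "\<bar>b m * b n * cos_int T (ln (real m) - ln (real n))\<bar>
          \<le> \<bar>b m\<bar> * \<bar>b n\<bar> * (2 / \<bar>ln (real m) - ln (real n)\<bar>)"
        unfolding abs_mult using 2 mn by (intro mult_left_mono abs_cos_int_le) auto
      also have "\<dots> \<le> v m n" unfolding v_def A_def using 2 mn assms
        by (simp only: if_True) (intro off_diagonal_term_le; auto)
      finally show ?thesis using 2 by (simp add: v_def)
    next
      case 3
      have "\<bar>b m * b n * cos_int T (ln (real m) - ln (real n))\<bar>
          \<le> \<bar>b m\<bar> * \<bar>b n\<bar> * (2 / \<bar>ln (real m) - ln (real n)\<bar>)"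
        unfolding abs_mult using 3 mn by (intro mult_left_mono abs_cos_int_le) auto
      also have "\<dots> = \<bar>b n\<bar> * \<bar>b m\<bar> * (2 / \<bar>ln (real n) - ln (real m)\<bar>)"
        by (simp add: abs_minus_commute mult_ac)
      also have "\<dots> \<le> v n m" unfolding v_def A_def using 3 mn assms
        by (simp only: if_True) (intro off_diagonal_term_le; auto)
      finally show ?thesis using 3 by (simp add: v_def)
    qed
  qed
  also have "\<dots> = (\<Sum>m=1..X. \<Sum>n=1..X. v m n) + (\<Sum>m=1..X. \<Sum>n=1..X. v n m)"
    by (simp only: sum.distrib)
  also have "(\<Sum>m=1..X. \<Sum>n=1..X. v m n) = (\<Sum>m=1..X. \<Sum>n=1..X. v n m)"
    by (rule sum.swap)
  also have "(\<Sum>n=1..X. \<Sum>m=1..X. v m n) \<le> (\<Sum>n=1..X. A * (1 / real n * (2 * harm X)))"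
  proof (intro sum_mono)
    fix n assume n: "n \<in> {1..X}"
    have "(\<Sum>m=1..X. v m n) = (\<Sum>m\<in>{1..<n}. A * (1 / real n * (1 / real m + 1 / (real n - real m))))"
      unfolding v_def using n by (intro sum.mono_neutral_cong_right) auto
    also have "\<dots> = A * (1 / real n * ((\<Sum>m\<in>{1..<n}. 1 / real m) + (\<Sum>m\<in>{1..<n}. 1 / (real n - real m))))"
      by (simp only: sum_distrib_left[symmetric] sum.distrib)
    also have "(\<Sum>m\<in>{1..<n}. 1 / (real n - real m)) = (\<Sum>m\<in>{1..<n}. 1 / real m)"
      by (rule sum.reindex_bij_witness[of _ "\<lambda>m. n - m" "\<lambda>m. n - m"]) (auto simp: of_nat_diff)
    finally have eq: "(\<Sum>m=1..X. v m n) = A * (1 / real n * (2 * (\<Sum>m\<in>{1..<n}. 1 / real m)))" by simp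
    have "(\<Sum>m\<in>{1..<n}. 1 / real m) = (\<Sum>m\<in>{1..<n}. inverse (real m))" by (simp add: divide_inverse)
    also have "\<dots> \<le> (\<Sum>m=1..X. inverse (real m))" using n by (intro sum_mono2) auto
    finally have "(\<Sum>m\<in>{1..<n}. 1 / real m) \<le> harm X" by (simp add: harm_def)
    then show "(\<Sum>m=1..X. v m n) \<le> A * (1 / real n * (2 * harm X))"
      unfolding eq using A n by (intro mult_left_mono) auto
  qed
  also have "(\<Sum>n=1..X. A * (1 / real n * (2 * harm X))) = 2 * A * harm X * harm X"
    unfolding harm_def by (simp add: sum_distrib_left sum_distrib_right divide_inverse mult_ac)
  finally show ?thesis by (simp add: A_def power2_eq_square algebra_simps)
qed

section \<open>Approximation by partial sums\<close>

definition eta_coeff :: "real \<Rightarrow> nat \<Rightarrow> real" where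
  "eta_coeff \<sigma> n = (if n = 0 then 0 else (-1) ^ (n + 1) * real n powr (- \<sigma>))"

lemma abs_eta_coeff: "\<bar>eta_coeff \<sigma> n\<bar> = (if n = 0 then 0 else real n powr (- \<sigma>))"
  by (simp add: eta_coeff_def abs_mult power_abs)

lemma of_nat_powr_Complex:
  assumes "n > 0"
  shows "of_nat n powr (- Complex \<sigma> t) = of_real (real n powr (- \<sigma>)) * cis (- (t * ln (real n)))"
proof -
  have "of_nat n powr (- Complex \<sigma> t) = exp (- Complex \<sigma> t * of_real (ln (real n)))"
    using assms by (simp add: powr_def Ln_of_nat)
  also have "- Complex \<sigma> t * of_real (ln (real n)) = of_real (- \<sigma> * ln (real n)) + \<i> * of_real (- (t * ln (real n)))"
    by (simp add: complex_eq_iff)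
  also have "exp \<dots> = of_real (exp (- \<sigma> * ln (real n))) * cis (- (t * ln (real n)))"
    unfolding exp_add cis_conv_exp exp_of_real ..
  also have "exp (- \<sigma> * ln (real n)) = real n powr (- \<sigma>)"
    using assms by (simp add: powr_def)
  finally show ?thesis .
qed

lemma eta_partial_sum_eq_dpoly:
  "(\<Sum>n<N. (-1) ^ n * of_nat (n + 1) powr (- Complex \<sigma> t)) = dpoly (eta_coeff \<sigma>) N t"
proof -
  have "dpoly (eta_coeff \<sigma>) N t
      = (\<Sum>n<N. of_real (eta_coeff \<sigma> (Suc n)) * cis (- (t * ln (real (Suc n)))))"
    unfolding dpoly_def One_nat_def by (rule sum.atLeast1_atMost_eq)
  also have "\<dots> = (\<Sum>n<N. (-1) ^ n * of_nat (n + 1) powr (- Complex \<sigma> t))"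
  proof (rule sum.cong[OF refl])
    fix n
    show "of_real (eta_coeff \<sigma> (Suc n)) * cis (- (t * ln (real (Suc n))))
        = (-1) ^ n * of_nat (n + 1) powr (- Complex \<sigma> t)"
      using of_nat_powr_Complex[of "Suc n" \<sigma> t] by (simp add: eta_coeff_def)
  qed
  finally show ?thesis ..
qed

text \<open>Of the K factors, K - 2 are kept at size N + 1 and two are spent on convergence in
  m.\<close>

lemma inverse_power_shift_le:
  assumes "K \<ge> 2"
  shows "1 / real (N + 1 + m) ^ K \<le> (real (N + 1))\<^sup>2 / real (N + 1) ^ K * (1 / (real (m + 1))\<^sup>2)"
proof -
  obtain k where K: "K = k + 2" using assms le_Suc_ex by (metis add.commute)
  have "1 / real (N + 1 + m) ^ K = 1 / real (N + 1 + m) ^ k * (1 / real (N + 1 + m) ^ 2)"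
    by (simp add: K power_add power2_eq_square)
  also have "\<dots> \<le> 1 / real (N + 1) ^ k * (1 / real (m + 1) ^ 2)"
    by (intro mult_mono divide_left_mono power_mono mult_pos_pos) auto
  also have "\<dots> = (real (N + 1))\<^sup>2 / real (N + 1) ^ K * (1 / (real (m + 1))\<^sup>2)"
    by (simp add: K power_add power2_eq_square)
  finally show ?thesis .
qed

lemma summable_inverse_squares_shift: "summable (\<lambda>m. 1 / (real (m + 1))\<^sup>2)"
proof -
  have "summable (\<lambda>m. real (0 + 1 + m) powr (- 2))" by (rule summable_powr_shift) simp
  then show ?thesis by (simp add: powr_minus powr_numeral divide_inverse add_ac)
qed

text \<open>With q = Y/(N + 1) \<le> 1 the j-th boundary term is at most q^j (N + 1)^(-Re s), and
  the weights 1/2^(j+1) add up to less than 1. The remaining series contributes q^K up to the factor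
  (N + 1)^2, which a large K absorbs.\<close>

lemma norm_etaE_diff_le:
  assumes s: "Re s \<ge> 0" and K: "K \<ge> 2" and Y: "norm s + real K \<le> Y" "Y \<le> real (N + 1)"
  shows "norm (etaE K N s - (\<Sum>n<N. (-1) ^ n * of_nat (n + 1) powr (- s)))
    \<le> real (N + 1) powr (- Re s)
      + (\<Sum>m. 1 / (real (m + 1))\<^sup>2) * (real (N + 1))\<^sup>2 * (Y / real (N + 1)) ^ K"
proof -
  have Y0: "Y \<ge> 0" using Y norm_ge_zero[of s] by linarith
  define q where "q = Y / real (N + 1)"
  have q: "0 \<le> q" "q \<le> 1" using Y0 Y by (auto simp: q_def)
  have j: "norm (fdiff j s (of_nat (N + 1))) \<le> real (N + 1) powr (- Re s)" if "j < K" for j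
  proof -
    have "norm (fdiff j s (of_real (real (N + 1)))) \<le> Y ^ j * real (N + 1) powr (- (Re s + real j))"
      using Y that s by (intro norm_fdiff_le') auto
    also have "\<dots> = q ^ j * real (N + 1) powr (- Re s)"
      by (simp add: q_def powr_diff powr_minus powr_realpow power_divide field_simps)
    also have "\<dots> \<le> 1 * real (N + 1) powr (- Re s)"
      using q by (intro mult_right_mono power_le_one) auto
    finally show ?thesis by simp
  qed
  have geo: "(\<Sum>j<K. x / 2 ^ (j + 1)) \<le> x" if "x \<ge> 0" for x :: real
  proof -
    have "(\<Sum>j<K. x / 2 ^ (j + 1)) = x - x / 2 ^ K" by (induction K) (simp_all add: field_simps)
    then show ?thesis using that by simp
  qed
  have A: "norm (\<Sum>j<K. fdiff j s (of_nat (N + 1)) / 2 ^ (j + 1)) \<le> real (N + 1) powr (- Re s)"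
  proof -
    have "norm (\<Sum>j<K. fdiff j s (of_nat (N + 1)) / 2 ^ (j + 1))
        \<le> (\<Sum>j<K. real (N + 1) powr (- Re s) / 2 ^ (j + 1))"
      using j by (intro sum_norm_le) (auto simp: norm_divide norm_power divide_right_mono norm_mult)
    also have "\<dots> \<le> real (N + 1) powr (- Re s)" by (rule geo) simp
    finally show ?thesis .
  qed
  define c where "c = Y ^ K * ((real (N + 1))\<^sup>2 / real (N + 1) ^ K)"
  have sK: "Re s + real K > 1" using s K by linarith
  have bd: "norm ((-1) ^ m * fdiff K s (of_nat (N + 1 + m))) \<le> c * (1 / (real (m + 1))\<^sup>2)" for m
  proof -
    have "norm (fdiff K s (of_real (real (N + 1 + m)))) \<le> Y ^ K * real (N + 1 + m) powr (- (Re s + real K))"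
      using Y sK by (intro norm_fdiff_le') auto
    also have "\<dots> \<le> Y ^ K * real (N + 1 + m) powr (- real K)"
      using Y0 s by (intro mult_left_mono powr_mono) auto
    also have "\<dots> = Y ^ K * (1 / real (N + 1 + m) ^ K)"
      by (subst powr_minus, subst powr_realpow) (auto simp: divide_inverse)
    also have "\<dots> \<le> Y ^ K * ((real (N + 1))\<^sup>2 / real (N + 1) ^ K * (1 / (real (m + 1))\<^sup>2))"
      using Y0 K by (intro mult_left_mono inverse_power_shift_le) auto
    finally show ?thesis by (simp add: norm_mult norm_power c_def mult_ac)
  qed
  have c: "c \<ge> 0" using Y0 by (simp add: c_def)
  have S0: "(\<Sum>m. 1 / (real (m + 1))\<^sup>2) \<ge> 0"
    by (intro suminf_nonneg summable_inverse_squares_shift) auto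
  have B: "norm (etaT K N s) \<le> c * (\<Sum>m. 1 / (real (m + 1))\<^sup>2)"
  proof -
    have "norm (etaT K N s) \<le> (\<Sum>m. c * (1 / (real (m + 1))\<^sup>2))"
      unfolding etaT_def using bd
      by (intro norm_suminf_le summable_mult summable_inverse_squares_shift) auto
    also have "\<dots> = c * (\<Sum>m. 1 / (real (m + 1))\<^sup>2)"
      by (intro suminf_mult summable_inverse_squares_shift)
    finally show ?thesis .
  qed
  have "norm (etaT K N s / 2 ^ K) \<le> c * (\<Sum>m. 1 / (real (m + 1))\<^sup>2)"
  proof -
    have "norm (etaT K N s / 2 ^ K) = norm (etaT K N s) / 2 ^ K" by (simp add: norm_divide norm_power)
    also have "\<dots> \<le> norm (etaT K N s) / 1" by (intro divide_left_mono) auto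
    finally show ?thesis using B by simp
  qed
  then have "norm ((\<Sum>j<K. fdiff j s (of_nat (N + 1)) / 2 ^ (j + 1)) + etaT K N s / 2 ^ K)
      \<le> real (N + 1) powr (- Re s) + c * (\<Sum>m. 1 / (real (m + 1))\<^sup>2)"
    using A by (intro norm_triangle_le add_mono)
  moreover have "c = (real (N + 1))\<^sup>2 * (Y / real (N + 1)) ^ K"
    by (simp add: c_def power_divide)
  ultimately show ?thesis by (simp add: etaE_def norm_mult norm_power mult_ac)
qed

text \<open>On [T, 2T] the modulus of s is of order T, so at N of order T^(1+\<eta>) each summation
  by parts gains T^(-\<eta>), and a number of them that does not depend on T makes the remainder a
  negative power of T.\<close>

theorem eta_approx:
  assumes "0 < \<eta>" "0 < \<sigma>" "\<sigma> < 1"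
  shows "\<exists>err. (err \<longlongrightarrow> 0) at_top \<and> (\<forall>\<^sub>F T in at_top. \<forall>t\<in>{T..2 * T}.
    norm ((1 - 2 powr (1 - Complex \<sigma> t)) * zeta (Complex \<sigma> t)
      - dpoly (eta_coeff \<sigma>) (nat \<lfloor>T powr (1 + \<eta>)\<rfloor>) t) \<le> err T)"
proof -
  define S where "S = (\<Sum>m. 1 / (real (m + 1))\<^sup>2)"
  have S: "S \<ge> 0" unfolding S_def by (intro suminf_nonneg summable_inverse_squares_shift) auto
  \<comment> \<open>This gives \<eta> K \<ge> 3 + 3\<eta>, which beats the factor (N + 1)^2 of order
    T^(2(1+\<eta>)).\<close>
  define K where "K = nat \<lceil>3 / \<eta>\<rceil> + 3"
  have K: "K \<ge> 2" "\<eta> * real K > 2 * (1 + \<eta>)"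
  proof -
    have "real K \<ge> 3 / \<eta> + 3" unfolding K_def by linarith
    then have "\<eta> * real K \<ge> \<eta> * (3 / \<eta> + 3)" using assms by (intro mult_left_mono) auto
    then show "\<eta> * real K > 2 * (1 + \<eta>)" using assms by (simp add: algebra_simps)
  qed (simp add: K_def)
  define err where "err = (\<lambda>T::real. T powr (- (1 + \<eta>) * \<sigma>) + S * 4 * 3 ^ K * T powr (2 * (1 + \<eta>) - \<eta> * real K))"
  have "(err \<longlongrightarrow> 0 + S * 4 * 3 ^ K * 0) at_top"
    unfolding err_def using assms K
    by (intro tendsto_add tendsto_mult tendsto_const tendsto_neg_powr filterlim_ident) (auto intro: mult_neg_pos)
  then have "(err \<longlongrightarrow> 0) at_top" by simp
  moreover have "\<forall>\<^sub>F T in at_top. \<forall>t\<in>{T..2 * T}.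
    norm ((1 - 2 powr (1 - Complex \<sigma> t)) * zeta (Complex \<sigma> t)
      - dpoly (eta_coeff \<sigma>) (nat \<lfloor>T powr (1 + \<eta>)\<rfloor>) t) \<le> err T"
  proof -
    \<comment> \<open>T^\<eta> \<ge> 3 gives 3T \<le> T^(1+\<eta>), and T \<ge> K + 1 gives |s| + K
      \<le> 1 + 2T + K \<le> 3T; so Y = 3T meets both requirements of
      \<open>norm_etaE_diff_le\<close>.\<close>
    have "filterlim (\<lambda>T::real. T powr \<eta>) at_top at_top"
      using assms by real_asymp
    then have "\<forall>\<^sub>F T::real in at_top. T powr \<eta> \<ge> 3" by (simp add: filterlim_at_top)
    moreover have "\<forall>\<^sub>F T::real in at_top. T \<ge> real K + 1" by (rule eventually_ge_at_top)
    ultimately show ?thesis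
    proof eventually_elim
      case (elim T)
      have T: "T \<ge> 1" using elim(2) by simp
      define M where "M = T powr (1 + \<eta>)"
      define N where "N = nat \<lfloor>M\<rfloor>"
      have M1: "M \<ge> 1" using T assms unfolding M_def by (intro ge_one_powr_ge_zero) auto
      have N: "real N \<le> M" "M \<le> real (N + 1)" using M1 unfolding N_def by linarith+
      have N2: "real (N + 1) \<le> 2 * M" using N M1 by linarith
      have MT: "M = T * T powr \<eta>" using T by (simp add: M_def powr_add)
      have MY: "3 * T \<le> M" using T elim(1) unfolding MT by (simp add: mult.commute[of 3])
      show ?case
      proof
        fix t assume t: "t \<in> {T..2 * T}"
        define s where "s = Complex \<sigma> t"
        have "norm s \<le> \<bar>Re s\<bar> + \<bar>Im s\<bar>" by (rule cmod_le)
        also have "\<dots> \<le> 1 + 2 * T" using t T assms by (auto simp: s_def)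
        finally have ns: "norm s + real K \<le> 3 * T" using elim(2) by linarith
        have "norm (etaE K N s - (\<Sum>n<N. (-1) ^ n * of_nat (n + 1) powr (- s)))
            \<le> real (N + 1) powr (- Re s) + S * (real (N + 1))\<^sup>2 * (3 * T / real (N + 1)) ^ K"
          unfolding S_def using ns K(1) assms MY N by (intro norm_etaE_diff_le) (auto simp: s_def)
        also have "\<dots> \<le> M powr (- \<sigma>) + S * (2 * M)\<^sup>2 * (3 * T / M) ^ K"
        proof (rule add_mono)
          show "real (N + 1) powr (- Re s) \<le> M powr (- \<sigma>)"
            using N M1 assms by (auto simp: s_def intro!: powr_mono2')
          show "S * (real (N + 1))\<^sup>2 * (3 * T / real (N + 1)) ^ K \<le> S * (2 * M)\<^sup>2 * (3 * T / M) ^ K"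
            using S N N2 M1 T
            by (intro mult_mono power_mono divide_left_mono mult_nonneg_nonneg) auto
        qed
        also have "M powr (- \<sigma>) = T powr (- (1 + \<eta>) * \<sigma>)"
          unfolding M_def powr_powr by (simp add: algebra_simps)
        also have "S * (2 * M)\<^sup>2 * (3 * T / M) ^ K = S * 4 * 3 ^ K * T powr (2 * (1 + \<eta>) - \<eta> * real K)"
        proof -
          have "3 * T / M = 3 * T powr (- \<eta>)"
            using T by (simp add: MT powr_minus field_simps)
          then have "(3 * T / M) ^ K = 3 ^ K * (T powr (- \<eta>)) ^ K"
            by (simp add: power_mult_distrib)
          also have "(T powr (- \<eta>)) ^ K = T powr (- \<eta> * real K)"
            using T by (simp add: powr_powr flip: powr_realpow)
          finally have 1: "(3 * T / M) ^ K = 3 ^ K * T powr (- \<eta> * real K)" .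
          have "M\<^sup>2 = T powr (2 * (1 + \<eta>))"
            unfolding M_def using T by (simp add: powr_powr mult.commute flip: powr_realpow)
          then have "(2 * M)\<^sup>2 * T powr (- \<eta> * real K) = 4 * T powr (2 * (1 + \<eta>) - \<eta> * real K)"
            by (simp add: power_mult_distrib powr_diff powr_minus divide_inverse)
          then show ?thesis unfolding 1 by (simp add: algebra_simps)
        qed
        finally have "norm (etaE K N s - (\<Sum>n<N. (-1) ^ n * of_nat (n + 1) powr (- s))) \<le> err T"
          by (simp add: err_def)
        moreover have "etaE K N s = (1 - 2 powr (1 - s)) * zeta s"
          using K(1) assms t T by (intro etaE_eq_zeta) (auto simp: s_def complex_eq_iff)
        ultimately show "norm ((1 - 2 powr (1 - Complex \<sigma> t)) * zeta (Complex \<sigma> t)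
            - dpoly (eta_coeff \<sigma>) (nat \<lfloor>T powr (1 + \<eta>)\<rfloor>) t) \<le> err T"
          unfolding s_def eta_partial_sum_eq_dpoly N_def M_def by simp
      qed
    qed
  qed
  ultimately show ?thesis by blast
qed

section \<open>Dirichlet convolution\<close>

text \<open>At m = 0 the range {1..m} is empty, so the value there is 0 although every d divides
  0.\<close>

definition dconv :: "(nat \<Rightarrow> real) \<Rightarrow> (nat \<Rightarrow> real) \<Rightarrow> nat \<Rightarrow> real" where
  "dconv c b m = (\<Sum>d\<in>{d\<in>{1..m}. d dvd m}. c d * b (m div d))"

definition trunc :: "nat \<Rightarrow> (nat \<Rightarrow> real) \<Rightarrow> nat \<Rightarrow> real" where
  "trunc N b n = (if n \<le> N then b n else 0)"

text \<open>The pairs (d, n) are grouped by their product. Both sequences are truncated because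
  products run up to QN, while only d \<le> Q and n \<le> N occur.\<close>

lemma dpoly_mult:
  "dpoly c Q t * dpoly b N t = dpoly (dconv (trunc Q c) (trunc N b)) (Q * N) t"
proof -
  define S where "S = {1..Q} \<times> {1..N}"
  define h where "h = (\<lambda>x. of_real (c (fst x) * b (snd x)) * cis (- (t * ln (real (fst x * snd x)))))"
  have "dpoly c Q t * dpoly b N t = (\<Sum>x\<in>S. h x)"
    unfolding dpoly_def sum_product S_def sum.cartesian_product
  proof (intro sum.cong refl, clarify)
    fix d n assume "d \<in> {1..Q}" "n \<in> {1..N}"
    then have "ln (real (d * n)) = ln (real d) + ln (real n)" by (simp add: ln_mult)
    then have "cis (- (t * ln (real (d * n)))) = cis (- (t * ln (real d))) * cis (- (t * ln (real n)))"
      by (simp add: cis_mult algebra_simps)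
    then show "of_real (c d) * cis (- (t * ln (real d))) * (of_real (b n) * cis (- (t * ln (real n)))) = h (d, n)"
      by (simp add: h_def mult_ac del: of_nat_mult)
  qed
  also have "\<dots> = (\<Sum>m\<in>{1..Q * N}. \<Sum>x\<in>{x\<in>S. fst x * snd x = m}. h x)"
    by (rule sum.group[symmetric]) (auto simp: S_def mult_le_mono)
  also have "\<dots> = dpoly (dconv (trunc Q c) (trunc N b)) (Q * N) t"
    unfolding dpoly_def
  proof (rule sum.cong[OF refl])
    fix m assume m: "m \<in> {1..Q * N}"
    define D where "D = {d\<in>{1..m}. d dvd m \<and> d \<le> Q \<and> m div d \<le> N}"
    have "dconv (trunc Q c) (trunc N b) m = (\<Sum>d\<in>D. c d * b (m div d))"
      unfolding dconv_def D_def trunc_def by (rule sum.mono_neutral_cong_right) auto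
    also have "\<dots> = (\<Sum>x\<in>{x\<in>S. fst x * snd x = m}. c (fst x) * b (snd x))"
      by (rule sum.reindex_bij_witness[of _ fst "\<lambda>d. (d, m div d)"])
         (use m in \<open>auto simp: D_def S_def dvd_div_eq_0_iff Suc_le_eq elim!: dvdE\<close>)
    finally have "of_real (dconv (trunc Q c) (trunc N b) m) * cis (- (t * ln (real m)))
        = (\<Sum>x\<in>{x\<in>S. fst x * snd x = m}. of_real (c (fst x) * b (snd x)) * cis (- (t * ln (real m))))"
      by (simp only: of_real_sum sum_distrib_right)
    also have "\<dots> = (\<Sum>x\<in>{x\<in>S. fst x * snd x = m}. h x)"
      unfolding h_def by (intro sum.cong) auto
    finally show "(\<Sum>x\<in>{x\<in>S. fst x * snd x = m}. h x)
        = of_real (dconv (trunc Q c) (trunc N b) m) * cis (- (t * ln (real m)))" ..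
  qed
  finally show ?thesis .
qed

lemma dconv_trunc_eq: "m \<le> N \<Longrightarrow> dconv c (trunc N b) m = dconv c b m"
  unfolding dconv_def trunc_def
  by (intro sum.cong) (auto intro: order.trans[OF div_le_dividend])

text \<open>(m/d)^(-\<sigma>) = d^\<sigma> m^(-\<sigma>), and only d \<le> Q occur; the constant is
  thus the same for every m and for every truncation of b.\<close>

lemma abs_dconv_le:
  assumes c: "\<And>n. n > Q \<Longrightarrow> c n = 0" and b: "\<And>n. n > 0 \<Longrightarrow> \<bar>b n\<bar> \<le> real n powr (- \<sigma>)"
  shows "\<bar>dconv c b m\<bar> \<le> (\<Sum>d=1..Q. \<bar>c d\<bar> * real d powr \<sigma>) * real m powr (- \<sigma>)"
proof -
  have c': "n \<le> Q" if "c n \<noteq> 0" for n using c that by (meson not_le)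
  have "\<bar>dconv c b m\<bar> \<le> (\<Sum>d\<in>{d\<in>{1..m}. d dvd m}. \<bar>c d\<bar> * \<bar>b (m div d)\<bar>)"
    unfolding dconv_def by (rule order.trans[OF sum_abs]) (simp add: abs_mult)
  also have "\<dots> \<le> (\<Sum>d\<in>{d\<in>{1..m}. d dvd m}. \<bar>c d\<bar> * real d powr \<sigma> * real m powr (- \<sigma>))"
  proof (intro sum_mono)
    fix d assume d: "d \<in> {d\<in>{1..m}. d dvd m}"
    then have pos: "m div d > 0" by (auto elim!: dvdE)
    have "real (m div d) powr (- \<sigma>) = real d powr \<sigma> * real m powr (- \<sigma>)"
    proof -
      have "real (m div d) = real m / real d" using d by (simp add: real_of_nat_div)
      then show ?thesis using d by (simp only: powr_divide of_nat_0_le_iff) (simp add: powr_minus divide_inverse)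
    qed
    then have "\<bar>b (m div d)\<bar> \<le> real d powr \<sigma> * real m powr (- \<sigma>)"
      using b[OF pos] by simp
    then show "\<bar>c d\<bar> * \<bar>b (m div d)\<bar> \<le> \<bar>c d\<bar> * real d powr \<sigma> * real m powr (- \<sigma>)"
      by (metis abs_ge_zero mult.assoc mult_left_mono)
  qed
  also have "\<dots> \<le> (\<Sum>d=1..Q. \<bar>c d\<bar> * real d powr \<sigma> * real m powr (- \<sigma>))"
  proof -
    have "(\<Sum>d\<in>{d\<in>{1..m}. d dvd m}. \<bar>c d\<bar> * real d powr \<sigma> * real m powr (- \<sigma>))
        = (\<Sum>d\<in>{d\<in>{1..m}. d dvd m \<and> d \<le> Q}. \<bar>c d\<bar> * real d powr \<sigma> * real m powr (- \<sigma>))"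
      by (rule sum.mono_neutral_right) (auto dest: c')
    also have "\<dots> \<le> (\<Sum>d=1..Q. \<bar>c d\<bar> * real d powr \<sigma> * real m powr (- \<sigma>))"
      by (rule sum_mono2) auto
    finally show ?thesis .
  qed
  also have "\<dots> = (\<Sum>d=1..Q. \<bar>c d\<bar> * real d powr \<sigma>) * real m powr (- \<sigma>)"
    by (simp only: sum_distrib_right)
  finally show ?thesis .
qed

section \<open>The mean square of zeta times a Dirichlet polynomial\<close>

lemma harm_le_ln:
  assumes "n \<ge> 1"
  shows "harm n \<le> 1 + ln (real n)"
proof -
  obtain m where m: "n = Suc m" using assms by (cases n) auto
  have "harm (Suc m) - ln (real (Suc m)) \<le> harm (Suc 0) - ln (real (Suc 0))"
    using decseqD[OF decseq_harm_diff_ln, of 0 m] by simp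
  then show ?thesis unfolding m by (simp add: harm_def)
qed

lemma summable_square_powr:
  assumes "\<sigma> > 1 / 2"
  shows "summable (\<lambda>n. (C * real n powr (- \<sigma>))\<^sup>2)"
proof -
  have "summable (\<lambda>n. C\<^sup>2 * real n powr (- (2 * \<sigma>)))"
    using assms by (intro summable_mult) (simp add: summable_real_powr_iff)
  moreover have "(C * real n powr (- \<sigma>))\<^sup>2 = C\<^sup>2 * real n powr (- (2 * \<sigma>))" for n
    by (simp add: power_mult_distrib power2_eq_square flip: powr_add)
  ultimately show ?thesis by simp
qed

definition avg :: "real \<Rightarrow> (real \<Rightarrow> real) \<Rightarrow> real" where
  "avg T f = integral {T..2 * T} f / T"

text \<open>The exponent \<sigma> + 1/2 exceeds 1, as \<open>eta_approx\<close> requires, and still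
  makes the off-diagonal error X^(2 - 2\<sigma>) (ln X)^2 of smaller order than T, because (\<sigma>
  + 1/2)(2 - 2\<sigma>) - 1 = -\<sigma>(2\<sigma> - 1) < 0.\<close>

lemma tendsto_avg_dpoly_product:
  assumes \<sigma>: "1 / 2 < \<sigma>" "\<sigma> < 1" and Q: "Q \<ge> 1"
    and c: "\<And>n. n > Q \<Longrightarrow> c n = 0"
    and b: "\<And>n. n > 0 \<Longrightarrow> \<bar>b n\<bar> \<le> real n powr (- \<sigma>)"
  shows "((\<lambda>T. avg T (\<lambda>t. (norm (dpoly c Q t * dpoly b (nat \<lfloor>T powr (\<sigma> + 1 / 2)\<rfloor>) t))\<^sup>2))
    \<longlongrightarrow> (\<Sum>m. (dconv c b m)\<^sup>2)) at_top"
proof -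
  define N where "N = (\<lambda>T::real. nat \<lfloor>T powr (\<sigma> + 1 / 2)\<rfloor>)"
  define g where "g = (\<lambda>T. dconv c (trunc (N T) b))"
  define C where "C = (\<Sum>d=1..Q. \<bar>c d\<bar> * real d powr \<sigma>)"
  have C0: "C \<ge> 0" unfolding C_def by (intro sum_nonneg) auto
  have cQ: "trunc Q c = c" using c by (auto simp: trunc_def fun_eq_iff not_le)
  have g_le: "\<bar>g T m\<bar> \<le> C * real m powr (- \<sigma>)" for T m
    unfolding g_def C_def using c b by (intro abs_dconv_le) (auto simp: trunc_def)
  define G where "G = (\<lambda>T. \<Sum>m=1..Q * N T. (g T m)\<^sup>2)"
  have Nlim: "filterlim N at_top at_top"
    unfolding N_def using \<sigma>
    by (intro filterlim_compose[OF filterlim_nat_sequentially] filterlim_compose[OF filterlim_floor_sequentially]) real_asymp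
  have G: "(G \<longlongrightarrow> (\<Sum>m. (dconv c b m)\<^sup>2)) at_top"
  proof -
    \<comment> \<open>The coefficients change with the truncation at \<open>N T\<close>, but each is
      eventually constant, and their squares lie under (C m^(-\<sigma>))^2, summable for \<sigma> >
      1/2: dominated convergence for series.\<close>
    define a where "a = (\<lambda>m T. if m \<in> {1..Q * N T} then (g T m)\<^sup>2 else 0)"
    have "((\<lambda>T. \<Sum>m. a m T) \<longlongrightarrow> (\<Sum>m. (dconv c b m)\<^sup>2)) at_top"
    proof (rule tannerys_theorem[THEN conjunct2, THEN conjunct2])
      fix m
      have "\<forall>\<^sub>F T in at_top. N T \<ge> m" using Nlim by (simp add: filterlim_at_top)
      then have "\<forall>\<^sub>F T in at_top. a m T = (dconv c b m)\<^sup>2"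
      proof eventually_elim
        case (elim T)
        have "N T \<le> Q * N T" using Q by simp
        then have "m \<le> Q * N T" using elim by linarith
        moreover have "g T m = dconv c b m" using elim by (simp add: g_def dconv_trunc_eq)
        moreover have "dconv c b 0 = 0" by (simp add: dconv_def)
        ultimately show ?case by (cases "m = 0") (auto simp: a_def)
      qed
      then show "((\<lambda>T. a m T) \<longlongrightarrow> (dconv c b m)\<^sup>2) at_top" by (rule tendsto_eventually)
    next
      have "norm (a m T) \<le> (C * real m powr (- \<sigma>))\<^sup>2" for m T
        using g_le[of T m] power_mono[OF g_le[of T m], of 2] by (auto simp: a_def)
      then show "\<forall>\<^sub>F (k, n) in at_top \<times>\<^sub>F at_top. norm (a k n) \<le> (C * real k powr (- \<sigma>))\<^sup>2"
        by (auto intro!: always_eventually)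
      show "summable (\<lambda>k. (C * real k powr (- \<sigma>))\<^sup>2)" using \<sigma> by (intro summable_square_powr)
    qed auto
    moreover have "(\<Sum>m. a m T) = G T" for T
    proof -
      have "(\<Sum>m. a m T) = (\<Sum>m=1..Q * N T. a m T)" by (rule suminf_finite) (auto simp: a_def)
      also have "\<dots> = G T" unfolding G_def a_def by (rule sum.cong) auto
      finally show ?thesis .
    qed
    ultimately show ?thesis by simp
  qed
  define p where "p = (\<sigma> + 1 / 2) * (2 - 2 * \<sigma>) - 1"
  have p: "p < 0"
  proof -
    have "p = - (\<sigma> * (2 * \<sigma> - 1))" by (simp add: p_def algebra_simps)
    then show ?thesis using \<sigma> by simp
  qed
  define q where "q = 1 + ln (real Q)"
  define e where "e = (\<lambda>T::real. (8 * C\<^sup>2 * real Q powr (2 - 2 * \<sigma>)) * (T powr p * (q + (\<sigma> + 1 / 2) * ln T)\<^sup>2))"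
  have "((\<lambda>T::real. T powr p * (q + (\<sigma> + 1 / 2) * ln T)\<^sup>2) \<longlongrightarrow> 0) at_top"
    using p \<sigma> by real_asymp
  then have e: "(e \<longlongrightarrow> 0) at_top" unfolding e_def by (rule tendsto_mult_right_zero)
  have "\<forall>\<^sub>F T::real in at_top. T \<ge> 1" by (rule eventually_ge_at_top)
  moreover have "\<forall>\<^sub>F T in at_top. N T \<ge> 1" using Nlim by (simp add: filterlim_at_top)
  ultimately have "\<forall>\<^sub>F T in at_top. norm (avg T (\<lambda>t. (norm (dpoly c Q t * dpoly b (N T) t))\<^sup>2) - G T) \<le> e T"
  proof eventually_elim
    case (elim T)
    define X where "X = Q * N T"
    have X1: "X \<ge> 1" using Q elim by (simp add: X_def)
    have "real (N T) \<le> T powr (\<sigma> + 1 / 2)" unfolding N_def by (simp add: of_nat_floor)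
    then have XT: "real X \<le> real Q * T powr (\<sigma> + 1 / 2)" by (simp add: X_def mult_left_mono)
    have "harm X \<le> 1 + ln (real X)" by (rule harm_le_ln[OF X1])
    also have "ln (real X) \<le> ln (real Q * T powr (\<sigma> + 1 / 2))"
      using XT X1 by (subst ln_le_cancel_iff) auto
    also have "\<dots> = ln (real Q) + (\<sigma> + 1 / 2) * ln T"
      using Q elim by (simp add: ln_mult ln_powr)
    finally have H: "harm X \<le> q + (\<sigma> + 1 / 2) * ln T" by (simp add: q_def)
    have "\<bar>integral {T..2 * T} (\<lambda>t. (norm (dpoly (g T) X t))\<^sup>2) - T * (\<Sum>n=1..X. (g T n)\<^sup>2)\<bar>
        \<le> 8 * C\<^sup>2 * real X powr (2 - 2 * \<sigma>) * (harm X)\<^sup>2"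
      using elim \<sigma> C0 g_le by (intro integral_norm_dpoly_square_approx) auto
    also have "\<dots> \<le> 8 * C\<^sup>2 * (real Q * T powr (\<sigma> + 1 / 2)) powr (2 - 2 * \<sigma>) * (q + (\<sigma> + 1 / 2) * ln T)\<^sup>2"
      using XT H \<sigma> C0 harm_nonneg[of X]
      by (intro mult_mono power_mono powr_mono2 mult_nonneg_nonneg) auto
    also have "\<dots> = e T * T"
    proof -
      have "(real Q * T powr (\<sigma> + 1 / 2)) powr (2 - 2 * \<sigma>)
          = real Q powr (2 - 2 * \<sigma>) * T powr ((\<sigma> + 1 / 2) * (2 - 2 * \<sigma>))"
        by (simp add: powr_mult powr_powr)
      also have "T powr ((\<sigma> + 1 / 2) * (2 - 2 * \<sigma>)) = T powr p * T"
        using elim by (simp add: p_def powr_diff)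
      finally show ?thesis by (simp add: e_def)
    qed
    finally have I: "\<bar>integral {T..2 * T} (\<lambda>t. (norm (dpoly (g T) X t))\<^sup>2) - T * G T\<bar> \<le> e T * T"
      by (simp add: G_def X_def)
    have "avg T (\<lambda>t. (norm (dpoly c Q t * dpoly b (N T) t))\<^sup>2) - G T
        = (integral {T..2 * T} (\<lambda>t. (norm (dpoly (g T) X t))\<^sup>2) - T * G T) / T"
      using elim unfolding avg_def dpoly_mult cQ by (simp add: g_def X_def diff_divide_distrib)
    then show ?case using I elim by (simp add: pos_divide_le_eq)
  qed
  then have "((\<lambda>T. avg T (\<lambda>t. (norm (dpoly c Q t * dpoly b (N T) t))\<^sup>2) - G T) \<longlongrightarrow> 0) at_top"
    by (rule Lim_null_comparison[OF _ e])
  from tendsto_add[OF this G] show ?thesis by (simp add: N_def)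
qed

text \<open>The squares differ by at most \<delta>(\<delta> + 2|P|), and 2|P| \<le> 1 + |P|^2 turns
  the linear term into the mean square that is already under control.\<close>

lemma avg_norm_square_perturb:
  assumes "T > 0" "continuous_on {T..2 * T} F" "continuous_on {T..2 * T} P" "\<delta> \<ge> 0"
    and F: "\<And>t. t \<in> {T..2 * T} \<Longrightarrow> norm (F t - P t :: complex) \<le> \<delta>"
  shows "\<bar>avg T (\<lambda>t. (norm (F t))\<^sup>2) - avg T (\<lambda>t. (norm (P t))\<^sup>2)\<bar>
    \<le> \<delta> * (1 + avg T (\<lambda>t. (norm (P t))\<^sup>2)) + \<delta>\<^sup>2"
proof -
  have i: "(\<lambda>t. (norm (F t))\<^sup>2) integrable_on {T..2 * T}" "(\<lambda>t. (norm (P t))\<^sup>2) integrable_on {T..2 * T}"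
    using assms by (auto intro!: integrable_continuous_real continuous_intros)
  have pt: "\<bar>(norm (F t))\<^sup>2 - (norm (P t))\<^sup>2\<bar> \<le> (\<delta> + \<delta>\<^sup>2) + \<delta> * (norm (P t))\<^sup>2"
    if "t \<in> {T..2 * T}" for t
  proof -
    define x y where "x = norm (F t)" and "y = norm (P t)"
    have xy: "\<bar>x - y\<bar> \<le> \<delta>" "0 \<le> x" "0 \<le> y"
      using F[OF that] norm_triangle_ineq3[of "F t" "P t"] by (auto simp: x_def y_def)
    have "\<bar>x\<^sup>2 - y\<^sup>2\<bar> = \<bar>x - y\<bar> * (x + y)"
      using xy by (simp add: power2_eq_square square_diff_square_factored abs_mult mult.commute)
    also have "\<dots> \<le> \<delta> * (\<delta> + 2 * y)"
      using xy assms by (intro mult_mono) auto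
    also have "\<dots> = \<delta> * (2 * y) + \<delta>\<^sup>2" by (simp add: power2_eq_square algebra_simps)
    also have "\<dots> \<le> \<delta> * (1 + y\<^sup>2) + \<delta>\<^sup>2"
      using assms sum_squares_bound[of y 1] by (intro add_mono mult_left_mono) auto
    finally show ?thesis by (simp add: x_def y_def algebra_simps)
  qed
  have "\<bar>integral {T..2 * T} (\<lambda>t. (norm (F t))\<^sup>2 - (norm (P t))\<^sup>2)\<bar>
      \<le> integral {T..2 * T} (\<lambda>t. (\<delta> + \<delta>\<^sup>2) + \<delta> * (norm (P t))\<^sup>2)"
    unfolding real_norm_def[symmetric] using i pt
    by (intro integral_norm_bound_integral integrable_diff integrable_add integrable_on_mult_right) auto
  also have "integral {T..2 * T} (\<lambda>t. (\<delta> + \<delta>\<^sup>2) + \<delta> * (norm (P t))\<^sup>2)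
      = (\<delta> + \<delta>\<^sup>2) * T + \<delta> * integral {T..2 * T} (\<lambda>t. (norm (P t))\<^sup>2)"
    using i assms by (subst integral_add) (auto intro!: integrable_on_mult_right)
  finally have "\<bar>integral {T..2 * T} (\<lambda>t. (norm (F t))\<^sup>2) - integral {T..2 * T} (\<lambda>t. (norm (P t))\<^sup>2)\<bar> / T
      \<le> ((\<delta> + \<delta>\<^sup>2) * T + \<delta> * integral {T..2 * T} (\<lambda>t. (norm (P t))\<^sup>2)) / T"
    using assms i by (intro divide_right_mono) (simp_all add: integral_diff)
  then show ?thesis using assms unfolding avg_def
    by (simp add: add_divide_distrib algebra_simps abs_divide flip: diff_divide_distrib)
qed

lemma continuous_on_Complex_line [continuous_intros]: "continuous_on A (Complex \<sigma>)"
proof -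
  have "Complex \<sigma> = (\<lambda>t. of_real \<sigma> + \<i> * of_real t)" by (auto simp: complex_eq_iff)
  then show ?thesis by (auto intro!: continuous_intros)
qed

lemma continuous_on_zeta_line:
  assumes "\<sigma> \<noteq> 1"
  shows "continuous_on A (\<lambda>t. zeta (Complex \<sigma> t))"
  by (rule continuous_on_compose2[OF holomorphic_on_imp_continuous_on[OF zeta_holomorphic]])
     (use assms in \<open>auto intro!: continuous_intros simp: complex_eq_iff\<close>)

lemma continuous_on_eta_factor: "continuous_on A (\<lambda>t. 1 - 2 powr (1 - Complex \<sigma> t) :: complex)"
  unfolding powr_def by (auto intro!: continuous_intros)

text \<open>The fixed polynomial is bounded by the sum of \<open>\<bar>c n\<bar>\<close>, so the
  approximation of the alternating series, taken with \<eta> = \<sigma> - 1/2, survives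
  multiplication by it.\<close>

theorem tendsto_avg_zeta_dpoly:
  assumes \<sigma>: "1 / 2 < \<sigma>" "\<sigma> < 1" and Q: "Q \<ge> 1" and c: "\<And>n. n > Q \<Longrightarrow> c n = 0"
  shows "((\<lambda>T. avg T (\<lambda>t. (norm (dpoly c Q t * ((1 - 2 powr (1 - Complex \<sigma> t)) * zeta (Complex \<sigma> t))))\<^sup>2))
    \<longlongrightarrow> (\<Sum>m. (dconv c (eta_coeff \<sigma>) m)\<^sup>2)) at_top"
proof -
  define E where "E = (\<lambda>t. (1 - 2 powr (1 - Complex \<sigma> t)) * zeta (Complex \<sigma> t))"
  define P where "P = (\<lambda>T::real. dpoly (eta_coeff \<sigma>) (nat \<lfloor>T powr (\<sigma> + 1 / 2)\<rfloor>))"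
  define A where "A = (\<lambda>T. avg T (\<lambda>t. (norm (dpoly c Q t * P T t))\<^sup>2))"
  have A: "(A \<longlongrightarrow> (\<Sum>m. (dconv c (eta_coeff \<sigma>) m)\<^sup>2)) at_top"
    unfolding A_def P_def using \<sigma> Q c by (intro tendsto_avg_dpoly_product) (auto simp: abs_eta_coeff)
  obtain err where err: "(err \<longlongrightarrow> 0) at_top"
    "\<forall>\<^sub>F T in at_top. \<forall>t\<in>{T..2 * T}. norm (E t - P T t) \<le> err T"
  proof -
    have e: "1 + (\<sigma> - 1 / 2) = \<sigma> + 1 / 2" by simp
    have "\<exists>err. (err \<longlongrightarrow> 0) at_top \<and> (\<forall>\<^sub>F T in at_top. \<forall>t\<in>{T..2 * T}. norm (E t - P T t) \<le> err T)"
      unfolding E_def P_def using \<sigma> by (intro eta_approx[of "\<sigma> - 1 / 2" \<sigma>, unfolded e]) auto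
    then show ?thesis using that by blast
  qed
  define B where "B = (\<Sum>n=1..Q. \<bar>c n\<bar>)"
  have B: "B \<ge> 0" unfolding B_def by (intro sum_nonneg) auto
  define \<delta> where "\<delta> = (\<lambda>T. B * \<bar>err T\<bar>)"
  have "((\<lambda>T. \<bar>err T\<bar>) \<longlongrightarrow> 0) at_top" using err(1) by (rule tendsto_rabs_zero)
  then have \<delta>: "(\<delta> \<longlongrightarrow> 0) at_top" unfolding \<delta>_def by (rule tendsto_mult_right_zero)
  have contE: "continuous_on S E" for S
    unfolding E_def using \<sigma> by (intro continuous_intros continuous_on_eta_factor continuous_on_zeta_line) auto
  have "\<forall>\<^sub>F T::real in at_top. T > 0" by (rule eventually_gt_at_top)
  with err(2) have bound: "\<forall>\<^sub>F T in at_top. norm (avg T (\<lambda>t. (norm (dpoly c Q t * E t))\<^sup>2) - A T)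
      \<le> \<delta> T * (1 + A T) + (\<delta> T)\<^sup>2"
  proof eventually_elim
    case (elim T)
    have "norm (dpoly c Q t * E t - dpoly c Q t * P T t) \<le> \<delta> T" if "t \<in> {T..2 * T}" for t
    proof -
      have "norm (dpoly c Q t * E t - dpoly c Q t * P T t) = norm (dpoly c Q t) * norm (E t - P T t)"
        by (simp flip: right_diff_distrib norm_mult)
      also have "\<dots> \<le> B * \<bar>err T\<bar>"
        unfolding B_def using elim that norm_dpoly_le[of c Q t] by (intro mult_mono) (force intro: sum_nonneg)+
      finally show ?thesis by (simp add: \<delta>_def)
    qed
    note close = this
    show ?case unfolding A_def real_norm_def
    proof (rule avg_norm_square_perturb)
      show "continuous_on {T..2 * T} (\<lambda>t. dpoly c Q t * E t)"
        by (intro continuous_on_mult continuous_on_dpoly contE)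
      show "continuous_on {T..2 * T} (\<lambda>t. dpoly c Q t * P T t)"
        unfolding P_def by (intro continuous_on_mult continuous_on_dpoly)
      show "0 \<le> \<delta> T" using B by (simp add: \<delta>_def)
      show "T > 0" using elim by blast
      show "norm (dpoly c Q t * E t - dpoly c Q t * P T t) \<le> \<delta> T" if "t \<in> {T..2 * T}" for t
        by (rule close[OF that])
    qed
  qed
  have "((\<lambda>T. \<delta> T * (1 + A T) + (\<delta> T)\<^sup>2) \<longlongrightarrow> 0 * (1 + (\<Sum>m. (dconv c (eta_coeff \<sigma>) m)\<^sup>2)) + 0\<^sup>2) at_top"
    by (intro tendsto_intros \<delta> A)
  then have "((\<lambda>T. \<delta> T * (1 + A T) + (\<delta> T)\<^sup>2) \<longlongrightarrow> 0) at_top" by simp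
  with bound have "((\<lambda>T. avg T (\<lambda>t. (norm (dpoly c Q t * E t))\<^sup>2) - A T) \<longlongrightarrow> 0) at_top"
    by (rule Lim_null_comparison)
  from tendsto_add[OF this A] show ?thesis by (simp add: E_def)
qed

text \<open>The length is fixed, so the mean square estimate with exponent 0 is enough: its error
  does not grow with T.\<close>

theorem tendsto_avg_dpoly:
  assumes "Q \<ge> 1"
  shows "((\<lambda>T. avg T (\<lambda>t. (norm (dpoly c Q t))\<^sup>2)) \<longlongrightarrow> (\<Sum>n=1..Q. (c n)\<^sup>2)) at_top"
proof -
  define C where "C = (\<Sum>n=1..Q. \<bar>c n\<bar>)"
  define D where "D = 8 * C\<^sup>2 * real Q powr (2 - 2 * 0) * (harm Q)\<^sup>2"
  have C: "C \<ge> 0" unfolding C_def by (intro sum_nonneg) auto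
  have c: "\<bar>c n\<bar> \<le> C * real n powr (- 0)" if "1 \<le> n" "n \<le> Q" for n
    using member_le_sum[of n "{1..Q}" "\<lambda>n. \<bar>c n\<bar>"] that by (simp add: C_def)
  have "\<forall>\<^sub>F T::real in at_top. T > 0" by (rule eventually_gt_at_top)
  then have "\<forall>\<^sub>F T in at_top. norm (avg T (\<lambda>t. (norm (dpoly c Q t))\<^sup>2) - (\<Sum>n=1..Q. (c n)\<^sup>2)) \<le> D / T"
  proof eventually_elim
    case (elim T)
    have "\<bar>integral {T..2 * T} (\<lambda>t. (norm (dpoly c Q t))\<^sup>2) - T * (\<Sum>n=1..Q. (c n)\<^sup>2)\<bar> \<le> D"
      unfolding D_def using elim C c by (intro integral_norm_dpoly_square_approx) auto
    moreover have "avg T (\<lambda>t. (norm (dpoly c Q t))\<^sup>2) - (\<Sum>n=1..Q. (c n)\<^sup>2)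
        = (integral {T..2 * T} (\<lambda>t. (norm (dpoly c Q t))\<^sup>2) - T * (\<Sum>n=1..Q. (c n)\<^sup>2)) / T"
      using elim by (simp add: avg_def diff_divide_distrib)
    ultimately show ?case using elim by (simp add: divide_right_mono)
  qed
  moreover have "((\<lambda>T::real. D / T) \<longlongrightarrow> 0) at_top" by real_asymp
  ultimately have "((\<lambda>T. avg T (\<lambda>t. (norm (dpoly c Q t))\<^sup>2) - (\<Sum>n=1..Q. (c n)\<^sup>2)) \<longlongrightarrow> 0) at_top"
    by (rule Lim_null_comparison)
  then show ?thesis by (simp add: LIM_zero_iff)
qed

section \<open>Local factors and prime products\<close>

definition shift_by :: "nat \<Rightarrow> (nat \<Rightarrow> real) \<Rightarrow> nat \<Rightarrow> real" where
  "shift_by p h n = (if p dvd n then h (n div p) else 0)"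

text \<open>
  With the coefficients normalised as above, shifting by \<open>p\<close> is multiplication by \<open>q = p\<^sup>\<sigma>\<^sup>-\<^sup>s\<close>, an
  isometry; a local factor is multiplication by \<open>1 + u q + v q\<^sup>2\<close>.
\<close>

definition local_factor :: "nat \<Rightarrow> real \<Rightarrow> real \<Rightarrow> (nat \<Rightarrow> real) \<Rightarrow> nat \<Rightarrow> real" where
  "local_factor p u v h n = h n + u * shift_by p h n + v * shift_by p (shift_by p h) n"

lemma suminf_multiples:
  fixes f :: "nat \<Rightarrow> real"
  assumes "p > 0" "summable f" "\<And>n. f n \<ge> 0"
  shows "summable (\<lambda>n. if p dvd n then 0 else f n)" "summable (\<lambda>m. f (p * m))"
    "(\<Sum>n. f n) = (\<Sum>n. if p dvd n then 0 else f n) + (\<Sum>m. f (p * m))"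
proof -
  define f1 where "f1 = (\<lambda>n. if p dvd n then f n else 0)"
  define f2 where "f2 = (\<lambda>n. if p dvd n then 0 else f n)"
  have s1: "summable f1" unfolding f1_def
    by (rule summable_comparison_test'[OF assms(2), of 0]) (use assms(3) in auto)
  show s2: "summable (\<lambda>n. if p dvd n then 0 else f n)"
    by (rule summable_comparison_test'[OF assms(2), of 0]) (use assms(3) in auto)
  have mono: "strict_mono (\<lambda>m. p * m)" using assms(1) by (auto simp: strict_mono_def)
  have off: "f1 n = 0" if "n \<notin> range (\<lambda>m. p * m)" for n
    using that by (auto simp: f1_def)
  have "(\<lambda>m. f1 (p * m)) sums (\<Sum>n. f1 n)"
    using sums_mono_reindex[of "\<lambda>m. p * m" f1, OF mono off] summable_sums[OF s1] by simp
  then have r: "(\<lambda>m. f (p * m)) sums (\<Sum>n. f1 n)" by (simp add: f1_def)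
  then show "summable (\<lambda>m. f (p * m))" by (rule sums_summable)
  have "(\<Sum>n. f n) = (\<Sum>n. f2 n + f1 n)" by (intro suminf_cong) (simp add: f1_def f2_def)
  also have "\<dots> = (\<Sum>n. f2 n) + (\<Sum>n. f1 n)"
    using s1 s2 by (intro suminf_add[symmetric]) (auto simp: f2_def)
  finally show "(\<Sum>n. f n) = (\<Sum>n. if p dvd n then 0 else f n) + (\<Sum>m. f (p * m))"
    using sums_unique[OF r] by (simp add: f2_def)
qed

lemma summable_shift_by:
  assumes "p > 0" "summable (\<lambda>n. (h n)\<^sup>2)"
  shows "summable (\<lambda>n. (shift_by p h n)\<^sup>2)"
proof -
  have mono: "strict_mono (\<lambda>m. p * m)" using assms(1) by (auto simp: strict_mono_def)
  have "(shift_by p h n)\<^sup>2 = 0" if "n \<notin> range (\<lambda>m. p * m)" for n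
    using that by (auto simp: shift_by_def)
  from sums_mono_reindex[of "\<lambda>m. p * m" "\<lambda>n. (shift_by p h n)\<^sup>2", OF mono this]
  have "(\<lambda>n. (shift_by p h n)\<^sup>2) sums (\<Sum>n. (h n)\<^sup>2)"
    using summable_sums[OF assms(2)] assms(1) by (simp add: shift_by_def)
  then show ?thesis by (rule sums_summable)
qed

lemma summable_add_square:
  fixes f g :: "nat \<Rightarrow> real"
  assumes "summable (\<lambda>n. (f n)\<^sup>2)" "summable (\<lambda>n. (g n)\<^sup>2)"
  shows "summable (\<lambda>n. (f n + g n)\<^sup>2)"
proof (rule summable_comparison_test')
  show "summable (\<lambda>n. 2 * (f n)\<^sup>2 + 2 * (g n)\<^sup>2)" using assms by (intro summable_add summable_mult)
  fix n
  have "(f n + g n)\<^sup>2 \<le> 2 * (f n)\<^sup>2 + 2 * (g n)\<^sup>2"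
    using sum_squares_bound[of "f n" "g n"] by (simp add: power2_sum)
  then show "norm ((f n + g n)\<^sup>2) \<le> 2 * (f n)\<^sup>2 + 2 * (g n)\<^sup>2" by simp
qed

lemma summable_scale_square:
  fixes f :: "nat \<Rightarrow> real"
  assumes "summable (\<lambda>n. (f n)\<^sup>2)"
  shows "summable (\<lambda>n. (u * f n)\<^sup>2)"
  using summable_mult[OF assms, of "u\<^sup>2"] by (simp add: power_mult_distrib)

lemma summable_local_factor:
  assumes "p > 0" "summable (\<lambda>n. (h n)\<^sup>2)"
  shows "summable (\<lambda>n. (local_factor p u v h n)\<^sup>2)"
  unfolding local_factor_def using assms
  by (intro summable_add_square summable_scale_square summable_shift_by)

text \<open>Let S be the shift by p, an isometry of l^2. The hypothesis on h says that the adjoint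
  of S maps h to \<xi> h. Hence S h has inner product \<xi> |h|^2 with h, S^2 h has \<xi> |h|^2 with
  S h and \<xi>^2 |h|^2 with h; these are the cross terms. The computation splits the sum by whether
  p divides n not at all, once, or at least twice.\<close>

lemma suminf_local_factor:
  assumes p: "p > 1" and h: "summable (\<lambda>n. (h n)\<^sup>2)" and \<xi>: "\<And>n. h (p * n) = \<xi> * h n"
  shows "(\<Sum>n. (local_factor p u v h n)\<^sup>2)
    = (1 + u\<^sup>2 + v\<^sup>2 + 2 * u * \<xi> + 2 * u * v * \<xi> + 2 * v * \<xi>\<^sup>2) * (\<Sum>n. (h n)\<^sup>2)"
proof -
  define H where "H = (\<Sum>n. (h n)\<^sup>2)"
  define A where "A = (\<Sum>n. if p dvd n then 0 else (h n)\<^sup>2)"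
  have p0: "p > 0" using p by simp
  note spl = suminf_multiples[OF p0]
  have "H = A + \<xi>\<^sup>2 * H"
    using spl(3)[OF h] suminf_mult[OF h, of "\<xi>\<^sup>2"] by (simp add: \<xi> A_def H_def power_mult_distrib)
  then have A: "A = (1 - \<xi>\<^sup>2) * H" by (simp add: algebra_simps)
  define F where "F = (\<lambda>m. ((\<xi> + u) * h m + v * shift_by p h m)\<^sup>2)"
  have F: "summable F" unfolding F_def using p0 h
    by (intro summable_add_square summable_scale_square summable_shift_by)
  have lf: "local_factor p u v h (p * m) = (\<xi> + u) * h m + v * shift_by p h m" for m
    using p0 by (simp add: local_factor_def shift_by_def \<xi>) (simp add: algebra_simps)
  have lf0: "local_factor p u v h n = h n" if "\<not> p dvd n" for n
    using that by (simp add: local_factor_def shift_by_def)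
  have "(\<Sum>n. (local_factor p u v h n)\<^sup>2)
      = (\<Sum>n. if p dvd n then 0 else (local_factor p u v h n)\<^sup>2) + (\<Sum>m. (local_factor p u v h (p * m))\<^sup>2)"
    by (rule spl(3)) (use p0 h in \<open>auto intro: summable_local_factor\<close>)
  also have "(\<Sum>n. if p dvd n then 0 else (local_factor p u v h n)\<^sup>2) = A"
    unfolding A_def by (intro suminf_cong) (simp add: lf0)
  also have "(\<Sum>m. (local_factor p u v h (p * m))\<^sup>2) = (\<Sum>m. F m)" by (simp add: lf F_def)
  also have "(\<Sum>m. F m) = (\<Sum>n. if p dvd n then 0 else F n) + (\<Sum>m. F (p * m))"
    by (rule spl(3)[OF F]) (simp add: F_def)
  also have "(\<Sum>n. if p dvd n then 0 else F n) = (\<Sum>n. (\<xi> + u)\<^sup>2 * (if p dvd n then 0 else (h n)\<^sup>2))"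
    by (intro suminf_cong) (simp add: F_def shift_by_def power_mult_distrib)
  also have "\<dots> = (\<xi> + u)\<^sup>2 * A"
    unfolding A_def by (rule suminf_mult[OF spl(1)[OF h]]) simp
  also have "(\<Sum>m. F (p * m)) = (\<Sum>m. ((\<xi> + u) * \<xi> + v)\<^sup>2 * (h m)\<^sup>2)"
  proof (rule suminf_cong)
    fix m
    have "(\<xi> + u) * (\<xi> * h m) + v * h m = ((\<xi> + u) * \<xi> + v) * h m" by (simp add: algebra_simps)
    then show "F (p * m) = ((\<xi> + u) * \<xi> + v)\<^sup>2 * (h m)\<^sup>2"
      using p0 by (simp add: F_def shift_by_def \<xi> power_mult_distrib)
  qed
  also have "\<dots> = ((\<xi> + u) * \<xi> + v)\<^sup>2 * H" unfolding H_def by (rule suminf_mult[OF h])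
  finally show ?thesis unfolding A H_def[symmetric] by (simp add: power2_eq_square algebra_simps)
qed

lemma dconv_shift_by:
  assumes "p > 0"
  shows "dconv (shift_by p c) b m = shift_by p (dconv c b) m"
proof (cases "p dvd m")
  case False
  then have "\<not> p dvd d" if "d dvd m" for d using that dvd_trans by blast
  then show ?thesis using False by (auto simp: dconv_def shift_by_def intro!: sum.neutral)
next
  case True
  then obtain k where k: "m = p * k" by (auto elim: dvdE)
  have "dconv (shift_by p c) b m = (\<Sum>d\<in>{d\<in>{1..m}. d dvd m \<and> p dvd d}. c (d div p) * b (m div d))"
    unfolding dconv_def shift_by_def by (rule sum.mono_neutral_cong_right) auto
  also have "\<dots> = (\<Sum>e\<in>{e\<in>{1..k}. e dvd k}. c e * b (k div e))"
    by (rule sum.reindex_bij_witness[of _ "\<lambda>e. p * e" "\<lambda>d. d div p"])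
       (use assms in \<open>auto simp: k Suc_le_eq dvd_div_eq_0_iff elim!: dvdE\<close>)
  finally show ?thesis using assms by (simp add: k shift_by_def dconv_def)
qed

lemma dconv_local_factor:
  assumes "p > 0"
  shows "dconv (local_factor p u v c) b = local_factor p u v (dconv c b)"
proof
  fix m
  have lin: "dconv (\<lambda>n. f n + u * g n + v * k n) b m = dconv f b m + u * dconv g b m + v * dconv k b m"
    for f g k unfolding dconv_def by (simp add: sum.distrib sum_distrib_left algebra_simps)
  have sh: "dconv (shift_by p f) b = shift_by p (dconv f b)" for f
    using dconv_shift_by[OF assms] by (intro ext)
  have "dconv (local_factor p u v c) b m = dconv (\<lambda>n. c n + u * shift_by p c n + v * shift_by p (shift_by p c) n) b m"
    by (simp only: local_factor_def[abs_def])
  then show "dconv (local_factor p u v c) b m = local_factor p u v (dconv c b) m"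
    unfolding lin sh by (simp add: local_factor_def)
qed

lemma shift_by_mult_prime:
  assumes "prime p" "prime q" "p \<noteq> q" and "\<And>n. h (q * n) = x * h n"
  shows "shift_by p h (q * n) = x * shift_by p h n"
proof -
  have "p dvd q * n \<longleftrightarrow> p dvd n"
    using assms primes_dvd_imp_eq[of p q] by (auto simp: prime_dvd_mult_iff)
  then show ?thesis using assms(4) by (auto simp: shift_by_def div_mult_swap[symmetric])
qed

text \<open>A local factor at p preserves the eigenvalue at any other prime, so the primes can be
  treated one at a time.\<close>

lemma local_factor_mult_prime:
  assumes "prime p" "prime q" "p \<noteq> q" and "\<And>n. h (q * n) = x * h n"
  shows "local_factor p u v h (q * n) = x * local_factor p u v h n"
proof -
  have 1: "shift_by p h (q * n) = x * shift_by p h n" for n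
    by (rule shift_by_mult_prime[OF assms(1-3)]) (rule assms(4))
  have 2: "shift_by p (shift_by p h) (q * n) = x * shift_by p (shift_by p h) n"
    by (rule shift_by_mult_prime[OF assms(1-3)]) (rule 1)
  show ?thesis unfolding local_factor_def 1 2 assms(4) by (simp add: algebra_simps)
qed

lemma dconv_delta:
  assumes "b 0 = 0"
  shows "dconv (\<lambda>n. if n = 1 then 1 else 0) b = b"
proof
  fix m
  show "dconv (\<lambda>n. if n = 1 then 1 else 0) b m = b m"
  proof (cases "m = 0")
    case False
    have "dconv (\<lambda>n. if n = 1 then 1 else 0) b m = (\<Sum>d\<in>{d\<in>{1..m}. d dvd m}. if d = 1 then b m else 0)"
      unfolding dconv_def by (intro sum.cong) auto
    also have "\<dots> = b m" using False by (subst sum.delta) auto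
    finally show ?thesis .
  qed (simp add: dconv_def assms)
qed

lemma exists_dirichlet_factor:
  fixes b u v :: "nat \<Rightarrow> real"
  assumes "finite P" "\<And>p. p \<in> P \<Longrightarrow> prime p \<and> odd p"
    and b: "b 0 = 0" "summable (\<lambda>n. (b n)\<^sup>2)"
    and \<xi>: "\<And>q n. prime q \<Longrightarrow> odd q \<Longrightarrow> b (q * n) = \<xi> q * b n"
  shows "\<exists>c Q. Q \<ge> 1 \<and> c 0 = 0 \<and> (\<forall>n>Q. c n = 0)
    \<and> (\<Sum>n=1..Q. (c n)\<^sup>2) = (\<Prod>p\<in>P. 1 + (u p)\<^sup>2 + (v p)\<^sup>2)
    \<and> (\<Sum>n. (dconv c b n)\<^sup>2) = (\<Prod>p\<in>P. 1 + (u p)\<^sup>2 + (v p)\<^sup>2 + 2 * u p * \<xi> p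
        + 2 * u p * v p * \<xi> p + 2 * v p * (\<xi> p)\<^sup>2) * (\<Sum>n. (b n)\<^sup>2)"
proof -
  have PP: "\<forall>p\<in>P. prime p \<and> odd p" using assms(2) by blast
  \<comment> \<open>The induction carries two relations at the primes q outside P: \<open>c\<close>
    has eigenvalue 0 and \<open>dconv c b\<close> has eigenvalue \<open>\<xi> q\<close>. With them
    \<open>suminf_local_factor\<close> evaluates both sums of squares when the next prime is
    added.\<close>
  have "\<exists>c Q. Q \<ge> 1 \<and> c 0 = 0 \<and> (\<forall>n>Q. c n = 0)
    \<and> (\<forall>q n. prime q \<longrightarrow> q \<notin> P \<longrightarrow> c (q * n) = 0)
    \<and> (\<forall>q n. prime q \<longrightarrow> odd q \<longrightarrow> q \<notin> P \<longrightarrow> dconv c b (q * n) = \<xi> q * dconv c b n)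
    \<and> summable (\<lambda>n. (c n)\<^sup>2) \<and> summable (\<lambda>n. (dconv c b n)\<^sup>2)
    \<and> (\<Sum>n. (c n)\<^sup>2) = (\<Prod>p\<in>P. 1 + (u p)\<^sup>2 + (v p)\<^sup>2)
    \<and> (\<Sum>n. (dconv c b n)\<^sup>2) = (\<Prod>p\<in>P. 1 + (u p)\<^sup>2 + (v p)\<^sup>2 + 2 * u p * \<xi> p
        + 2 * u p * v p * \<xi> p + 2 * v p * (\<xi> p)\<^sup>2) * (\<Sum>n. (b n)\<^sup>2)"
    using assms(1) PP
  proof (induction P)
    case empty
    define c where "c = (\<lambda>n::nat. if n = 1 then 1 else 0 :: real)"
    have dc: "dconv c b = b" unfolding c_def by (rule dconv_delta[of b, OF b(1)])
    have c2: "(\<lambda>n. (c n)\<^sup>2) = (\<lambda>n. if n = 1 then 1 else 0)" by (auto simp: c_def)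
    have "(\<lambda>n. (c n)\<^sup>2) sums 1" unfolding c2 using sums_single[of 1 "\<lambda>_. 1 :: real"] by simp
    then have F1: "summable (\<lambda>n. (c n)\<^sup>2)" and F2: "(\<Sum>n. (c n)\<^sup>2) = 1" by (auto simp: sums_iff)
    have F3: "c (q * n) = 0" if "prime q" for q n using that by (auto simp: c_def)
    have F4: "(1::nat) \<ge> 1" "c 0 = 0" by (auto simp: c_def)
    have F5: "c n = 0" if "n > 1" for n using that by (simp add: c_def)
    have F6: "dconv c b (q * n) = \<xi> q * dconv c b n" if "prime q" "odd q" for q n
      unfolding dc using that by (rule \<xi>)
    have F7: "summable (\<lambda>n. (dconv c b n)\<^sup>2)" unfolding dc by (rule b(2))
    have F8: "(\<Sum>n. (dconv c b n)\<^sup>2) = 1 * (\<Sum>n. (b n)\<^sup>2)" unfolding dc by simp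
    show ?case unfolding prod.empty
    proof (rule exI[of _ c], rule exI[of _ "1::nat"], intro conjI)
      show "\<forall>n>1. c n = 0" using F5 by blast
      show "\<forall>q n. prime q \<longrightarrow> q \<notin> {} \<longrightarrow> c (q * n) = 0"
        by (intro allI impI) (rule F3)
      show "\<forall>q n. prime q \<longrightarrow> odd q \<longrightarrow> q \<notin> {} \<longrightarrow> dconv c b (q * n) = \<xi> q * dconv c b n"
        by (intro allI impI) (rule F6)
    qed (fact F1 F2 F4 F7 F8)+
  next
    case (insert p P)
    have P: "\<forall>p\<in>P. prime p \<and> odd p" using insert.prems by blast
    from insert.IH[OF P] obtain c Q where c0: "Q \<ge> 1" "c 0 = 0" "\<forall>n>Q. c n = 0"
      "\<forall>q n. prime q \<longrightarrow> q \<notin> P \<longrightarrow> c (q * n) = 0"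
      "\<forall>q n. prime q \<longrightarrow> odd q \<longrightarrow> q \<notin> P \<longrightarrow> dconv c b (q * n) = \<xi> q * dconv c b n"
      "summable (\<lambda>n. (c n)\<^sup>2)" "summable (\<lambda>n. (dconv c b n)\<^sup>2)"
      "(\<Sum>n. (c n)\<^sup>2) = (\<Prod>p\<in>P. 1 + (u p)\<^sup>2 + (v p)\<^sup>2)"
      "(\<Sum>n. (dconv c b n)\<^sup>2) = (\<Prod>p\<in>P. 1 + (u p)\<^sup>2 + (v p)\<^sup>2 + 2 * u p * \<xi> p
        + 2 * u p * v p * \<xi> p + 2 * v p * (\<xi> p)\<^sup>2) * (\<Sum>n. (b n)\<^sup>2)"
      by (elim exE conjE) (rule that; assumption)
    have c3: "c n = 0" if "n > Q" for n using c0(3) that by blast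
    have c4: "c (q * n) = 0" if "prime q" "q \<notin> P" for q n using c0(4) that by blast
    have c5: "dconv c b (q * n) = \<xi> q * dconv c b n" if "prime q" "odd q" "q \<notin> P" for q n
      using c0(5) that by blast
    note c = c0(1,2) c3 c4 c5 c0(6-9)
    have p: "prime p" "odd p" "p > 1" "p > 0"
      using insert.prems prime_gt_1_nat[of p] prime_gt_0_nat[of p] by auto
    define c' where "c' = local_factor p (u p) (v p) c"
    have dc: "dconv c' b = local_factor p (u p) (v p) (dconv c b)"
      unfolding c'_def using p by (intro dconv_local_factor)
    have sh0: "shift_by p f n = 0" if "n > R * p" "\<And>n. n > R \<Longrightarrow> f n = 0" for f n R
      using that p by (auto simp: shift_by_def mult.commute elim!: dvdE)
    \<comment> \<open>A local factor shifts by p at most twice, which multiplies the support bound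
      by p^2.\<close>
    have supp: "c' n = 0" if n: "n > Q * p * p" for n
    proof -
      have "Q \<le> Q * p" "Q * p \<le> Q * p * p" using p by simp_all
      then have "n > Q" "n > Q * p" using n by linarith+
      then show ?thesis
        using sh0[of Q n c] sh0[of "Q * p" n "shift_by p c"] sh0[of Q _ c] c(3) n
        by (simp add: c'_def local_factor_def)
    qed
    have 1: "c' (q * n) = 0" if "prime q" "q \<notin> insert p P" for q n
      using local_factor_mult_prime[of p q c 0 "u p" "v p" n] p that c(4)[of q] by (auto simp: c'_def)
    have 2: "dconv c' b (q * n) = \<xi> q * dconv c' b n" if "prime q" "odd q" "q \<notin> insert p P" for q n
      unfolding dc using p that c(5)[of q] by (intro local_factor_mult_prime) auto
    have 3: "(\<Sum>n. (c' n)\<^sup>2) = (1 + (u p)\<^sup>2 + (v p)\<^sup>2) * (\<Sum>n. (c n)\<^sup>2)"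
      using suminf_local_factor[of p c 0 "u p" "v p"] p c(4)[of p] c(6) insert.hyps by (simp add: c'_def)
    have 4: "(\<Sum>n. (dconv c' b n)\<^sup>2) = (1 + (u p)\<^sup>2 + (v p)\<^sup>2 + 2 * u p * \<xi> p
        + 2 * u p * v p * \<xi> p + 2 * v p * (\<xi> p)\<^sup>2) * (\<Sum>n. (dconv c b n)\<^sup>2)"
      unfolding dc using p c(5)[of p] c(7) insert.hyps by (intro suminf_local_factor) auto
    have 5: "summable (\<lambda>n. (c' n)\<^sup>2)" "summable (\<lambda>n. (dconv c' b n)\<^sup>2)"
    proof -
      show "summable (\<lambda>n. (c' n)\<^sup>2)"
        unfolding c'_def by (rule summable_local_factor[OF p(4) c(6)])
      show "summable (\<lambda>n. (dconv c' b n)\<^sup>2)"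
        unfolding dc by (rule summable_local_factor[OF p(4) c(7)])
    qed
    have 6: "c' 0 = 0" using c(2) by (simp add: c'_def local_factor_def shift_by_def)
    have 7: "Q * p * p \<ge> 1" using c(1) p by (simp add: Suc_le_eq)
    show ?case
    proof (rule exI[of _ c'], rule exI[of _ "Q * p * p"], intro conjI)
      show "\<forall>n>Q * p * p. c' n = 0" using supp by blast
      show "\<forall>q n. prime q \<longrightarrow> q \<notin> insert p P \<longrightarrow> c' (q * n) = 0"
        by (intro allI impI) (rule 1)
      show "\<forall>q n. prime q \<longrightarrow> odd q \<longrightarrow> q \<notin> insert p P \<longrightarrow> dconv c' b (q * n) = \<xi> q * dconv c' b n"
        by (intro allI impI) (rule 2)
      show "(\<Sum>n. (c' n)\<^sup>2) = (\<Prod>p\<in>insert p P. 1 + (u p)\<^sup>2 + (v p)\<^sup>2)"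
        unfolding 3 c(8) using insert.hyps by (rule prod.insert[symmetric])
      show "(\<Sum>n. (dconv c' b n)\<^sup>2) = (\<Prod>p\<in>insert p P. 1 + (u p)\<^sup>2 + (v p)\<^sup>2 + 2 * u p * \<xi> p
        + 2 * u p * v p * \<xi> p + 2 * v p * (\<xi> p)\<^sup>2) * (\<Sum>n. (b n)\<^sup>2)"
        unfolding 4 c(9) prod.insert[OF insert.hyps] by (rule mult.assoc[symmetric])
    qed (fact 5 6 7)+
  qed
  then obtain c Q where c: "Q \<ge> 1" "c 0 = 0" "\<forall>n>Q. c n = 0"
    "(\<Sum>n. (c n)\<^sup>2) = (\<Prod>p\<in>P. 1 + (u p)\<^sup>2 + (v p)\<^sup>2)"
    "(\<Sum>n. (dconv c b n)\<^sup>2) = (\<Prod>p\<in>P. 1 + (u p)\<^sup>2 + (v p)\<^sup>2 + 2 * u p * \<xi> p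
        + 2 * u p * v p * \<xi> p + 2 * v p * (\<xi> p)\<^sup>2) * (\<Sum>n. (b n)\<^sup>2)"
    by (elim exE conjE) (rule that; assumption)
  have "c n = 0" if "n \<notin> {1..Q}" for n
    using c(2,3) that by (cases "n = 0") auto
  then have "(\<Sum>n. (c n)\<^sup>2) = (\<Sum>n=1..Q. (c n)\<^sup>2)" by (intro suminf_finite) auto
  with c(4) have "(\<Sum>n=1..Q. (c n)\<^sup>2) = (\<Prod>p\<in>P. 1 + (u p)\<^sup>2 + (v p)\<^sup>2)" by simp
  with c(1,2,3,5) show ?thesis by (intro exI conjI)
qed

section \<open>Divergence of the product of 1 + 1/p over the primes\<close>

definition smooth_upto :: "nat set \<Rightarrow> nat \<Rightarrow> nat set" where
  "smooth_upto P N = {n\<in>{1..N}. \<forall>q. prime q \<longrightarrow> q dvd n \<longrightarrow> q \<in> P}"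

text \<open>An element of the set for \<open>insert p P\<close> is either free of p or p times an
  element of the same set. So its sum s is at most the sum for P plus s/p; the cut-off N keeps s
  finite, which allows solving for s.\<close>

lemma sum_smooth_le_prod:
  assumes "finite P" "\<And>p. p \<in> P \<Longrightarrow> prime p"
  shows "(\<Sum>n\<in>smooth_upto P N. 1 / real n) \<le> (\<Prod>p\<in>P. 1 / (1 - 1 / real p))"
  using assms
proof (induction P)
  case empty
  have "smooth_upto {} N \<subseteq> {1}"
  proof
    fix n assume "n \<in> smooth_upto {} N"
    then have "\<nexists>q. prime q \<and> q dvd n" by (auto simp: smooth_upto_def)
    then show "n \<in> {1}" using prime_factor_nat[of n] by blast
  qed
  then have "(\<Sum>n\<in>smooth_upto {} N. 1 / real n) \<le> (\<Sum>n\<in>{1}. 1 / real n)" by (intro sum_mono2) auto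
  then show ?case by simp
next
  case (insert p P)
  have p: "p > 1" using insert.prems prime_gt_1_nat by blast
  define s where "s = (\<Sum>n\<in>smooth_upto (insert p P) N. 1 / real n)"
  have fin: "finite (smooth_upto A N)" for A by (simp add: smooth_upto_def)
  have sub: "smooth_upto (insert p P) N \<subseteq> smooth_upto P N \<union> (\<lambda>m. p * m) ` smooth_upto (insert p P) N"
  proof
    fix n assume n: "n \<in> smooth_upto (insert p P) N"
    show "n \<in> smooth_upto P N \<union> (\<lambda>m. p * m) ` smooth_upto (insert p P) N"
    proof (cases "p dvd n")
      case False
      then show ?thesis using n by (auto simp: smooth_upto_def)
    next
      case True
      then obtain m where m: "n = p * m" by (auto elim: dvdE)
      have "m \<le> p * m" using p by simp
      then have "m \<in> smooth_upto (insert p P) N"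
        using n m p by (auto simp: smooth_upto_def intro: order.trans[OF \<open>m \<le> p * m\<close>])
      then show ?thesis using m by blast
    qed
  qed
  have "s \<le> (\<Sum>n\<in>smooth_upto P N \<union> (\<lambda>m. p * m) ` smooth_upto (insert p P) N. 1 / real n)"
    unfolding s_def by (rule sum_mono2) (use sub fin in auto)
  also have "\<dots> \<le> (\<Sum>n\<in>smooth_upto P N. 1 / real n) + (\<Sum>n\<in>(\<lambda>m. p * m) ` smooth_upto (insert p P) N. 1 / real n)"
    using fin by (simp add: sum_Un sum_nonneg)
  also have "(\<Sum>n\<in>(\<lambda>m. p * m) ` smooth_upto (insert p P) N. 1 / real n) = 1 / real p * s"
    unfolding s_def sum_distrib_left using p
    by (subst sum.reindex) (auto simp: inj_on_def intro!: sum.cong)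
  finally have "s * (1 - 1 / real p) \<le> (\<Sum>n\<in>smooth_upto P N. 1 / real n)" by (simp add: algebra_simps)
  also have "\<dots> \<le> (\<Prod>p\<in>P. 1 / (1 - 1 / real p))" using insert by simp
  finally have "s \<le> (\<Prod>p\<in>P. 1 / (1 - 1 / real p)) / (1 - 1 / real p)"
    using p by (simp add: pos_le_divide_eq)
  then show ?case using insert.hyps by (simp add: s_def)
qed

text \<open>Every n \<le> N is composed of primes up to N. The square comes from 1/(1 - y) \<le> (1
  + y)^2 for 0 < y \<le> 1/2.\<close>

lemma harm_le_prod_primes:
  "harm N \<le> (\<Prod>p\<in>{p. prime p \<and> p \<le> N}. (1 + 1 / real p))\<^sup>2"
proof -
  let ?P = "{p. prime p \<and> p \<le> N}"
  have "smooth_upto ?P N = {1..N}" by (auto simp: smooth_upto_def dest: dvd_imp_le)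
  then have "harm N = (\<Sum>n\<in>smooth_upto ?P N. 1 / real n)" by (simp add: harm_def divide_inverse)
  also have "\<dots> \<le> (\<Prod>p\<in>?P. 1 / (1 - 1 / real p))" by (rule sum_smooth_le_prod) auto
  also have "\<dots> \<le> (\<Prod>p\<in>?P. (1 + 1 / real p)\<^sup>2)"
  proof (intro prod_mono conjI)
    fix p assume "p \<in> ?P"
    then have p: "real p \<ge> 2" using prime_ge_2_nat by fastforce
    define y where "y = 1 / real p"
    have y: "0 < y" "y \<le> 1 / 2" using p by (auto simp: y_def field_simps)
    have "y * (y + y\<^sup>2) \<le> y * (1 / 2 + (1 / 2)\<^sup>2)"
      using y by (intro mult_left_mono add_mono power_mono) auto
    also have "\<dots> \<le> y" using y by (simp add: power2_eq_square)
    finally have "1 \<le> (1 + y)\<^sup>2 * (1 - y)" by (simp add: power2_eq_square algebra_simps)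
    then show "1 / (1 - 1 / real p) \<le> (1 + 1 / real p)\<^sup>2"
      using y unfolding y_def by (simp add: pos_divide_le_eq)
    show "0 \<le> 1 / (1 - 1 / real p)" using p by simp
  qed
  finally show ?thesis by (simp add: prod_power_distrib)
qed

lemma prod_odd_primes_unbounded:
  assumes "\<sigma> \<le> 1"
  shows "\<exists>P. finite P \<and> (\<forall>p\<in>P. prime p \<and> odd p) \<and> (\<Prod>p\<in>P. 1 + real p powr (- \<sigma>)) \<ge> B"
proof -
  \<comment> \<open>The bound is squared because the product enters
    \<open>harm_le_prod_primes\<close> squared; the factor 2 covers the 3/2 lost with the prime
    2.\<close>
  have "\<forall>\<^sub>F N in sequentially. harm N \<ge> (2 * \<bar>B\<bar>)\<^sup>2"
    using harm_at_top unfolding filterlim_at_top by blast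
  then obtain N where N: "harm N \<ge> (2 * \<bar>B\<bar>)\<^sup>2" by (auto simp: eventually_sequentially)
  define A where "A = {p::nat. prime p \<and> p \<le> N}"
  define P where "P = A - {2}"
  have fin: "finite A" "finite P" by (auto simp: A_def P_def)
  have "(2 * \<bar>B\<bar>)\<^sup>2 \<le> (\<Prod>p\<in>A. 1 + 1 / real p)\<^sup>2"
    using N harm_le_prod_primes[of N] by (simp add: A_def)
  then have "2 * \<bar>B\<bar> \<le> (\<Prod>p\<in>A. 1 + 1 / real p)"
    by (rule power2_le_imp_le) (auto intro: prod_nonneg)
  also have "\<dots> \<le> (\<Prod>p\<in>insert 2 P. 1 + 1 / real p)"
    using fin by (intro prod_mono2) (auto simp: P_def)
  also have "\<dots> = 3 / 2 * (\<Prod>p\<in>P. 1 + 1 / real p)"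
    using fin by (subst prod.insert) (auto simp: P_def)
  also have "(\<Prod>p\<in>P. 1 + 1 / real p) \<le> (\<Prod>p\<in>P. 1 + real p powr (- \<sigma>))"
  proof (intro prod_mono conjI add_mono order.refl)
    fix p assume "p \<in> P"
    then have "p \<ge> 1" using prime_ge_1_nat by (auto simp: P_def A_def)
    then have "real p powr (- 1) \<le> real p powr (- \<sigma>)" using assms by (intro powr_mono) auto
    then show "1 / real p \<le> real p powr (- \<sigma>)" using \<open>p \<ge> 1\<close> by (simp add: powr_minus_divide)
  qed auto
  finally have "B \<le> (\<Prod>p\<in>P. 1 + real p powr (- \<sigma>))" by linarith
  moreover have "prime p \<and> odd p" if "p \<in> P" for p
    using that prime_odd_nat[of p] prime_ge_2_nat[of p] by (auto simp: P_def A_def)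
  ultimately show ?thesis using fin by blast
qed

section \<open>Values of the modulus of zeta in the strip\<close>

lemma eta_coeff_zero [simp]: "eta_coeff \<sigma> 0 = 0"
  by (simp add: eta_coeff_def)

lemma summable_eta_coeff_square:
  assumes "\<sigma> > 1 / 2"
  shows "summable (\<lambda>n. (eta_coeff \<sigma> n)\<^sup>2)"
proof (rule summable_comparison_test'[OF summable_square_powr[OF assms, of 1]])
  fix n
  have "(eta_coeff \<sigma> n)\<^sup>2 = \<bar>eta_coeff \<sigma> n\<bar>\<^sup>2" by simp
  then show "norm ((eta_coeff \<sigma> n)\<^sup>2) \<le> (1 * real n powr (- \<sigma>))\<^sup>2"
    unfolding abs_eta_coeff by simp
qed

text \<open>The sign depends only on the parity of n, which an odd factor preserves. No such
  relation holds for q = 2, hence the restriction to odd primes.\<close>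

lemma eta_coeff_mult_odd:
  assumes "odd q"
  shows "eta_coeff \<sigma> (q * n) = real q powr (- \<sigma>) * eta_coeff \<sigma> n"
proof (cases "n = 0")
  case False
  have "q > 0" using assms by (auto elim: oddE)
  have "(-1 :: real) ^ (q * n + 1) = (-1) ^ (n + 1)"
    using assms by (cases "even n") auto
  then show ?thesis using False \<open>q > 0\<close> by (simp add: eta_coeff_def powr_mult)
qed simp

lemma suminf_eta_coeff_ge:
  assumes "\<sigma> > 1 / 2"
  shows "(\<Sum>n. (eta_coeff \<sigma> n)\<^sup>2) \<ge> 1"
proof -
  have "(\<Sum>n\<in>{1}. (eta_coeff \<sigma> n)\<^sup>2) \<le> (\<Sum>n. (eta_coeff \<sigma> n)\<^sup>2)"
    by (rule sum_le_suminf[OF summable_eta_coeff_square[OF assms]]) auto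
  then show ?thesis by (simp add: eta_coeff_def)
qed

lemma avg_mono:
  assumes "T > 0" "continuous_on {T..2 * T} f" "continuous_on {T..2 * T} g"
    and "\<And>t. t \<in> {T..2 * T} \<Longrightarrow> f t \<le> g t"
  shows "avg T f \<le> avg T g"
  unfolding avg_def using assms
  by (intro divide_right_mono integral_le integrable_continuous_real) auto

lemma avg_cmult: "avg T (\<lambda>t. k * f t) = k * avg T f"
  by (simp add: avg_def)

text \<open>For \<sigma> < 1 the lower bound is positive, so both upper and lower bounds for |zeta|
  pass to the alternating series.\<close>

lemma norm_eta_factor:
  shows "norm (1 - 2 powr (1 - Complex \<sigma> t) :: complex) \<ge> 2 powr (1 - \<sigma>) - 1"
    and "norm (1 - 2 powr (1 - Complex \<sigma> t) :: complex) \<le> 1 + 2 powr (1 - \<sigma>)"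
proof -
  have n: "norm (2 powr (1 - Complex \<sigma> t) :: complex) = 2 powr (1 - \<sigma>)"
    using norm_powr_real_powr[of 2 "1 - Complex \<sigma> t"] by simp
  show "norm (1 - 2 powr (1 - Complex \<sigma> t) :: complex) \<ge> 2 powr (1 - \<sigma>) - 1"
    using norm_triangle_ineq2[of "2 powr (1 - Complex \<sigma> t)" "1 :: complex"] n
    by (simp add: norm_minus_commute)
  show "norm (1 - 2 powr (1 - Complex \<sigma> t) :: complex) \<le> 1 + 2 powr (1 - \<sigma>)"
    using norm_triangle_ineq4[of "1 :: complex" "2 powr (1 - Complex \<sigma> t)"] n by simp
qed

lemma continuous_on_norm_dpoly_square: "continuous_on A (\<lambda>t. (norm (dpoly c Q t))\<^sup>2)"
  by (intro continuous_intros continuous_on_dpoly)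

lemma continuous_on_norm_dpoly_zeta_square:
  assumes "\<sigma> \<noteq> 1"
  shows "continuous_on A (\<lambda>t. (norm (dpoly c Q t * ((1 - 2 powr (1 - Complex \<sigma> t)) * zeta (Complex \<sigma> t))))\<^sup>2)"
  by (intro continuous_on_power continuous_on_norm continuous_on_mult continuous_on_dpoly
      continuous_on_eta_factor continuous_on_zeta_line assms)

text \<open>Put q = p^(\<sigma>-s) and x = p^(-\<sigma>). The factor 1 - x q = 1 - p^(-s) cancels
  the Euler factor at p, and 1 - q then contributes only 2 - 2x^2 to the squared norm of the product
  with the alternating series. But (1 - x q)(1 - q) itself has squared coefficient norm 2 + 2x +
  2x^2 \<ge> 2(1 + x). A lower bound for |zeta| would therefore bound the product of the 1 +
  x.\<close>

lemma zeta_small_far: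
  assumes \<sigma>: "1 / 2 < \<sigma>" "\<sigma> < 1" and "\<kappa> > 0"
  shows "\<exists>t\<ge>t0. norm (zeta (Complex \<sigma> t)) < \<kappa>"
proof (rule ccontr)
  assume "\<not> (\<exists>t\<ge>t0. norm (zeta (Complex \<sigma> t)) < \<kappa>)"
  then have large: "\<kappa> \<le> norm (zeta (Complex \<sigma> t))" if "t \<ge> t0" for t using that by (auto simp: not_less)
  define w where "w = 2 powr (1 - \<sigma>) - 1"
  have "2 powr 0 < 2 powr (1 - \<sigma>)" using \<sigma> by (intro powr_less_mono) auto
  then have w: "w > 0" by (simp add: w_def)
  define k where "k = (\<kappa> * w)\<^sup>2"
  define A where "A = (\<lambda>P :: nat set. \<Prod>p\<in>P. 2 :: real)"
  have k: "k > 0" using w assms by (simp add: k_def)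
  define B where "B = (\<Sum>n. (eta_coeff \<sigma> n)\<^sup>2)"
  have B: "B \<ge> 1" unfolding B_def using suminf_eta_coeff_ge \<sigma> by simp
  define x where "x = (\<lambda>p. real p powr (- \<sigma>))"
  \<comment> \<open>With this bound the final inequality becomes
    \<open>A P * B + A P \<le> A P * B\<close>, where \<open>A P\<close> is 2 to the number of
    primes.\<close>
  obtain P where P: "finite P" "\<And>p. p \<in> P \<Longrightarrow> prime p \<and> odd p" "(\<Prod>p\<in>P. 1 + x p) \<ge> (B + 1) / k"
    using prod_odd_primes_unbounded[of \<sigma> "(B + 1) / k"] \<sigma> unfolding x_def by fastforce
  have x: "0 \<le> x p" for p by (simp add: x_def)
  obtain c Q where c: "Q \<ge> 1" "c 0 = 0" "\<forall>n>Q. c n = 0"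
    "(\<Sum>n=1..Q. (c n)\<^sup>2) = (\<Prod>p\<in>P. 1 + (- (1 + x p))\<^sup>2 + (x p)\<^sup>2)"
    "(\<Sum>n. (dconv c (eta_coeff \<sigma>) n)\<^sup>2) = (\<Prod>p\<in>P. 1 + (- (1 + x p))\<^sup>2 + (x p)\<^sup>2 + 2 * (- (1 + x p)) * x p
        + 2 * (- (1 + x p)) * x p * x p + 2 * x p * (x p)\<^sup>2) * B"
    using exists_dirichlet_factor[OF P(1,2) eta_coeff_zero summable_eta_coeff_square[OF \<sigma>(1)],
        where u = "\<lambda>p. - (1 + x p)" and v = x and \<xi> = x] eta_coeff_mult_odd
    unfolding B_def x_def by blast
  have cQ: "c n = 0" if "n > Q" for n using c(3) that by blast
  have "\<forall>\<^sub>F T in at_top. k * avg T (\<lambda>t. (norm (dpoly c Q t))\<^sup>2)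
      \<le> avg T (\<lambda>t. (norm (dpoly c Q t * ((1 - 2 powr (1 - Complex \<sigma> t)) * zeta (Complex \<sigma> t))))\<^sup>2)"
    using eventually_ge_at_top[of "max 1 t0"]
  proof eventually_elim
    case (elim T)
    show ?case unfolding avg_cmult[symmetric]
    proof (rule avg_mono)
      fix t assume t: "t \<in> {T..2 * T}"
      define E where "E = (1 - 2 powr (1 - Complex \<sigma> t)) * zeta (Complex \<sigma> t)"
      have "\<kappa> * w \<le> norm E"
        unfolding E_def norm_mult mult.commute[of \<kappa>] using large[of t] norm_eta_factor(1)[of \<sigma> t] elim t assms w
        by (intro mult_mono) (auto simp: w_def)
      then have "k \<le> (norm E)\<^sup>2" unfolding k_def using w assms by (intro power_mono) auto
      then have "k * (norm (dpoly c Q t))\<^sup>2 \<le> (norm E)\<^sup>2 * (norm (dpoly c Q t))\<^sup>2"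
        by (intro mult_right_mono) auto
      then show "k * (norm (dpoly c Q t))\<^sup>2 \<le> (norm (dpoly c Q t * ((1 - 2 powr (1 - Complex \<sigma> t)) * zeta (Complex \<sigma> t))))\<^sup>2"
        by (simp add: E_def norm_mult power_mult_distrib mult_ac)
    qed (use elim \<sigma> in \<open>auto intro!: continuous_on_norm_dpoly_zeta_square continuous_on_mult continuous_on_norm_dpoly_square\<close>)
  qed
  from tendsto_le[OF _ tendsto_avg_zeta_dpoly[OF \<sigma> c(1) cQ] tendsto_mult[OF tendsto_const tendsto_avg_dpoly[OF c(1)]] this]
  have "k * (\<Sum>n=1..Q. (c n)\<^sup>2) \<le> (\<Sum>m. (dconv c (eta_coeff \<sigma>) m)\<^sup>2)" by simp
  also have "\<dots> \<le> (\<Prod>p\<in>P. 2) * B"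
    unfolding c(5)
  proof (intro mult_right_mono prod_mono conjI)
    fix p assume "p \<in> P"
    then have "p \<ge> 1" using P(2) prime_ge_1_nat by blast
    then have x1: "x p \<le> 1" using powr_mono[of "- \<sigma>" 0 "real p"] \<sigma> by (simp add: x_def)
    have e: "1 + (- (1 + x p))\<^sup>2 + (x p)\<^sup>2 + 2 * (- (1 + x p)) * x p
        + 2 * (- (1 + x p)) * x p * x p + 2 * x p * (x p)\<^sup>2 = 2 - 2 * (x p)\<^sup>2"
      by (simp add: power2_eq_square algebra_simps)
    have "(x p)\<^sup>2 \<le> 1" using x x1 by (simp add: power_le_one)
    then show "0 \<le> 1 + (- (1 + x p))\<^sup>2 + (x p)\<^sup>2 + 2 * (- (1 + x p)) * x p
        + 2 * (- (1 + x p)) * x p * x p + 2 * x p * (x p)\<^sup>2" unfolding e by simp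
    show "1 + (- (1 + x p))\<^sup>2 + (x p)\<^sup>2 + 2 * (- (1 + x p)) * x p
        + 2 * (- (1 + x p)) * x p * x p + 2 * x p * (x p)\<^sup>2 \<le> 2" unfolding e by simp
  qed (use B in auto)
  finally have up: "k * (\<Sum>n=1..Q. (c n)\<^sup>2) \<le> (\<Prod>p\<in>P. 2) * B" .
  have "(\<Prod>p\<in>P. 2) * ((B + 1) / k) \<le> (\<Prod>p\<in>P. 2) * (\<Prod>p\<in>P. 1 + x p)"
    using P(3) by (intro mult_left_mono prod_nonneg) auto
  also have "\<dots> = (\<Prod>p\<in>P. 2 * (1 + x p))" by (rule prod.distrib[symmetric])
  also have "\<dots> \<le> (\<Sum>n=1..Q. (c n)\<^sup>2)"
    unfolding c(4) using x by (intro prod_mono) (auto simp: power2_eq_square algebra_simps)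
  finally have "k * ((\<Prod>p\<in>P. 2) * ((B + 1) / k)) \<le> k * (\<Sum>n=1..Q. (c n)\<^sup>2)"
    using k by (intro mult_left_mono) auto
  also note up
  finally have "k * (A P * ((B + 1) / k)) \<le> A P * B" unfolding A_def .
  moreover have "k * (A P * ((B + 1) / k)) = A P * B + A P" using k by (simp add: field_simps)
  moreover have "A P > 0" unfolding A_def by (intro prod_pos) auto
  ultimately show False by simp
qed

text \<open>With q = p^(\<sigma>-s) and x = p^(-\<sigma>), the factor 1 + q has squared coefficient
  norm 2 but contributes 2(1 + x) after multiplication by the alternating series, as the cross term
  2x is positive. An upper bound for |zeta| would keep the product of the 1 + x below k.\<close>

lemma zeta_large_far:
  assumes \<sigma>: "1 / 2 < \<sigma>" "\<sigma> < 1"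
  shows "\<exists>t\<ge>t0. norm (zeta (Complex \<sigma> t)) > \<kappa>"
proof (rule ccontr)
  assume "\<not> (\<exists>t\<ge>t0. norm (zeta (Complex \<sigma> t)) > \<kappa>)"
  then have small: "norm (zeta (Complex \<sigma> t)) \<le> \<kappa>" if "t \<ge> t0" for t using that by (auto simp: not_less)
  have \<kappa>: "\<kappa> \<ge> 0" using small[of t0] norm_ge_zero order.trans by blast
  define w where "w = 1 + 2 powr (1 - \<sigma>)"
  have w: "w > 0" by (simp add: w_def add_pos_nonneg)
  define k where "k = (\<kappa> * w)\<^sup>2"
  define B where "B = (\<Sum>n. (eta_coeff \<sigma> n)\<^sup>2)"
  have B: "B \<ge> 1" unfolding B_def using suminf_eta_coeff_ge \<sigma> by simp
  define x where "x = (\<lambda>p. real p powr (- \<sigma>))"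
  obtain P where P: "finite P" "\<And>p. p \<in> P \<Longrightarrow> prime p \<and> odd p" "(\<Prod>p\<in>P. 1 + x p) \<ge> k + 1"
    using prod_odd_primes_unbounded[of \<sigma> "k + 1"] \<sigma> unfolding x_def by fastforce
  have x: "0 \<le> x p" for p by (simp add: x_def)
  obtain c Q where c: "Q \<ge> 1" "c 0 = 0" "\<forall>n>Q. c n = 0"
    "(\<Sum>n=1..Q. (c n)\<^sup>2) = (\<Prod>p\<in>P. 1 + 1\<^sup>2 + 0\<^sup>2)"
    "(\<Sum>n. (dconv c (eta_coeff \<sigma>) n)\<^sup>2) = (\<Prod>p\<in>P. 1 + 1\<^sup>2 + 0\<^sup>2 + 2 * 1 * x p
        + 2 * 1 * 0 * x p + 2 * 0 * (x p)\<^sup>2) * B"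
    using exists_dirichlet_factor[OF P(1,2) eta_coeff_zero summable_eta_coeff_square[OF \<sigma>(1)],
        where u = "\<lambda>p. 1" and v = "\<lambda>p. 0" and \<xi> = x] eta_coeff_mult_odd
    unfolding B_def x_def by blast
  have cQ: "c n = 0" if "n > Q" for n using c(3) that by blast
  have "\<forall>\<^sub>F T in at_top. avg T (\<lambda>t. (norm (dpoly c Q t * ((1 - 2 powr (1 - Complex \<sigma> t)) * zeta (Complex \<sigma> t))))\<^sup>2)
      \<le> k * avg T (\<lambda>t. (norm (dpoly c Q t))\<^sup>2)"
    using eventually_ge_at_top[of "max 1 t0"]
  proof eventually_elim
    case (elim T)
    show ?case unfolding avg_cmult[symmetric]
    proof (rule avg_mono)
      fix t assume t: "t \<in> {T..2 * T}"
      define E where "E = (1 - 2 powr (1 - Complex \<sigma> t)) * zeta (Complex \<sigma> t)"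
      have "norm E \<le> \<kappa> * w"
        unfolding E_def norm_mult mult.commute[of \<kappa>] using small[of t] norm_eta_factor(2)[of \<sigma> t] elim t w
        by (intro mult_mono) (auto simp: w_def)
      then have "(norm E)\<^sup>2 \<le> k" unfolding k_def by (intro power_mono) auto
      then have "(norm E)\<^sup>2 * (norm (dpoly c Q t))\<^sup>2 \<le> k * (norm (dpoly c Q t))\<^sup>2"
        by (intro mult_right_mono) auto
      then show "(norm (dpoly c Q t * ((1 - 2 powr (1 - Complex \<sigma> t)) * zeta (Complex \<sigma> t))))\<^sup>2 \<le> k * (norm (dpoly c Q t))\<^sup>2"
        by (simp add: E_def norm_mult power_mult_distrib mult_ac)
    qed (use elim \<sigma> in \<open>auto intro!: continuous_on_norm_dpoly_zeta_square continuous_on_mult continuous_on_norm_dpoly_square\<close>)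
  qed
  from tendsto_le[OF _ tendsto_mult[OF tendsto_const tendsto_avg_dpoly[OF c(1)]] tendsto_avg_zeta_dpoly[OF \<sigma> c(1) cQ] this]
  have "(\<Sum>m. (dconv c (eta_coeff \<sigma>) m)\<^sup>2) \<le> k * (\<Sum>n=1..Q. (c n)\<^sup>2)" by simp
  also have "\<dots> = k * (\<Prod>p\<in>P. 2)" unfolding c(4) by simp
  also have "(\<Sum>m. (dconv c (eta_coeff \<sigma>) m)\<^sup>2) = (\<Prod>p\<in>P. 2 * (1 + x p)) * B"
    unfolding c(5) by (simp add: algebra_simps)
  also have "(\<Prod>p\<in>P. 2 * (1 + x p)) = (\<Prod>p\<in>P. 2) * (\<Prod>p\<in>P. 1 + x p)" by (rule prod.distrib)
  finally have "(\<Prod>p\<in>P. 2) * ((\<Prod>p\<in>P. 1 + x p) * B) \<le> (\<Prod>p\<in>P. 2) * k" by (simp add: mult_ac)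
  moreover have "(\<Prod>p\<in>P. 2 :: real) > 0" by (intro prod_pos) auto
  ultimately have "(\<Prod>p\<in>P. 1 + x p) * B \<le> k" by simp
  moreover have "(\<Prod>p\<in>P. 1 + x p) * 1 \<le> (\<Prod>p\<in>P. 1 + x p) * B"
    using B x by (intro mult_left_mono prod_nonneg) auto
  ultimately show False using P(3) by linarith
qed

theorem infinite_zeta_modulus_values:
  assumes \<sigma>: "1 / 2 < \<sigma>" "\<sigma> < 1" and "y > 0"
  shows "infinite {t. t > 0 \<and> norm (zeta (Complex \<sigma> t)) = y}"
proof
  let ?S = "{t. t > 0 \<and> norm (zeta (Complex \<sigma> t)) = y}"
  assume fin: "finite ?S"
  \<comment> \<open>Inserting 0 makes \<open>Max\<close> meaningful for an empty set and ensures M >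
    0.\<close>
  define M where "M = Max (insert 0 ?S) + 1"
  have M: "t < M" if "t \<in> ?S" for t
  proof -
    have "t \<le> Max (insert 0 ?S)" by (rule Max_ge) (use fin that in auto)
    then show ?thesis unfolding M_def by linarith
  qed
  have "0 \<le> Max (insert 0 ?S)" by (rule Max_ge) (use fin in auto)
  then have M0: "M > 0" unfolding M_def by linarith
  obtain a where a: "a \<ge> M" "norm (zeta (Complex \<sigma> a)) < y" using zeta_small_far[OF assms] by blast
  obtain b where b: "b \<ge> M" "norm (zeta (Complex \<sigma> b)) > y" using zeta_large_far[OF \<sigma>] by blast
  have cont: "continuous_on A (\<lambda>t. norm (zeta (Complex \<sigma> t)))" for A
    using \<sigma> by (intro continuous_on_norm continuous_on_zeta_line) auto
  have "\<exists>t\<ge>M. norm (zeta (Complex \<sigma> t)) = y"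
  proof (cases "a \<le> b")
    case True
    have "\<exists>t\<ge>a. t \<le> b \<and> norm (zeta (Complex \<sigma> t)) = y"
      by (rule IVT'[OF _ _ True cont]) (use a b in auto)
    then obtain t where "a \<le> t" "norm (zeta (Complex \<sigma> t)) = y" by blast
    then show ?thesis using a(1) by (intro exI[of _ t]) auto
  next
    case False
    then have "b \<le> a" by simp
    have "\<exists>t\<ge>b. t \<le> a \<and> norm (zeta (Complex \<sigma> t)) = y"
      by (rule IVT2'[OF _ _ \<open>b \<le> a\<close> cont]) (use a b in auto)
    then obtain t where "b \<le> t" "norm (zeta (Complex \<sigma> t)) = y" by blast
    then show ?thesis using b(1) by (intro exI[of _ t]) auto
  qed
  then obtain t where "t \<ge> M" "norm (zeta (Complex \<sigma> t)) = y" by blast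
  then show False using M[of t] M0 by auto
qed

section \<open>The mean square on the critical line\<close>

lemma continuous_on_zeta_crit_sq [continuous_intros]: "continuous_on A zeta_crit_sq"
  unfolding zeta_crit_sq_def[abs_def]
  by (intro continuous_on_power continuous_on_norm continuous_on_zeta_line) simp

lemma zeta_crit_sq_nonneg [simp]: "zeta_crit_sq t \<ge> 0"
  by (simp add: zeta_crit_sq_def)

lemma Re_dpoly: "Re (dpoly b X t) = (\<Sum>n=1..X. b n * cos (t * ln (real n)))"
  by (simp add: dpoly_def Re_sum)

lemma sum_inverse_sqrt_le: "(\<Sum>n=1..N. real n powr (- (1 / 2))) \<le> 2 * sqrt (real N)"
proof (induction N)
  case (Suc N)
  have "sqrt (real N) \<le> sqrt (real (Suc N))" by simp
  define x y where "x = sqrt (real N)" and "y = sqrt (real (Suc N))"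
  have xy: "0 \<le> x" "x \<le> y" "0 < y" unfolding x_def y_def by simp_all
  have "y * y = real N + 1" "x * x = real N" unfolding x_def y_def by simp_all
  then have "1 = (y - x) * (y + x)" by (simp add: algebra_simps)
  also have "\<dots> \<le> (y - x) * (2 * y)" using xy by (intro mult_left_mono) auto
  finally have "1 / y \<le> 2 * (y - x)" using xy by (simp add: pos_divide_le_eq mult_ac)
  moreover have "real (Suc N) powr (- (1 / 2)) = 1 / y"
    unfolding y_def powr_minus powr_half_sqrt[OF of_nat_0_le_iff] by (rule inverse_eq_divide)
  ultimately have "real (Suc N) powr (- (1 / 2)) \<le> 2 * y - 2 * x" by simp
  then have "(\<Sum>n=1..N. real n powr (- (1 / 2))) + real (Suc N) powr (- (1 / 2)) \<le> 2 * x + (2 * y - 2 * x)"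
    using Suc unfolding x_def by (intro add_mono)
  then show ?case by (simp add: y_def)
qed simp

text \<open>The term n = 1 is the constant 1 and contributes T. For n \<ge> 2 the frequency ln n is
  at least 1/2, so the term contributes at most 4 n^(-1/2), and these add up to at most 8 sqrt
  N.\<close>

lemma integral_Re_dpoly_eta_ge:
  assumes "T \<ge> 0"
  shows "integral {T..2 * T} (\<lambda>t. Re (dpoly (eta_coeff (1 / 2)) N t)) \<ge> T * (if N = 0 then 0 else 1) - 8 * sqrt (real N)"
proof -
  let ?b = "eta_coeff (1 / 2)"
  have I: "integral {T..2 * T} (\<lambda>t. Re (dpoly ?b N t)) = (\<Sum>n=1..N. ?b n * cos_int T (ln (real n)))"
    unfolding Re_dpoly
    by (intro integral_unique has_integral_sum has_integral_mult_right has_integral_cos_int assms) auto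
  have "(\<Sum>n=1..N. (if n = 1 then T else 0) - 4 * real n powr (- (1 / 2)))
      \<le> (\<Sum>n=1..N. ?b n * cos_int T (ln (real n)))"
  proof (intro sum_mono)
    fix n assume n: "n \<in> {1..N}"
    show "(if n = 1 then T else 0) - 4 * real n powr (- (1 / 2)) \<le> ?b n * cos_int T (ln (real n))"
    proof (cases "n = 1")
      case True
      then show ?thesis by (simp add: eta_coeff_def cos_int_def)
    next
      case False
      with n have n2: "n \<ge> 2" by auto
      have "1 / 2 \<le> ln (2 :: real)" using ln2_ge_two_thirds by simp
      also have "\<dots> \<le> ln (real n)" using n2 by simp
      finally have l: "ln (real n) \<ge> 1 / 2" .
      have "\<bar>cos_int T (ln (real n))\<bar> \<le> 2 / \<bar>ln (real n)\<bar>" using l by (intro abs_cos_int_le) auto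
      also have "\<dots> \<le> 4" using l by (simp add: pos_divide_le_eq)
      finally have "\<bar>?b n * cos_int T (ln (real n))\<bar> \<le> real n powr (- (1 / 2)) * 4"
        unfolding abs_mult abs_eta_coeff using n2 by (intro mult_mono) auto
      then show ?thesis using False by (auto simp: abs_le_iff)
    qed
  qed
  moreover have "(\<Sum>n=1..N. (if n = 1 then T else 0) - 4 * real n powr (- (1 / 2)))
      = T * (if N = 0 then 0 else 1) - 4 * (\<Sum>n=1..N. real n powr (- (1 / 2)))"
    by (simp add: sum_subtractf sum_distrib_left)
  ultimately show ?thesis using sum_inverse_sqrt_le[of N] unfolding I by linarith
qed

text \<open>In the first moment the error sqrt N is only of order T^(3/4) for N of order T^(3/2).
  With |1 - 2^(1-s)| \<le> 3 and 3x \<le> 9x^2 + 1/4 it follows that 3T/4 is at most 9 times the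
  integral plus T/2, whence the 36.\<close>

lemma integral_zeta_crit_sq_dyadic_ge:
  "\<forall>\<^sub>F T in at_top. integral {T..2 * T} zeta_crit_sq \<ge> T / 36"
proof -
  define E where "E = (\<lambda>t. (1 - 2 powr (1 - Complex (1 / 2) t)) * zeta (Complex (1 / 2) t))"
  define P where "P = (\<lambda>T::real. dpoly (eta_coeff (1 / 2)) (nat \<lfloor>T powr (1 + 1 / 2)\<rfloor>))"
  obtain err where err: "(err \<longlongrightarrow> 0) at_top"
    "\<forall>\<^sub>F T in at_top. \<forall>t\<in>{T..2 * T}. norm (E t - P T t) \<le> err T"
    using eta_approx[of "1 / 2" "1 / 2"] unfolding E_def P_def by auto
  have contE: "continuous_on S E" for S
    unfolding E_def by (intro continuous_on_mult continuous_on_eta_factor continuous_on_zeta_line) simp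
  have contP: "continuous_on S (P T)" for S T unfolding P_def by (rule continuous_on_dpoly)
  have "\<forall>\<^sub>F T in at_top. err T < 1 / 4" using err(1) by (rule order_tendstoD) simp
  moreover have "\<forall>\<^sub>F T::real in at_top. T / 4 \<ge> 8 * sqrt (T powr (3 / 2))" by real_asymp
  moreover have "\<forall>\<^sub>F T::real in at_top. T \<ge> 1" by (rule eventually_ge_at_top)
  ultimately show ?thesis using err(2)
  proof eventually_elim
    case (elim T)
    define N where "N = nat \<lfloor>T powr (1 + 1 / 2)\<rfloor>"
    have Tp: "T powr (3 / 2) \<ge> 1" using elim by (intro ge_one_powr_ge_zero) auto
    have N: "N \<noteq> 0" "real N \<le> T powr (3 / 2)" using Tp by (auto simp: N_def)
    have "T - T / 4 \<le> T - 8 * sqrt (T powr (3 / 2))" using elim by simp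
    also have "\<dots> \<le> T - 8 * sqrt (real N)" using N by simp
    also have "\<dots> \<le> integral {T..2 * T} (\<lambda>t. Re (P T t))"
      using integral_Re_dpoly_eta_ge[of T N] elim N by (simp add: P_def N_def)
    also have "\<dots> \<le> integral {T..2 * T} (\<lambda>t. norm (E t) + 1 / 4)"
    proof (rule integral_le)
      show "(\<lambda>t. Re (P T t)) integrable_on {T..2 * T}" "(\<lambda>t. norm (E t) + 1 / 4) integrable_on {T..2 * T}"
        using contE contP by (auto intro!: integrable_continuous_real continuous_intros)
      fix t assume t: "t \<in> {T..2 * T}"
      have "Re (P T t) \<le> norm (P T t)" by (rule complex_Re_le_cmod)
      also have "\<dots> \<le> norm (E t) + norm (E t - P T t)"
        by (metis norm_minus_commute norm_triangle_sub)
      also have "\<dots> \<le> norm (E t) + 1 / 4" using elim t by fastforce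
      finally show "Re (P T t) \<le> norm (E t) + 1 / 4" .
    qed
    also have "\<dots> \<le> integral {T..2 * T} (\<lambda>t. 9 * zeta_crit_sq t + 1 / 2)"
    proof (rule integral_le)
      show "(\<lambda>t. norm (E t) + 1 / 4) integrable_on {T..2 * T}"
        "(\<lambda>t. 9 * zeta_crit_sq t + 1 / 2) integrable_on {T..2 * T}"
        using contE by (auto intro!: integrable_continuous_real continuous_intros)
      fix t
      define x where "x = norm (zeta (Complex (1 / 2) t))"
      have "(2::real) powr (1 - 1 / 2) \<le> 2 powr 1" by (intro powr_mono) auto
      then have "norm (1 - 2 powr (1 - Complex (1 / 2) t) :: complex) \<le> 3"
        using norm_triangle_ineq4[of "1 :: complex" "2 powr (1 - Complex (1 / 2) t)"]
          norm_powr_real_powr[of 2 "1 - Complex (1 / 2) t"] by simp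
      then have "norm (E t) \<le> 3 * x"
        unfolding E_def norm_mult x_def by (rule mult_right_mono) simp
      moreover have "0 \<le> (3 * x - 1 / 2)\<^sup>2" by simp
      then have "3 * x \<le> 9 * x\<^sup>2 + 1 / 4" by (simp add: power2_eq_square algebra_simps)
      ultimately show "norm (E t) + 1 / 4 \<le> 9 * zeta_crit_sq t + 1 / 2"
        by (simp add: zeta_crit_sq_def x_def)
    qed
    also have "\<dots> = 9 * integral {T..2 * T} zeta_crit_sq + T / 2"
      using elim by (subst integral_add) (auto intro!: integrable_continuous_real continuous_intros)
    finally show ?case by simp
  qed
qed

definition zeta_energy :: "real \<Rightarrow> real" where
  "zeta_energy T = integral {0..T} zeta_crit_sq"

lemma zeta_energy_has_derivative:
  assumes "T > 0"
  shows "(zeta_energy has_real_derivative zeta_crit_sq T) (at T)"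
proof -
  have "(zeta_energy has_real_derivative zeta_crit_sq T) (at T within {0..T + 1})"
    unfolding zeta_energy_def using assms
    by (intro integral_has_real_derivative continuous_on_zeta_crit_sq) auto
  moreover have "at T within {0..T + 1} = at T"
    using assms by (intro at_within_interior) auto
  ultimately show ?thesis by simp
qed

lemma zeta_energy_nonneg: "zeta_energy T \<ge> 0"
  unfolding zeta_energy_def by (intro integral_nonneg integrable_continuous_real continuous_on_zeta_crit_sq) simp

lemma zeta_energy_continuous: "continuous_on {0..} zeta_energy"
proof -
  have "continuous (at T within {0..}) zeta_energy" if "T \<ge> 0" for T
  proof -
    have "continuous_on {0..T + 1} zeta_energy"
      unfolding zeta_energy_def
      by (intro indefinite_integral_continuous_1 integrable_continuous_real continuous_on_zeta_crit_sq)
    then have "continuous (at T within {0..T + 1}) zeta_energy"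
      using that by (simp add: continuous_on_eq_continuous_within)
    moreover have "at T within {0..T + 1} = at T within {0..}"
      using that by (intro at_within_nhd[of T "{T - 1<..<T + 1}"]) auto
    ultimately show ?thesis by simp
  qed
  then show ?thesis by (simp add: continuous_on_eq_continuous_within)
qed

text \<open>If zeta vanished on an interval of the critical line, it would vanish identically,
  against the growth of its mean square.\<close>

lemma zeta_crit_sq_pos_between:
  assumes "a < b"
  shows "\<exists>t. a < t \<and> t < b \<and> zeta_crit_sq t > 0"
proof (rule ccontr)
  assume none: "\<not> (\<exists>t. a < t \<and> t < b \<and> zeta_crit_sq t > 0)"
  have zero: "zeta (Complex (1 / 2) t) = 0" if "a < t" "t < b" for t
  proof -
    have "\<not> zeta_crit_sq t > 0" using none that by blast
    then show ?thesis by (simp add: zeta_crit_sq_def)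
  qed
  define c where "c = (a + b) / 2"
  define U where "U = Complex (1 / 2) ` {a<..<b}"
  have cab: "a < c" "c < b" using assms by (auto simp: c_def)
  have lim: "Complex (1 / 2) c islimpt U"
    unfolding islimpt_approachable
  proof (intro allI impI)
    fix e :: real assume "e > 0"
    define t where "t = c + min (e / 2) ((b - c) / 2)"
    have t: "c < t" "t < b" "t - c < e" using \<open>e > 0\<close> cab by (auto simp: t_def min_def field_simps)
    have "Complex (1 / 2) t \<in> U" using t cab by (auto simp: U_def)
    moreover have "Complex (1 / 2) t \<noteq> Complex (1 / 2) c" using t by simp
    moreover have "dist (Complex (1 / 2) t) (Complex (1 / 2) c) < e"
    proof -
      have "Complex (1 / 2) t - Complex (1 / 2) c = Complex 0 (t - c)" by (simp add: complex_eq_iff)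
      then show ?thesis using t by (simp add: dist_norm complex_norm)
    qed
    ultimately show "\<exists>x'\<in>U. x' \<noteq> Complex (1 / 2) c \<and> dist x' (Complex (1 / 2) c) < e" by blast
  qed
  have z: "zeta w = 0" if "w \<noteq> 1" for w
  proof (rule analytic_continuation[OF zeta_holomorphic _ _ _ _ lim])
    show "connected (- {1 :: complex})"
      using convex_connected_delete_complex[of UNIV 1] by (simp add: Compl_eq_Diff_UNIV)
    show "U \<subseteq> - {1}" by (auto simp: U_def complex_eq_iff)
    show "Complex (1 / 2) c \<in> - {1}" by (auto simp: complex_eq_iff)
    show "\<And>z. z \<in> U \<Longrightarrow> zeta z = 0" using zero by (auto simp: U_def)
  qed (use that in auto)
  have zc: "zeta_crit_sq = (\<lambda>_. 0)"
    using z by (auto simp: zeta_crit_sq_def fun_eq_iff complex_eq_iff)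
  have "\<forall>\<^sub>F T in at_top. T / 36 \<le> (0 :: real)"
    using integral_zeta_crit_sq_dyadic_ge unfolding zc by simp
  moreover have "\<forall>\<^sub>F T in at_top. T > (0 :: real)" by (rule eventually_gt_at_top)
  ultimately have "\<forall>\<^sub>F T in at_top :: real filter. False" by eventually_elim simp
  then show False by simp
qed

lemma integral_pos_of_continuous:
  fixes h :: "real \<Rightarrow> real"
  assumes "continuous_on {a..b} h" "\<And>t. t \<in> {a..b} \<Longrightarrow> h t \<ge> 0" "a < c" "c < b" "h c > 0"
  shows "integral {a..b} h > 0"
proof -
  have "integral {a..b} h \<noteq> 0"
    using integral_eq_0_iff[of a b h] assms by force
  moreover have "integral {a..b} h \<ge> 0"
    using assms by (intro integral_nonneg integrable_continuous_real) auto
  ultimately show ?thesis by linarith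
qed

lemma zeta_energy_strict_mono:
  assumes "0 \<le> S" "S < T"
  shows "zeta_energy S < zeta_energy T"
proof -
  obtain t where t: "S < t" "t < T" "zeta_crit_sq t > 0" using zeta_crit_sq_pos_between assms by blast
  have "integral {S..T} zeta_crit_sq > 0"
    by (rule integral_pos_of_continuous[OF continuous_on_zeta_crit_sq _ t]) simp
  moreover have "zeta_energy S + integral {S..T} zeta_crit_sq = zeta_energy T"
    unfolding zeta_energy_def using assms
    by (intro Henstock_Kurzweil_Integration.integral_combine integrable_continuous_real continuous_on_zeta_crit_sq) auto
  ultimately show ?thesis by linarith
qed

lemma zeta_energy_unbounded: "\<exists>T\<ge>0. zeta_energy T \<ge> B"
proof -
  have "\<forall>\<^sub>F T::real in at_top. T \<ge> max 0 (36 * B)" by (rule eventually_ge_at_top)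
  with integral_zeta_crit_sq_dyadic_ge
  have "\<forall>\<^sub>F T in at_top. T \<ge> 0 \<and> zeta_energy (2 * T) \<ge> B"
  proof eventually_elim
    case (elim T)
    have "zeta_energy T + integral {T..2 * T} zeta_crit_sq = zeta_energy (2 * T)"
      unfolding zeta_energy_def using elim
      by (intro Henstock_Kurzweil_Integration.integral_combine integrable_continuous_real continuous_on_zeta_crit_sq) auto
    then show ?case using elim zeta_energy_nonneg[of T] by auto
  qed
  then obtain T where "T \<ge> 0" "zeta_energy (2 * T) \<ge> B"
    by (metis (mono_tags, lifting) eventually_happens' trivial_limit_at_top_linorder)
  then show ?thesis by (intro exI[of _ "2 * T"]) auto
qed

section \<open>Jacob's ladder\<close>

locale ladder =
  fixes y0 :: real and \<mu> :: "real \<Rightarrow> real"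
  assumes y0: "0 < y0"
    and mono: "mono_on {y0..} \<mu>"
    and smooth: "smooth_on_ray y0 \<mu>"
    and big: "\<And>y. y \<ge> y0 \<Longrightarrow> \<mu> y \<ge> 7 * y * ln y"
begin

text \<open>In the defining equation x occurs in the weight and, through \<mu>, in the upper limit.
  The two are separated here so that each dependence can be studied alone.\<close>

definition weighted :: "real \<Rightarrow> real \<Rightarrow> real" where
  "weighted x m = integral {0..m} (\<lambda>t. zeta_crit_sq t * exp (- 2 * t / x))"

definition level :: "real \<Rightarrow> real" where
  "level x = weighted x (\<mu> x)"

lemma ladder_eq_iff: "ladder_eq y0 \<mu> T x \<longleftrightarrow> y0 \<le> x \<and> level x = zeta_energy T"
  by (simp add: ladder_eq_def level_def weighted_def zeta_energy_def)

lemma continuous_on_weight: "continuous_on A (\<lambda>t. zeta_crit_sq t * exp (- 2 * t / x))"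
  by (cases "x = 0") (auto intro!: continuous_intros)

lemma weighted_pos:
  assumes "m > 0"
  shows "weighted x m > 0"
proof -
  obtain c where "0 < c" "c < m" "zeta_crit_sq c > 0" using zeta_crit_sq_pos_between assms by blast
  then show ?thesis
    unfolding weighted_def by (intro integral_pos_of_continuous[OF continuous_on_weight]) auto
qed

lemma weighted_less:
  assumes "m > 0" "0 < x" "x < x'"
  shows "weighted x m < weighted x' m"
proof -
  define h where "h = (\<lambda>t. zeta_crit_sq t * exp (- 2 * t / x') - zeta_crit_sq t * exp (- 2 * t / x))"
  obtain c where c: "0 < c" "c < m" "zeta_crit_sq c > 0" using zeta_crit_sq_pos_between assms by blast
  have le: "- 2 * t / x \<le> - 2 * t / x'" if "t \<ge> 0" for t
    using that assms by (simp add: divide_left_mono)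
  have "integral {0..m} h > 0"
  proof (rule integral_pos_of_continuous[OF _ _ c(1,2)])
    show "continuous_on {0..m} h" unfolding h_def by (intro continuous_on_diff continuous_on_weight)
    show "h t \<ge> 0" if "t \<in> {0..m}" for t
      unfolding h_def using le[of t] that by (auto intro!: mult_left_mono)
    have "- 2 * c / x < - 2 * c / x'" using c assms by (simp add: divide_strict_left_mono)
    then show "h c > 0" unfolding h_def using c by simp
  qed
  moreover have "integral {0..m} h = weighted x' m - weighted x m"
    unfolding h_def weighted_def
    by (intro Henstock_Kurzweil_Integration.integral_diff integrable_continuous_real continuous_on_weight)
  ultimately show ?thesis by simp
qed

lemma weighted_mono:
  assumes "m \<le> m'"
  shows "weighted x m \<le> weighted x m'"
  unfolding weighted_def using assms
  by (intro integral_subset_le integrable_continuous_real continuous_on_weight) auto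

text \<open>An integral over an empty interval is 0. Near y0 the function \<mu> may be negative, so
  \<open>level\<close> may begin with a stretch of zeros.\<close>

lemma level_zero: "\<mu> x \<le> 0 \<Longrightarrow> level x = 0"
  by (cases "\<mu> x = 0") (auto simp: level_def weighted_def)

lemma level_pos: "\<mu> x > 0 \<Longrightarrow> level x > 0"
  by (simp add: level_def weighted_pos)

lemma level_strict_mono:
  assumes "y0 \<le> x" "x < x'" "\<mu> x' > 0"
  shows "level x < level x'"
proof (cases "\<mu> x > 0")
  case False
  then show ?thesis using level_zero[of x] level_pos[OF assms(3)] by simp
next
  case True
  have "level x < weighted x' (\<mu> x)"
    unfolding level_def using True assms y0 by (intro weighted_less) auto
  also have "\<dots> \<le> level x'"
    unfolding level_def using mono assms by (intro weighted_mono) (auto simp: mono_on_def)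
  finally show ?thesis .
qed

text \<open>From 2 on 7 ln x \<ge> 14/3 > 1, so that \<mu> x \<ge> x.\<close>

definition x0 :: real where "x0 = max y0 2"

lemma x0: "x0 \<ge> y0" "x0 \<ge> 2" by (auto simp: x0_def)

lemma \<mu>_ge:
  assumes "x \<ge> x0"
  shows "\<mu> x \<ge> x" "\<mu> x > 0"
proof -
  have x: "x \<ge> 2" "x \<ge> y0" using assms x0 by auto
  have "ln x \<ge> ln 2" using x by simp
  then have "ln x \<ge> 2 / 3" using ln2_ge_two_thirds by linarith
  then have "7 * x * (2 / 3) \<le> 7 * x * ln x" using x by (intro mult_left_mono) auto
  also have "\<dots> \<le> \<mu> x" using big x by blast
  finally show "\<mu> x \<ge> x" using x by linarith
  then show "\<mu> x > 0" using x by linarith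
qed

text \<open>On [0, x] the weight is at least e^(-2), and \<mu> x \<ge> x; thus the divergence of the
  energy passes to \<open>level\<close>.\<close>

lemma level_ge:
  assumes "x \<ge> x0"
  shows "level x \<ge> exp (- 2) * zeta_energy x"
proof -
  have x: "x > 0" using assms x0 by linarith
  have "exp (- 2) * zeta_energy x = integral {0..x} (\<lambda>t. exp (- 2) * zeta_crit_sq t)"
    unfolding zeta_energy_def by simp
  also have "\<dots> \<le> weighted x x"
    unfolding weighted_def
  proof (rule integral_le)
    show "(\<lambda>t. exp (- 2) * zeta_crit_sq t) integrable_on {0..x}"
      by (intro integrable_continuous_real continuous_intros)
    show "(\<lambda>t. zeta_crit_sq t * exp (- 2 * t / x)) integrable_on {0..x}"
      by (intro integrable_continuous_real continuous_on_weight)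
    fix t assume "t \<in> {0..x}"
    then have "- 2 \<le> - 2 * t / x" using x by (simp add: pos_divide_le_eq)
    then have "zeta_crit_sq t * exp (- 2) \<le> zeta_crit_sq t * exp (- 2 * t / x)"
      by (intro mult_left_mono) auto
    then show "exp (- 2) * zeta_crit_sq t \<le> zeta_crit_sq t * exp (- 2 * t / x)" by (simp add: mult.commute)
  qed
  also have "\<dots> \<le> level x" unfolding level_def by (rule weighted_mono[OF \<mu>_ge(1)[OF assms]])
  finally show ?thesis .
qed

lemma \<mu>_has_derivative:
  assumes "x > y0"
  shows "\<exists>d\<ge>0. (\<mu> has_real_derivative d) (at x)"
proof -
  obtain D where D: "D 0 = \<mu>" "\<And>n y. y \<ge> y0 \<Longrightarrow> (D n has_real_derivative D (Suc n) y) (at y within {y0..})"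
    using smooth unfolding smooth_on_ray_def by blast
  have "at x within {y0..} = at x" using assms by (intro at_within_interior) auto
  then have d: "(\<mu> has_real_derivative D (Suc 0) x) (at x)"
    using D(2)[of x 0] D(1) assms by simp
  moreover have "D (Suc 0) x \<ge> 0"
    by (rule mono_on_imp_deriv_nonneg[OF mono d]) (use assms in auto)
  ultimately show ?thesis by blast
qed

text \<open>The total derivative of \<open>weighted\<close> along the curve (x, \<mu> x). The
  partial derivative in x is strictly positive because zeta has no interval of zeros on the line;
  the moving upper limit adds a nonnegative integrand times \<mu>' \<ge> 0.\<close>

lemma level_has_derivative:
  assumes "x > x0"
  shows "\<exists>d>0. (level has_real_derivative d) (at x)"
proof -
  have x: "x > 0" "x > y0" using assms x0 by linarith+
  obtain d\<mu> where d\<mu>: "d\<mu> \<ge> 0" "(\<mu> has_real_derivative d\<mu>) (at x)" using \<mu>_has_derivative[OF x(2)] by blast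
  define m where "m = \<mu> x"
  have m: "m > 0" unfolding m_def using \<mu>_ge(2) assms by simp
  \<comment> \<open>Room above m, so that the upper limit can vary to both sides of m.\<close>
  define M where "M = m + 1"
  define k where "k = (\<lambda>x t. zeta_crit_sq t * exp (- 2 * t / x) * (2 * t / x\<^sup>2))"
  define dx where "dx = integral {0..m} (k x)"
  define fy where "fy = (\<lambda>x y. zeta_crit_sq y * exp (- 2 * y / x))"
  have dx_pos: "dx > 0"
  proof -
    obtain c where c: "0 < c" "c < m" "zeta_crit_sq c > 0" using zeta_crit_sq_pos_between m by blast
    have "continuous_on {0..m} (k x)"
      unfolding k_def using x by (intro continuous_on_mult continuous_on_weight continuous_intros) auto
    then show ?thesis unfolding dx_def
      by (rule integral_pos_of_continuous[OF _ _ c(1,2)]) (use c x in \<open>auto simp: k_def\<close>)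
  qed
  have fx: "((\<lambda>x. weighted x m) has_real_derivative dx) (at x within {0<..})"
    unfolding weighted_def dx_def cbox_interval[symmetric]
  proof (rule leibniz_rule_field_derivative)
    fix x t :: real assume "x \<in> {0<..}"
    then show "((\<lambda>x. zeta_crit_sq t * exp (- 2 * t / x)) has_real_derivative k x t) (at x within {0<..})"
      unfolding k_def by (auto intro!: derivative_eq_intros simp: power2_eq_square)
  next
    fix x :: real
    show "(\<lambda>t. zeta_crit_sq t * exp (- 2 * t / x)) integrable_on cbox 0 m"
      unfolding cbox_interval by (intro integrable_continuous_real continuous_on_weight)
  next
    have "continuous_on ({0<..} \<times> cbox 0 m) (\<lambda>p. k (fst p) (snd p))"
      unfolding k_def
      by (intro continuous_intros continuous_on_compose2[OF continuous_on_zeta_crit_sq[of UNIV]]) auto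
    then show "continuous_on ({0<..} \<times> cbox 0 m) (\<lambda>(x, t). k x t)" by (simp add: case_prod_beta')
  qed (use x in auto)
  have "((\<lambda>(x, y). weighted x y) has_derivative (\<lambda>(tx, ty). dx * tx + blinfun_mult_right (fy x m) ty))
      (at (x, m) within {0<..} \<times> {0..M})"
  \<comment> \<open>Joint differentiability needs one partial derivative at the point and continuity
    of the other; the integrand at the upper limit is the continuous one.\<close>
  proof (rule has_derivative_partialsI[where fy = "\<lambda>x y. blinfun_mult_right (fy x y)"])
    show "((\<lambda>x. weighted x m) has_derivative (\<lambda>h. dx * h)) (at x within {0<..})"
      using fx by (simp add: has_field_derivative_def)
    fix x' y :: real assume xy: "x' \<in> {0<..}" "y \<in> {0..M}"
    have "((\<lambda>y. weighted x' y) has_real_derivative fy x' y) (at y within {0..M})"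
      unfolding weighted_def fy_def by (rule integral_has_real_derivative[OF continuous_on_weight xy(2)])
    then show "((\<lambda>y. weighted x' y) has_derivative blinfun_apply (blinfun_mult_right (fy x' y))) (at y within {0..M})"
      by (simp add: has_field_derivative_def)
  next
    have "continuous_on ({0<..} \<times> {0..M}) (\<lambda>p. fy (fst p) (snd p))"
      unfolding fy_def
      by (intro continuous_intros continuous_on_compose2[OF continuous_on_zeta_crit_sq[of UNIV]]) auto
    then have "continuous_on ({0<..} \<times> {0..M}) (\<lambda>p. blinfun_mult_right (fy (fst p) (snd p)))"
      by (rule bounded_linear.continuous_on[OF bounded_linear_blinfun_mult_right])
    then show "continuous (at (x, m) within {0<..} \<times> {0..M}) (\<lambda>(x, y). blinfun_mult_right (fy x y))"
      unfolding continuous_on_eq_continuous_within case_prod_beta' using x m by (auto simp: M_def)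
  qed (use m in \<open>auto simp: M_def\<close>)
  note W = this
  \<comment> \<open>On a neighbourhood S of x the curve stays in the domain on which
    \<open>weighted\<close> was differentiated.\<close>
  have "isCont \<mu> x" using d\<mu>(2) by (rule DERIV_isCont)
  then have "\<forall>\<^sub>F x' in nhds x. \<mu> x' < M"
    unfolding isCont_def using order_tendstoD(2)[of \<mu> "\<mu> x" "at x" M]
    by (auto simp: m_def M_def eventually_nhds_conv_at)
  moreover have "\<forall>\<^sub>F x' in nhds x. x' > x0" using assms
    by (intro eventually_nhds_in_open[of "{x0<..}" x, simplified]) auto
  ultimately have "\<forall>\<^sub>F x' in nhds x. \<mu> x' < M \<and> x' > x0" by (rule eventually_conj)
  then obtain S where S: "open S" "x \<in> S" "\<And>x'. x' \<in> S \<Longrightarrow> \<mu> x' < M \<and> x' > x0"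
    unfolding eventually_nhds by blast
  have sub: "(\<lambda>x. (x, \<mu> x)) ` S \<subseteq> {0<..} \<times> {0..M}"
  proof clarify
    fix x' assume "x' \<in> S"
    then have "\<mu> x' < M" "x' > x0" using S(3) by auto
    moreover have "\<mu> x' > 0" using \<mu>_ge(2) \<open>x' > x0\<close> by simp
    ultimately show "x' \<in> {0<..} \<and> \<mu> x' \<in> {0..M}" using x0 by simp
  qed
  have d1: "((\<lambda>x. (x, \<mu> x)) has_derivative (\<lambda>h. (h, d\<mu> * h))) (at x within S)"
    by (rule has_derivative_Pair[OF has_derivative_ident
          has_derivative_at_withinI[OF d\<mu>(2)[unfolded has_field_derivative_def]]])
  have d2: "((\<lambda>(x, y). weighted x y) has_derivative (\<lambda>(tx, ty). dx * tx + blinfun_mult_right (fy x m) ty))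
      (at (x, \<mu> x) within (\<lambda>x. (x, \<mu> x)) ` S)"
    using has_derivative_subset[OF W sub] by (simp add: m_def)
  have "((\<lambda>x. weighted x (\<mu> x)) has_derivative (\<lambda>h. dx * h + fy x m * (d\<mu> * h))) (at x within S)"
    using has_derivative_in_compose[OF d1 d2] by simp
  then have "(level has_derivative (\<lambda>h. dx * h + fy x m * (d\<mu> * h))) (at x)"
    unfolding level_def[abs_def] using at_within_open[OF S(2,1)] by simp
  then have "(level has_real_derivative dx + fy x m * d\<mu>) (at x)"
    unfolding has_field_derivative_def by (rule has_derivative_eq_rhs) (auto simp: algebra_simps)
  moreover have "dx + fy x m * d\<mu> > 0"
    using dx_pos d\<mu>(1) by (intro add_pos_nonneg) (auto simp: fy_def)
  ultimately show ?thesis by blast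
qed

end

context ladder
begin

text \<open>Strictly above x0, so that \<open>level\<close> is continuous at x1 itself and the
  intermediate value theorem can start there.\<close>

definition x1 :: real where "x1 = x0 + 1"

lemma x1: "x1 > x0" "x1 \<ge> y0" "x1 > 0"
  using x0 by (auto simp: x1_def)

lemma continuous_on_level: "continuous_on {x0<..} level"
proof (rule continuous_at_imp_continuous_on, rule ballI)
  fix x assume "x \<in> {x0<..}"
  then obtain d where "(level has_real_derivative d) (at x)" using level_has_derivative[of x] by auto
  then show "isCont level x" by (rule DERIV_isCont)
qed

lemma level_less:
  assumes "x1 \<le> x" "x < x'"
  shows "level x < level x'"
  using assms x1 \<mu>_ge(2)[of x'] by (intro level_strict_mono) auto

text \<open>Uniqueness in \<open>ladder_dom\<close> concerns every x' \<ge> y0, including those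
  below x1. Where \<mu> x' \<le> 0 the level is 0 and cannot equal the positive level of x;
  elsewhere strict monotonicity decides.\<close>

lemma level_unique:
  assumes "x1 \<le> x" "y0 \<le> x'" "level x' = level x"
  shows "x' = x"
proof (rule ccontr)
  assume "x' \<noteq> x"
  have \<mu>x: "\<mu> x > 0" using assms x1 by (intro \<mu>_ge(2)) auto
  have "\<mu> x' > 0" using level_zero[of x'] level_pos[OF \<mu>x] assms(3) by (cases "\<mu> x' > 0") auto
  then show False
    using level_strict_mono[of x x'] level_strict_mono[of x' x] \<mu>x assms x1 \<open>x' \<noteq> x\<close>
    by (cases "x < x'") auto
qed

lemma level_unbounded: "\<exists>V\<ge>x1. \<forall>x\<ge>V. level x \<ge> B"
proof -
  obtain T where T: "T \<ge> 0" "zeta_energy T \<ge> exp 2 * \<bar>B\<bar>" using zeta_energy_unbounded by blast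
  have "level x \<ge> B" if "x \<ge> max x1 (T + 1)" for x
  proof -
    have "zeta_energy T \<le> zeta_energy x" using zeta_energy_strict_mono[of T x] T that by simp
    then have "exp (- 2) * (exp 2 * \<bar>B\<bar>) \<le> exp (- 2) * zeta_energy x"
      using T by (intro mult_left_mono) auto
    also have "\<dots> \<le> level x" using that x1 by (intro level_ge) auto
    also have "exp (- 2) * (exp 2 * \<bar>B\<bar>) = \<bar>B\<bar>"
      by (simp flip: mult.assoc exp_add)
    finally show ?thesis by simp
  qed
  then show ?thesis by (intro exI[of _ "max x1 (T + 1)"]) auto
qed

lemma zeta_energy_onto:
  assumes "B \<ge> 0"
  shows "\<exists>T\<ge>0. zeta_energy T = B"
proof -
  obtain S where S: "S \<ge> 0" "zeta_energy S \<ge> B" using zeta_energy_unbounded by blast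
  have "\<exists>T\<ge>0. T \<le> S \<and> zeta_energy T = B"
  proof (rule IVT')
    show "zeta_energy 0 \<le> B" using assms by (simp add: zeta_energy_def)
    show "continuous_on {0..S} zeta_energy"
      by (rule continuous_on_subset[OF zeta_energy_continuous]) auto
  qed (use S in auto)
  then show ?thesis by blast
qed

lemma level_onto:
  assumes "B > level x1"
  shows "\<exists>x>x1. level x = B"
proof -
  obtain V where V: "V \<ge> x1" "level V \<ge> B" using level_unbounded[of B] by blast
  have "\<exists>x\<ge>x1. x \<le> V \<and> level x = B"
  proof (rule IVT')
    show "continuous_on {x1..V} level"
      by (rule continuous_on_subset[OF continuous_on_level]) (use x1 in auto)
  qed (use V assms in auto)
  then obtain x where x: "x \<ge> x1" "level x = B" by blast
  then show ?thesis using assms by (intro exI[of _ x]) (cases "x = x1", auto)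
qed

lemma ladder_phi_eq:
  assumes "T \<ge> 0" "x1 \<le> x" "level x = zeta_energy T"
  shows "T \<in> ladder_dom y0 \<mu>" "ladder_phi y0 \<mu> T = x"
proof -
  have e: "ladder_eq y0 \<mu> T x" using assms x1 by (auto simp: ladder_eq_iff)
  have u: "x' = x" if "ladder_eq y0 \<mu> T x'" for x'
    by (rule level_unique) (use that assms in \<open>auto simp: ladder_eq_iff\<close>)
  have "\<exists>!x. ladder_eq y0 \<mu> T x" using e u by blast
  then show "T \<in> ladder_dom y0 \<mu>" using assms(1) by (simp add: ladder_dom_def)
  show "ladder_phi y0 \<mu> T = x" unfolding ladder_phi_def using e u by (rule the_equality)
qed

definition rung :: "real \<Rightarrow> real" where
  "rung v = (THE t. t \<in> ladder_dom y0 \<mu> \<and> jacobs_ladder y0 \<mu> t = v)"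

lemma reverse_iterate_Suc: "reverse_iterate y0 \<mu> (Suc r) T = rung (reverse_iterate y0 \<mu> r T)"
  by (simp add: rung_def)

text \<open>The wanted t is the one whose energy is \<open>level (2 * v)\<close>. Any rival in
  \<open>ladder_dom\<close> has the same energy, because \<phi> is there a genuine solution of the
  defining equation, and the energy is injective on [0, \<infinity>).\<close>

lemma rung_props:
  assumes "2 * v \<ge> x1"
  shows "rung v \<ge> 0" "zeta_energy (rung v) = level (2 * v)" "jacobs_ladder y0 \<mu> (rung v) = v"
proof -
  have lev: "level (2 * v) > 0" using assms x1 by (intro level_pos \<mu>_ge(2)) auto
  obtain T where T: "T \<ge> 0" "zeta_energy T = level (2 * v)"
    using zeta_energy_onto[of "level (2 * v)"] lev by auto
  note P = ladder_phi_eq[OF T(1) assms T(2)[symmetric]]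
  have j: "jacobs_ladder y0 \<mu> T = v" using P(2) by (simp add: jacobs_ladder_def)
  have "rung v = T" unfolding rung_def
  proof (rule the_equality)
    show "T \<in> ladder_dom y0 \<mu> \<and> jacobs_ladder y0 \<mu> T = v" using P j by blast
  next
    fix t assume t: "t \<in> ladder_dom y0 \<mu> \<and> jacobs_ladder y0 \<mu> t = v"
    then have t0: "t \<ge> 0" and ex: "\<exists>!x. ladder_eq y0 \<mu> t x" unfolding ladder_dom_def by blast+
    have "ladder_eq y0 \<mu> t (ladder_phi y0 \<mu> t)" unfolding ladder_phi_def by (rule theI'[OF ex])
    moreover have "ladder_phi y0 \<mu> t = 2 * v" using t by (simp add: jacobs_ladder_def)
    ultimately have "zeta_energy t = zeta_energy T" using T by (simp add: ladder_eq_iff)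
    then show "t = T"
      using zeta_energy_strict_mono[of t T] zeta_energy_strict_mono[of T t] t0 T(1)
      by (cases t T rule: linorder_cases) auto
  qed
  then show "rung v \<ge> 0" "zeta_energy (rung v) = level (2 * v)" "jacobs_ladder y0 \<mu> (rung v) = v"
    using T j by auto
qed

definition t1 :: real where "t1 = rung (x1 / 2)"

lemma t1: "t1 \<ge> 0" "zeta_energy t1 = level x1"
  using rung_props[of "x1 / 2"] by (auto simp: t1_def)

lemma zeta_energy_less_imp:
  assumes "zeta_energy S < zeta_energy T" "S \<ge> 0" "T \<ge> 0"
  shows "S < T"
  using assms zeta_energy_strict_mono[of T S] by (cases S T rule: linorder_cases) auto

lemma rung_gt:
  assumes "2 * v > x1"
  shows "rung v > t1"
proof (rule zeta_energy_less_imp)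
  show "zeta_energy t1 < zeta_energy (rung v)"
    unfolding t1(2) using assms rung_props(2)[of v] by (simp add: level_less)
qed (use assms rung_props(1)[of v] t1 in auto)

lemma rung_unbounded: "\<exists>V. \<forall>v\<ge>V. rung v \<ge> B"
proof -
  define M where "M = max B 0"
  obtain V where V: "V \<ge> x1" "\<And>x. x \<ge> V \<Longrightarrow> level x \<ge> zeta_energy M + 1"
    using level_unbounded[of "zeta_energy M + 1"] by blast
  have "rung v \<ge> B" if v: "v \<ge> V / 2" for v
  proof -
    have v1: "2 * v \<ge> V" "2 * v \<ge> x1" using v V(1) by linarith+
    have "zeta_energy M < zeta_energy (rung v)"
      using V(2)[OF v1(1)] rung_props(2)[OF v1(2)] by linarith
    then have "M < rung v"
      by (rule zeta_energy_less_imp) (use rung_props(1)[OF v1(2)] in \<open>auto simp: M_def\<close>)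
    then show ?thesis by (simp add: M_def)
  qed
  then show ?thesis by blast
qed

lemma phi_above:
  assumes "T > t1"
  shows "ladder_phi y0 \<mu> T > x1" "level (ladder_phi y0 \<mu> T) = zeta_energy T"
proof -
  have "level x1 < zeta_energy T" using zeta_energy_strict_mono[of t1 T] t1 assms by simp
  then obtain x where x: "x > x1" "level x = zeta_energy T" using level_onto by blast
  have "ladder_phi y0 \<mu> T = x" using x assms t1 by (intro ladder_phi_eq) auto
  then show "ladder_phi y0 \<mu> T > x1" "level (ladder_phi y0 \<mu> T) = zeta_energy T" using x by auto
qed

lemma jacobs_ladder_strict_mono: "strict_mono_on {t1<..} (jacobs_ladder y0 \<mu>)"
proof (rule strict_mono_onI)
  fix S T assume ST: "S \<in> {t1<..}" "T \<in> {t1<..}" "S < T"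
  have e: "zeta_energy S < zeta_energy T" using zeta_energy_strict_mono[of S T] ST t1 by simp
  have "ladder_phi y0 \<mu> S < ladder_phi y0 \<mu> T"
  proof (rule ccontr)
    assume "\<not> ladder_phi y0 \<mu> S < ladder_phi y0 \<mu> T"
    then have "level (ladder_phi y0 \<mu> T) \<le> level (ladder_phi y0 \<mu> S)"
      using level_less[of "ladder_phi y0 \<mu> T" "ladder_phi y0 \<mu> S"] phi_above[of T] ST
      by (cases "ladder_phi y0 \<mu> T = ladder_phi y0 \<mu> S") auto
    then show False using phi_above(2)[of S] phi_above(2)[of T] ST e by simp
  qed
  then show "jacobs_ladder y0 \<mu> S < jacobs_ladder y0 \<mu> T" by (simp add: jacobs_ladder_def)
qed

text \<open>Here \<phi> is the inverse of \<open>level\<close> applied to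
  \<open>zeta_energy\<close>. The derivative obtained is a positive multiple of
  \<open>zeta_crit_sq T\<close>, which may vanish.\<close>

lemma jacobs_ladder_has_derivative:
  assumes "T > t1"
  shows "\<exists>d. (jacobs_ladder y0 \<mu> has_real_derivative d) (at T)"
proof -
  define g where "g = (\<lambda>y. THE x. x1 < x \<and> level x = y)"
  have g: "g (level x) = x" if "x > x1" for x
    unfolding g_def
  proof (rule the_equality)
    fix x' assume "x1 < x' \<and> level x' = level x"
    then have "x1 < x'" "level x' = level x" by auto
    then show "x' = x" using that x1(2) level_unique[of x x'] by simp
  qed (use that in simp)
  define x where "x = ladder_phi y0 \<mu> T"
  have x: "x > x1" "level x = zeta_energy T" using phi_above[OF assms] by (auto simp: x_def)
  obtain d where d: "d > 0" "(level has_real_derivative d) (at x)"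
    using level_has_derivative[of x] x x1 by auto
  have "(g has_real_derivative inverse d) (at (level x))"
  proof (rule has_field_derivative_inverse_strong[OF d(2)])
    show "continuous_on {x1<..} level"
      by (rule continuous_on_subset[OF continuous_on_level]) (use x1 in auto)
  qed (use d x g in auto)
  moreover have "(zeta_energy has_real_derivative zeta_crit_sq T) (at T)"
    using t1 assms by (intro zeta_energy_has_derivative) auto
  ultimately have "((\<lambda>T. g (zeta_energy T)) has_real_derivative inverse d * zeta_crit_sq T) (at T)"
    unfolding x(2) by (rule DERIV_chain2)
  then have "((\<lambda>T. g (zeta_energy T) / 2) has_real_derivative inverse d * zeta_crit_sq T / 2) (at T)"
    by (rule DERIV_cdivide)
  then have "(jacobs_ladder y0 \<mu> has_real_derivative inverse d * zeta_crit_sq T / 2) (at T)"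
  proof (rule has_field_derivative_transform_within_open)
    show "g (zeta_energy S) / 2 = jacobs_ladder y0 \<mu> S" if "S \<in> {t1<..}" for S
      using phi_above[of S] g[of "ladder_phi y0 \<mu> S"] that by (simp add: jacobs_ladder_def)
  qed (use assms in auto)
  then show ?thesis by blast
qed

end

section \<open>Mean values along reverse iterates\<close>

text \<open>The mean value theorem is applied once, on the interval of index k; the point z found
  there is carried down by g, and its images are all the \<open>\<xi> r\<close>.\<close>

lemma mean_value_iterates:
  fixes g A f :: "real \<Rightarrow> real" and a b :: "nat \<Rightarrow> real"
  assumes g: "strict_mono_on {c<..} g" "\<And>t. t > c \<Longrightarrow> \<exists>d. (g has_real_derivative d) (at t)"
    and ab: "\<And>r. r \<le> k \<Longrightarrow> a r < b r" "\<And>r. 1 \<le> r \<Longrightarrow> r \<le> k \<Longrightarrow> a r > c"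
    and step: "\<And>r. r < k \<Longrightarrow> g (a (Suc r)) = a r" "\<And>r. r < k \<Longrightarrow> g (b (Suc r)) = b r"
    and A: "\<And>t. (A has_real_derivative f t) (at t)"
  shows "\<exists>\<xi>. (\<forall>r\<le>k. \<xi> r \<in> {a r<..<b r})
    \<and> A (b 0) - A (a 0) = (b k - a k) * (f (\<xi> 0) * (\<Prod>r=1..k. deriv g (\<xi> r)))"
proof -
  have less: "g s < g t" if "c < s" "s < t" for s t
    using strict_mono_onD[OF g(1), of s t] that by auto
  have ends: "(g ^^ j) (a k) = a (k - j) \<and> (g ^^ j) (b k) = b (k - j)" if "j \<le> k" for j
    using that
  proof (induction j)
    case (Suc j)
    have "k - j = Suc (k - Suc j)" using Suc.prems by simp
    then show ?case using Suc step[of "k - Suc j"] by auto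
  qed auto
  have between: "(g ^^ j) t \<in> {a (k - j)<..<b (k - j)}" if "j \<le> k" "a k < t" "t < b k" for j t
    using that(1)
  proof (induction j)
    case (Suc j)
    have k: "k - j = Suc (k - Suc j)" using Suc.prems by simp
    have "a (k - j) > c" using ab(2)[of "k - j"] Suc.prems by simp
    then have "g (a (k - j)) < g ((g ^^ j) t)" "g ((g ^^ j) t) < g (b (k - j))"
      using Suc less by auto
    then show ?case using step[of "k - Suc j"] Suc.prems by (simp add: k)
  qed (use that in auto)
  \<comment> \<open>For j < k the orbit is in an interval of index k - j \<ge> 1, which lies above
    c. The interval of index 0 is not assumed to do so, but g is never applied there.\<close>
  have closed: "(g ^^ j) t > c" if "j < k" "a k \<le> t" "t \<le> b k" for j t
  proof -
    have "a (k - j) > c" "a (k - j) < b (k - j)" using ab that by auto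
    moreover have "(g ^^ j) t \<ge> a (k - j)"
      using between[of j t] ends[of j] that calculation by (cases "t = a k \<or> t = b k") auto
    ultimately show ?thesis by linarith
  qed
  have der: "((g ^^ j) has_real_derivative (\<Prod>i<j. deriv g ((g ^^ i) t))) (at t)"
    if "j \<le> k" and t: "a k \<le> t" "t \<le> b k" for j t
    using that(1)
  proof (induction j)
    case 0
    have "(g ^^ 0) = (\<lambda>x. x)" by auto
    then show ?case using DERIV_ident[of "at t"] by simp
  next
    case (Suc j)
    obtain d where d: "(g has_real_derivative d) (at ((g ^^ j) t))"
      using g(2)[OF closed[of j t]] Suc.prems t by auto
    then have "deriv g ((g ^^ j) t) = d" by (rule DERIV_imp_deriv)
    with d have "(g has_real_derivative deriv g ((g ^^ j) t)) (at ((g ^^ j) t))" by simp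
    from DERIV_chain2[OF this Suc.IH]
    have "((\<lambda>x. g ((g ^^ j) x)) has_real_derivative deriv g ((g ^^ j) t) * (\<Prod>i<j. deriv g ((g ^^ i) t))) (at t)"
      using Suc.prems by simp
    moreover have "(g ^^ Suc j) = (\<lambda>x. g ((g ^^ j) x))" by (auto simp: fun_eq_iff)
    ultimately show ?case by (simp add: mult.commute)
  qed
  have "\<exists>z>a k. z < b k \<and> A ((g ^^ k) (b k)) - A ((g ^^ k) (a k))
      = (b k - a k) * (f ((g ^^ k) z) * (\<Prod>i<k. deriv g ((g ^^ i) z)))"
  proof (rule MVT2)
    show "a k < b k" using ab by simp
    fix t assume "a k \<le> t" "t \<le> b k"
    then show "((\<lambda>t. A ((g ^^ k) t)) has_real_derivative f ((g ^^ k) t) * (\<Prod>i<k. deriv g ((g ^^ i) t))) (at t)"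
      by (intro DERIV_chain2[OF A der]) auto
  qed
  then obtain z where z: "a k < z" "z < b k" "A ((g ^^ k) (b k)) - A ((g ^^ k) (a k))
      = (b k - a k) * (f ((g ^^ k) z) * (\<Prod>i<k. deriv g ((g ^^ i) z)))" by blast
  define \<xi> where "\<xi> = (\<lambda>r. (g ^^ (k - r)) z)"
  have "\<xi> r \<in> {a r<..<b r}" if "r \<le> k" for r
    using between[of "k - r" z] z that by (simp add: \<xi>_def)
  moreover have "(\<Prod>i<k. deriv g ((g ^^ i) z)) = (\<Prod>r=1..k. deriv g (\<xi> r))"
    unfolding \<xi>_def by (rule prod.reindex_bij_witness[of _ "\<lambda>r. k - r" "\<lambda>i. k - i"]) auto
  ultimately show ?thesis using z(3) ends[of k] by (intro exI[of _ \<xi>]) (simp add: \<xi>_def)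
qed

context ladder
begin

abbreviation iter :: "nat \<Rightarrow> real \<Rightarrow> real" where
  "iter \<equiv> reverse_iterate y0 \<mu>"

lemma rung_less:
  assumes "2 * v > x1" "v < v'"
  shows "rung v < rung v'"
proof (rule ccontr)
  assume "\<not> rung v < rung v'"
  then have "jacobs_ladder y0 \<mu> (rung v') \<le> jacobs_ladder y0 \<mu> (rung v)"
    using strict_mono_onD[OF jacobs_ladder_strict_mono, of "rung v'" "rung v"] rung_gt[of v] rung_gt[of v'] assms
    by (cases "rung v = rung v'") auto
  then show False using rung_props(3)[of v] rung_props(3)[of v'] assms by simp
qed

lemma iterates_large: "\<exists>L. \<forall>T\<ge>L. \<forall>r\<le>k. iter r T \<ge> B"
proof (induction k arbitrary: B)
  case 0
  then show ?case by auto
next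
  case (Suc k)
  obtain V where V: "\<And>v. v \<ge> V \<Longrightarrow> rung v \<ge> B" using rung_unbounded by blast
  obtain L where L: "\<And>T r. T \<ge> L \<Longrightarrow> r \<le> k \<Longrightarrow> iter r T \<ge> max B V" using Suc.IH by blast
  have "iter r T \<ge> B" if "T \<ge> L" "r \<le> Suc k" for T r
  proof (cases "r \<le> k")
    case True
    then show ?thesis using L[of T r] that by simp
  next
    case False
    then have "r = Suc k" using that by simp
    then show ?thesis using V[of "iter k T"] L[of T k] that by (simp only: reverse_iterate_Suc) simp
  qed
  then show ?case by blast
qed

text \<open>\<open>\<xi> 0\<close> lies in the original interval, \<open>\<xi> r\<close> in its r-th
  reverse iterate. For f = 1 the values at r \<ge> 1 are the points \<beta>.\<close>

definition mean_point :: "real \<Rightarrow> real \<Rightarrow> nat \<Rightarrow> (real \<Rightarrow> real) \<Rightarrow> (nat \<Rightarrow> real) \<Rightarrow> bool" where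
  "mean_point U T k f \<xi> \<longleftrightarrow> (\<forall>r\<le>k. \<xi> r \<in> {iter r T<..<iter r (T + U)})
    \<and> integral {T..T + U} f = (iter k (T + U) - iter k T) * (f (\<xi> 0) * (\<Prod>r=1..k. Ztilde_sq y0 \<mu> (\<xi> r)))"

text \<open>The threshold depends on k0 alone: it only has to keep the iterates up to order k0 above
  x1/2, where \<open>rung\<close> inverts the ladder.\<close>

lemma exists_mean_point:
  "\<exists>L. \<forall>T\<ge>L. \<forall>U>0. \<forall>k\<le>k0. \<forall>A f. (\<forall>t. (A has_real_derivative f t) (at t)) \<longrightarrow> (\<exists>\<xi>. mean_point U T k f \<xi>)"
proof -
  obtain L where L: "\<And>T r. T \<ge> L \<Longrightarrow> r \<le> k0 \<Longrightarrow> iter r T \<ge> x1 / 2 + 1"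
    using iterates_large[where k = k0 and B = "x1 / 2 + 1"] by blast
  have "\<exists>\<xi>. mean_point U T k f \<xi>"
    if T: "T \<ge> L" and U: "U > 0" and k: "k \<le> k0" and A: "\<And>t. (A has_real_derivative f t) (at t)" for T U k A f
  proof -
    have big: "2 * iter r S > x1" if "S \<ge> T" "r \<le> k" for S r
      using L[of S r] that T k by simp
    have less: "iter r T < iter r (T + U)" if "r \<le> k" for r
      using that
    proof (induction r)
      case (Suc r)
      then show ?case unfolding reverse_iterate_Suc by (intro rung_less big) auto
    qed (use U in simp)
    have step: "jacobs_ladder y0 \<mu> (iter (Suc r) S) = iter r S" if "S \<ge> T" "r < k" for S r
      unfolding reverse_iterate_Suc using big[of S r] that by (intro rung_props) auto
    have gt: "iter r T > t1" if rk: "1 \<le> r" "r \<le> k" for r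
    proof -
      obtain q where q: "r = Suc q" using rk by (cases r) auto
      show ?thesis unfolding q reverse_iterate_Suc using big[of T q] rk q by (intro rung_gt) auto
    qed
    have "\<exists>\<xi>. (\<forall>r\<le>k. \<xi> r \<in> {iter r T<..<iter r (T + U)})
      \<and> A (iter 0 (T + U)) - A (iter 0 T) = (iter k (T + U) - iter k T)
        * (f (\<xi> 0) * (\<Prod>r=1..k. deriv (jacobs_ladder y0 \<mu>) (\<xi> r)))"
      using less gt step U A
      by (intro mean_value_iterates[OF jacobs_ladder_strict_mono jacobs_ladder_has_derivative]) auto
    moreover have "(f has_integral A (T + U) - A T) {T..T + U}"
      using A U by (intro fundamental_theorem_of_calculus)
        (auto simp flip: has_real_derivative_iff_has_vector_derivative intro: has_field_derivative_at_within)
    then have "integral {T..T + U} f = A (T + U) - A T" by (rule integral_unique)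
    ultimately show ?thesis unfolding mean_point_def Ztilde_sq_def by simp
  qed
  then show ?thesis by blast
qed

lemma mean_point_quotient:
  assumes "U > 0" "mean_point U T k f \<xi>" "mean_point U T k (\<lambda>_. 1) \<eta>"
  shows "f (\<xi> 0) * (\<Prod>r=1..k. Ztilde_sq y0 \<mu> (\<xi> r) / Ztilde_sq y0 \<mu> (\<eta> r)) = integral {T..T + U} f / U"
proof -
  define l where "l = iter k (T + U) - iter k T"
  have f: "integral {T..T + U} f = l * (f (\<xi> 0) * (\<Prod>r=1..k. Ztilde_sq y0 \<mu> (\<xi> r)))"
    using assms(2) by (simp add: mean_point_def l_def)
  have "integral {T..T + U} (\<lambda>_. 1 :: real) = U" using assms(1) by simp
  then have u: "U = l * (\<Prod>r=1..k. Ztilde_sq y0 \<mu> (\<eta> r))"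
    using assms(3) by (simp add: mean_point_def l_def)
  \<comment> \<open>U > 0 forces the length and every factor at \<eta> to be nonzero, so the length
    cancels and no quotient is a division by zero.\<close>
  have "l \<noteq> 0" using u assms(1) by auto
  then show ?thesis unfolding f prod_dividef by (simp add: u)
qed

end

section \<open>Trigonometric integrals and signs of the functions f_1, ..., f_12\<close>

lemma osc_fun_simps:
  "osc_fun 1 t = sin t ^ 2" "osc_fun 2 t = cos t ^ 2" "osc_fun 3 t = sin t ^ 4" "osc_fun 4 t = cos t ^ 4"
  "osc_fun 5 t = sin t ^ 6" "osc_fun 6 t = cos t ^ 6" "osc_fun 7 t = cos (2 * t)" "osc_fun 8 t = cos (4 * t)"
  "osc_fun 9 t = cos (6 * t)" "osc_fun 10 t = sin (2 * t) / (2 * t)" "osc_fun 11 t = sin (4 * t) / (4 * t)"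
  "osc_fun 12 t = sin (6 * t) / (6 * t)"
  by (simp_all add: osc_fun_def)

text \<open>The Fourier coefficients of the first nine functions with respect to \<open>1, cos 2t, cos 4t, cos 6t\<close>.\<close>

definition fourier :: "nat \<Rightarrow> real \<times> real \<times> real \<times> real" where
  "fourier l = [(1/2, -1/2, 0, 0), (1/2, 1/2, 0, 0), (3/8, -1/2, 1/8, 0), (3/8, 1/2, 1/8, 0),
    (5/16, -15/32, 3/16, -1/32), (5/16, 15/32, 3/16, 1/32), (0, 1, 0, 0), (0, 0, 1, 0), (0, 0, 0, 1)] ! (l - 1)"

lemma fourier_simps:
  "fourier 1 = (1/2, -1/2, 0, 0)" "fourier 2 = (1/2, 1/2, 0, 0)" "fourier 3 = (3/8, -1/2, 1/8, 0)"
  "fourier 4 = (3/8, 1/2, 1/8, 0)" "fourier 5 = (5/16, -15/32, 3/16, -1/32)"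
  "fourier 6 = (5/16, 15/32, 3/16, 1/32)" "fourier 7 = (0, 1, 0, 0)" "fourier 8 = (0, 0, 1, 0)"
  "fourier 9 = (0, 0, 0, 1)"
  by (simp_all add: fourier_def)

lemma atLeastAtMost_1_9: "{1..9::nat} = {1, 2, 3, 4, 5, 6, 7, 8, 9}"
  by auto

lemma cos_multiples:
  fixes t :: real
  shows "sin t ^ 2 = (1 - cos (2 * t)) / 2" "cos t ^ 2 = (1 + cos (2 * t)) / 2"
    "cos (4 * t) = 2 * cos (2 * t) ^ 2 - 1" "cos (6 * t) = 4 * cos (2 * t) ^ 3 - 3 * cos (2 * t)"
proof -
  show "sin t ^ 2 = (1 - cos (2 * t)) / 2" by (simp add: cos_double_sin)
  show "cos t ^ 2 = (1 + cos (2 * t)) / 2" by (simp add: cos_double_cos)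
  show "cos (4 * t) = 2 * cos (2 * t) ^ 2 - 1" using cos_double_cos[of "2 * t"] by simp
  show "cos (6 * t) = 4 * cos (2 * t) ^ 3 - 3 * cos (2 * t)" using cos_treble_cos[of "2 * t"] by simp
qed

text \<open>All nine functions are polynomials in cos 2t, so after rewriting powers and multiple
  angles only polynomial algebra remains.\<close>

lemma osc_fun_fourier:
  assumes "l \<in> {1..9}" "fourier l = (c0, c1, c2, c3)"
  shows "osc_fun l t = c0 + c1 * cos (2 * t) + c2 * cos (4 * t) + c3 * cos (6 * t)"
proof -
  have p: "x ^ 4 = (x ^ 2) ^ 2" "x ^ 6 = (x ^ 2) ^ 3" for x :: real by (simp_all flip: power_mult)
  consider "l = 1" | "l = 2" | "l = 3" | "l = 4" | "l = 5" | "l = 6" | "l = 7" | "l = 8" | "l = 9"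
    using assms(1) unfolding atLeastAtMost_1_9 by auto
  then show ?thesis
    by cases (use assms(2) in \<open>auto simp only: fourier_simps prod.inject osc_fun_simps p cos_multiples[of t]\<close>,
      simp_all add: field_simps power2_eq_square power3_eq_cube)
qed

lemma sin_cos_shift_pi_int:
  fixes x :: real and L :: int
  shows "sin (2 * (pi * L) + x) = sin x" "cos (2 * (pi * L) + x) = cos x"
  by (simp_all add: sin_add cos_add mult.assoc[symmetric] sin_integer_2pi cos_integer_2pi)

lemma integral_osc_fun:
  fixes L :: int
  assumes "l \<in> {1..9}" "fourier l = (c0, c1, c2, c3)" "U > 0"
  shows "integral {pi * L..pi * L + U} (osc_fun l) / U
    = c0 + c1 * osc_fun 10 U + c2 * osc_fun 11 U + c3 * osc_fun 12 U"
    and "\<exists>A. \<forall>t. (A has_real_derivative osc_fun l t) (at t)"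
proof -
  define A where "A = (\<lambda>t. c0 * t + c1 * (sin (2 * t) / 2) + c2 * (sin (4 * t) / 4) + c3 * (sin (6 * t) / 6))"
  have A: "(A has_real_derivative osc_fun l t) (at t)" for t
    unfolding osc_fun_fourier[OF assms(1,2)] A_def by (auto intro!: derivative_eq_intros)
  then show "\<exists>A. \<forall>t. (A has_real_derivative osc_fun l t) (at t)" by blast
  have "(osc_fun l has_integral A (pi * L + U) - A (pi * L)) {pi * L..pi * L + U}"
    using A assms(3) by (intro fundamental_theorem_of_calculus)
      (auto simp flip: has_real_derivative_iff_has_vector_derivative intro: has_field_derivative_at_within)
  then have I: "integral {pi * L..pi * L + U} (osc_fun l) = A (pi * L + U) - A (pi * L)" by (rule integral_unique)
  \<comment> \<open>These sines have period \<pi>, so the integral over [\<pi>L, \<pi>L + U] does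
    not depend on L.\<close>
  have s: "sin (real m * 2 * (pi * L + x)) = sin (real m * 2 * x)" for m x
    using sin_cos_shift_pi_int(1)[of "int m * L" "real m * 2 * x"] by (simp add: algebra_simps)
  have "sin (2 * (pi * L + x)) = sin (2 * x)" "sin (4 * (pi * L + x)) = sin (4 * x)"
    "sin (6 * (pi * L + x)) = sin (6 * x)" for x
    using s[of 1 x] s[of 2 x] s[of 3 x] by simp_all
  from this[of U] this[of 0]
  have "A (pi * L + U) - A (pi * L) = c0 * U + c1 * (sin (2 * U) / 2) + c2 * (sin (4 * U) / 4) + c3 * (sin (6 * U) / 6)"
    by (simp add: A_def algebra_simps)
  then show "integral {pi * L..pi * L + U} (osc_fun l) / U
    = c0 + c1 * osc_fun 10 U + c2 * osc_fun 11 U + c3 * osc_fun 12 U"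
    unfolding I osc_fun_simps using assms(3) by (simp add: field_simps)
qed

text \<open>With s the distance from \<pi>L, even 6s stays below \<pi>/2, so the cosines are
  positive, and s > 0 keeps the sine from vanishing.\<close>

lemma osc_fun_pos:
  fixes L :: int
  assumes "l \<in> {1..9}" "pi * L < t" "t < pi * L + U" "U < pi / 12"
  shows "osc_fun l t > 0"
proof -
  define s where "s = t - pi * L"
  have s: "0 < s" "s < pi / 12" using assms by (auto simp: s_def)
  have t: "t = pi * L + s" by (simp add: s_def)
  have c2: "cos (2 * t) = cos (2 * s)"
    using sin_cos_shift_pi_int(2)[of L "2 * s"] by (simp add: t algebra_simps)
  have c4: "cos (4 * t) = cos (4 * s)"
    using sin_cos_shift_pi_int(2)[of "2 * L" "4 * s"] by (simp add: t algebra_simps)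
  have c6: "cos (6 * t) = cos (6 * s)"
    using sin_cos_shift_pi_int(2)[of "3 * L" "6 * s"] by (simp add: t algebra_simps)
  have pos: "cos (2 * s) > 0" "cos (4 * s) > 0" "cos (6 * s) > 0"
    using s by (auto intro!: cos_gt_zero)
  have "cos (2 * s) < cos 0" using s by (intro cos_monotone_0_pi) auto
  then have sn: "sin t ^ 2 > 0" unfolding cos_multiples(1) c2 by simp
  have cn: "cos t ^ 2 > 0" unfolding cos_multiples(2) c2 using pos by simp
  have p: "x ^ 4 = (x ^ 2) ^ 2" "x ^ 6 = (x ^ 2) ^ 3" for x :: real by (simp_all flip: power_mult)
  consider "l = 1" | "l = 2" | "l = 3" | "l = 4" | "l = 5" | "l = 6" | "l = 7" | "l = 8" | "l = 9"
    using assms(1) unfolding atLeastAtMost_1_9 by auto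
  then show ?thesis
    by cases (simp_all only: osc_fun_simps p c2 c4 c6 pos sn cn zero_less_power)
qed

lemma osc_fun_pos':
  assumes "l \<in> {10..12}" "0 < U" "U < pi / 12"
  shows "osc_fun l U > 0"
proof -
  have "sin (2 * U) > 0" "sin (4 * U) > 0" "sin (6 * U) > 0"
    using assms by (auto intro!: sin_gt_zero)
  then have "osc_fun 10 U > 0" "osc_fun 11 U > 0" "osc_fun 12 U > 0"
    unfolding osc_fun_simps using assms by simp_all
  moreover have "{10..12::nat} = {10, 11, 12}" by auto
  ultimately show ?thesis using assms(1) by auto
qed

section \<open>The sets W and the assembly of the equalities\<close>

lemma strip_center_bounds:
  assumes "strip_conditions \<sigma>1 \<sigma>2 \<sigma>0 \<delta>" "l \<in> {1..12}"
  shows "1 / 2 < \<sigma>0 l" "\<sigma>0 l < 1" "\<delta> > 0"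
proof -
  have s: "\<sigma>0 i < \<sigma>0 (Suc i)" if "1 \<le> i" "i \<le> 11" for i
    using assms(1) that by (auto simp: strip_conditions_def)
  have lo: "\<sigma>0 1 \<le> \<sigma>0 i" if "1 \<le> i" "i \<le> 12" for i
    using that by (induction i rule: dec_induct) (use s in force)+
  have hi: "\<sigma>0 i \<le> \<sigma>0 12" if "i \<le> 12" "1 \<le> i" for i
    using that by (induction i rule: inc_induct) (use s in force)+
  show "1 / 2 < \<sigma>0 l" "\<sigma>0 l < 1" "\<delta> > 0"
    using lo[of l] hi[of l] assms by (auto simp: strip_conditions_def)
qed

lemma admissible_bounds:
  assumes "admissible n0 U" "n \<in> {1..n0}"
  shows "0 < U n" "U n < pi / 12"
proof -
  have s: "U i < U (Suc i)" if "1 \<le> i" "i < n0" for i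
    using assms(1) that by (auto simp: admissible_def)
  have lo: "U 1 \<le> U i" if "1 \<le> i" "i \<le> n0" for i
    using that by (induction i rule: dec_induct) (use s in force)+
  have hi: "U i \<le> U n0" if "i \<le> n0" "1 \<le> i" for i
    using that by (induction i rule: inc_induct) (use s in force)+
  show "0 < U n" "U n < pi / 12"
    using lo[of n] hi[of n] assms by (auto simp: admissible_def)
qed

text \<open>The centre line of the strip already contains infinitely many such points.\<close>

lemma infinite_zeta_level_set:
  assumes "1 / 2 < \<sigma>" "\<sigma> < 1" "\<delta> > 0" "y > 0"
  shows "infinite {w \<in> half_strip \<sigma> \<delta>. norm (zeta w) = y}"
proof
  assume fin: "finite {w \<in> half_strip \<sigma> \<delta>. norm (zeta w) = y}"
  have "Complex \<sigma> ` {t. t > 0 \<and> norm (zeta (Complex \<sigma> t)) = y} \<subseteq> {w \<in> half_strip \<sigma> \<delta>. norm (zeta w) = y}"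
    using assms(3) by (auto simp: half_strip_def)
  then have "finite (Complex \<sigma> ` {t. t > 0 \<and> norm (zeta (Complex \<sigma> t)) = y})"
    using fin by (rule finite_subset)
  then have "finite {t. t > 0 \<and> norm (zeta (Complex \<sigma> t)) = y}"
    by (rule finite_imageD) (auto simp: inj_on_def)
  then show False using infinite_zeta_modulus_values[OF assms(1,2,4)] by blast
qed

theorem mainTheorem1:
  fixes y0 :: real and \<mu> :: "real \<Rightarrow> real"
  assumes "0 < y0"
    and "mono_on {y0..} \<mu>"
    and "smooth_on_ray y0 \<mu>"
    and "\<forall>y\<ge>y0. \<mu> y \<ge> 7 * y * ln y"
  shows "\<exists>(\<alpha> :: real \<Rightarrow> real \<Rightarrow> nat \<Rightarrow> (real \<Rightarrow> real) \<Rightarrow> nat \<Rightarrow> real)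
          (\<beta> :: real \<Rightarrow> real \<Rightarrow> nat \<Rightarrow> nat \<Rightarrow> real).
    \<forall>(k0 :: nat) \<sigma>1 \<sigma>2 \<sigma>0 \<delta> n0 U.
      strip_conditions \<sigma>1 \<sigma>2 \<sigma>0 \<delta> \<longrightarrow> admissible n0 U \<longrightarrow>
      (\<exists>L0 :: real. L0 > 0 \<and> (\<forall>(L :: int) (k :: nat \<Rightarrow> nat).
        real_of_int L \<ge> L0 \<longrightarrow> (\<forall>l\<in>{1..9}. 1 \<le> k l \<and> k l \<le> k0) \<longrightarrow>
        (\<forall>n\<in>{1..n0}.
          let A = (\<lambda>l r. \<alpha> (U n) (pi * L) (k l) (osc_fun l) r);
              B = (\<lambda>l r. \<beta> (U n) (pi * L) (k l) r);
              I = (\<lambda>r. {reverse_iterate y0 \<mu> r (pi * L) <..< reverse_iterate y0 \<mu> r (pi * L + U n)});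
              P = (\<lambda>l. \<Prod>r = 1..k l. Ztilde_sq y0 \<mu> (A l r) / Ztilde_sq y0 \<mu> (B l r))
          in (\<forall>l\<in>{1..9}. A l 0 \<in> {pi * L <..< pi * L + U n} \<and>
                (\<forall>r\<in>{1..k l}. A l r \<in> I r \<and> B l r \<in> I r)) \<and>
             (\<exists>W :: nat \<Rightarrow> complex set.
                (\<forall>l\<in>{1..12}. infinite (W l) \<and> W l \<subseteq> half_strip (\<sigma>0 l) \<delta>) \<and>
                (\<forall>w :: nat \<Rightarrow> complex. (\<forall>l\<in>{1..12}. w l \<in> W l) \<longrightarrow>
                  (let z = (\<lambda>l. cmod (zeta (w l))) in
                   (\<forall>l\<in>{1..9}. z l = osc_fun l (A l 0)) \<and>
                   (\<forall>l\<in>{10..12}. z l = osc_fun l (U n)) \<and>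
                   z 1 * P 1 = 1/2 - 1/2 * z 10 \<and>
                   z 2 * P 2 = 1/2 + 1/2 * z 10 \<and>
                   z 3 * P 3 = 3/8 - 1/2 * z 10 + 1/8 * z 11 \<and>
                   z 4 * P 4 = 3/8 + 1/2 * z 10 + 1/8 * z 11 \<and>
                   z 5 * P 5 = 5/16 - 15/32 * z 10 + 3/16 * z 11 - 1/32 * z 12 \<and>
                   z 6 * P 6 = 5/16 + 15/32 * z 10 + 3/16 * z 11 + 1/32 * z 12 \<and>
                   z 7 * P 7 = z 10 \<and> z 8 * P 8 = z 11 \<and> z 9 * P 9 = z 12))))))"
proof -
  interpret ladder y0 \<mu> using assms by unfold_locales auto
  \<comment> \<open>The choice sees only (U, T, k, f), and \<beta> is its value at f = 1. This
    yields the required dependence, with both functions fixed before k0, the strips and the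
    admissible set.\<close>
  define \<alpha> where "\<alpha> = (\<lambda>U T k f. SOME \<xi>. mean_point U T k f \<xi>)"
  define \<beta> where "\<beta> = (\<lambda>U T k. \<alpha> U T k (\<lambda>_. 1))"
  show ?thesis
  proof (rule exI[of _ \<alpha>], rule exI[of _ \<beta>], intro allI impI, goal_cases)
    case (1 k0 \<sigma>1 \<sigma>2 \<sigma>0 \<delta> n0 U)
    note strip = 1(1) and adm = 1(2)
    obtain L1 where L1: "\<And>T U k A f. T \<ge> L1 \<Longrightarrow> U > 0 \<Longrightarrow> k \<le> k0 \<Longrightarrow>
        (\<forall>t. (A has_real_derivative f t) (at t)) \<Longrightarrow> \<exists>\<xi>. mean_point U T k f \<xi>"
      using exists_mean_point[of k0] by blast
    show ?case
    \<comment> \<open>L \<ge> 1 is what gives \<pi>L \<ge> L \<ge> L1.\<close>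
    proof (rule exI[of _ "max 1 L1"], intro conjI allI impI ballI, goal_cases)
      case (2 L k n)
      note L = 2(1) and k = 2(2) and n = 2(3)
      define T where "T = pi * real_of_int L"
      note U = admissible_bounds[OF adm n]
      have "1 * real_of_int L \<le> pi * real_of_int L" using L pi_ge_two by (intro mult_right_mono) auto
      then have T: "T \<ge> L1" using L unfolding T_def by linarith
      have mp: "mean_point (U n) T (k l) f (\<alpha> (U n) T (k l) f)"
        if l: "l \<in> {1..9}" and A: "\<exists>A. \<forall>t. (A has_real_derivative f t) (at t)" for l f
      proof -
        obtain A where "\<forall>t. (A has_real_derivative f t) (at t)" using A by blast
        then have "\<exists>\<xi>. mean_point (U n) T (k l) f \<xi>" using L1 T U(1) k l by blast
        then show ?thesis unfolding \<alpha>_def by (rule someI_ex)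
      qed
      have fou: "\<exists>c0 c1 c2 c3. fourier l = (c0, c1, c2, c3)" for l by (metis prod.exhaust)
      have mpA: "mean_point (U n) T (k l) (osc_fun l) (\<alpha> (U n) T (k l) (osc_fun l))" if "l \<in> {1..9}" for l
        using fou[of l] integral_osc_fun(2)[OF that _ U(1)] by (intro mp that) blast
      have "\<forall>t. ((\<lambda>t. t) has_real_derivative 1) (at t)" by simp
      then have mpB: "mean_point (U n) T (k l) (\<lambda>_. 1) (\<beta> (U n) T (k l))" if "l \<in> {1..9}" for l
        unfolding \<beta>_def by (intro mp that) blast
      \<comment> \<open>These prescribed moduli do not involve w, so the equalities hold for every
        choice of points in W.\<close>
      define y where "y = (\<lambda>l. if l \<le> 9 then osc_fun l (\<alpha> (U n) T (k l) (osc_fun l) 0) else osc_fun l (U n))"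
      have inA: "\<alpha> (U n) T (k l) (osc_fun l) r \<in> {iter r T<..<iter r (T + U n)}" if "l \<in> {1..9}" "r \<le> k l" for l r
        using mpA[OF that(1)] that(2) unfolding mean_point_def by blast
      have inB: "\<beta> (U n) T (k l) r \<in> {iter r T<..<iter r (T + U n)}" if "l \<in> {1..9}" "r \<le> k l" for l r
        using mpB[OF that(1)] that(2) unfolding mean_point_def by blast
      have y_pos: "y l > 0" if l: "l \<in> {1..12}" for l
      proof (cases "l \<le> 9")
        case True
        then have "l \<in> {1..9}" using l by simp
        then show ?thesis using True inA[of l 0] U by (auto simp: y_def T_def intro!: osc_fun_pos)
      next
        case False
        then have "l \<in> {10..12}" using l by simp
        then show ?thesis using False osc_fun_pos'[of l "U n"] U by (simp add: y_def)
      qed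
      define W where "W = (\<lambda>l. {w \<in> half_strip (\<sigma>0 l) \<delta>. norm (zeta w) = y l})"
      show ?case
        unfolding Let_def T_def[symmetric]
      proof (intro conjI exI[of _ W], goal_cases)
        case 1
        show ?case using inA inB inA[of _ 0] by simp
      next
        case 2
        show ?case
          using infinite_zeta_level_set strip_center_bounds[OF strip] y_pos unfolding W_def by blast
      next
        case 3
        show ?case
        proof (intro allI impI, goal_cases)
          case (1 w)
          note w = 1
          have z: "norm (zeta (w l)) = y l" if "l \<in> {1..12}" for l
            using w that unfolding W_def by blast
          \<comment> \<open>One identity with symbolic Fourier coefficients; the nine equalities are
            its instances.\<close>
          have eq: "norm (zeta (w l)) * (\<Prod>r=1..k l. Ztilde_sq y0 \<mu> (\<alpha> (U n) T (k l) (osc_fun l) r)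
              / Ztilde_sq y0 \<mu> (\<beta> (U n) T (k l) r))
            = c0 + c1 * norm (zeta (w 10)) + c2 * norm (zeta (w 11)) + c3 * norm (zeta (w 12))"
            if l: "l \<in> {1..9}" and c: "fourier l = (c0, c1, c2, c3)" for l c0 c1 c2 c3
            using mean_point_quotient[OF U(1) mpA[OF l] mpB[OF l]] integral_osc_fun(1)[OF l c U(1), of L] l
            by (simp add: z y_def T_def)
          have z_low: "\<forall>l\<in>{1..9}. norm (zeta (w l)) = osc_fun l (\<alpha> (U n) T (k l) (osc_fun l) 0)"
            and z_high: "\<forall>l\<in>{10..12}. norm (zeta (w l)) = osc_fun l (U n)"
            by (simp_all add: z y_def)
          show ?case
            by (intro conjI z_low z_high)
              (use fourier_simps[THEN eq[rotated]] in simp_all)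
        qed
      qed
    qed simp
  qed
qed

end
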